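(* Let $\Omega\subset\mathbb{R}^2$ be a compact convex set with nonempty interior and let $f:\mathbb{R}^2\to\mathbb{R}$ be a $C^2$ function. Assume that a convex function $u:\Omega\to\mathbb{R}$, an open set $\mathcal{U}\subset\Omega$, and a point $\check x\in\mathcal{U}$ are such that (i) $u$ is $C^1$ in $\mathcal{U}$; (ii) $(\check x,u(\check x))$ is an extreme point of $\operatorname{epi}(u)$; (iii) the smallest eigenvalue of $f''(\nabla u(\check x))$ is nonzero. Then for any $\varepsilon>0$ there is a convex function $u_1$ on $\Omega$ such that (a) $u_1=u$ on $\Omega\setminus\mathcal{U}$; (b) $|u-u_1|<\varepsilon$; and (c) $F(u_1)<F(u)$.
   Context: For a convex function $u$ on $\Omega$, $F(u)=\int_\Omega f(\nabla u(x))\,dx$ (the gradient $\nabla u$ exists almost everywhere in $\Omega$ and is measurable), and $\operatorname{epi}(u)=\{(x,z): x\in\Omega,\ z\ge u(x)\}\subset\mathbb{R}^3$ is the epigraph of $u$. $f''$ denotes the second derivative (Hessian matrix) of $f$.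
   Formalization: It is additionally assumed that f(∇u) is integrable on Ω, so F(u) is finite; without this the claim can fail: on the unit disc with u=-√(1-|x|²), f(p)=|p|⁴+|p|² and U a small disc, F(u)=F(u₁)=+∞ for every u₁. *)

theory Defs
  imports "HOL-Analysis.Analysis"
begin

text \<open>
  Functions given only on a planar set \<open>\<Omega>\<close> are represented by total functions on \<open>real^2\<close>.
  Derivatives are always taken at a point of the whole plane, so at an interior point of \<open>\<Omega>\<close>
  they depend only on the restriction of the function to \<open>\<Omega>\<close>.
\<close>

definition grad :: "('a::real_inner \<Rightarrow> real) \<Rightarrow> 'a \<Rightarrow> 'a" where
  "grad u x = (THE D. GDERIV u x :> D)"

definition C1_on :: "'a::real_inner set \<Rightarrow> ('a \<Rightarrow> real) \<Rightarrow> bool" where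
  "C1_on U u \<longleftrightarrow> (\<forall>x\<in>U. u differentiable (at x)) \<and> continuous_on U (grad u)"

definition hessian :: "(real^'n \<Rightarrow> real) \<Rightarrow> real^'n \<Rightarrow> real^'n^'n" where
  "hessian f x = jacobian (grad f) (at x)"

definition C2 :: "(real^'n \<Rightarrow> real) \<Rightarrow> bool" where
  "C2 f \<longleftrightarrow> (\<forall>x. f differentiable (at x)) \<and> (\<forall>x. grad f differentiable (at x)) \<and>
    continuous_on UNIV (hessian f)"

definition eigenvalues :: "real^'n^'n \<Rightarrow> real set" where
  "eigenvalues A = {k. \<exists>v. v \<noteq> 0 \<and> A *v v = k *\<^sub>R v}"

text \<open>
  Meant for symmetric matrices (such as Hessians of \<open>C\<^sup>2\<close> functions), whose set of
  real eigenvalues is finite and nonempty.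
\<close>

definition smallest_eigenvalue :: "real^'n^'n \<Rightarrow> real" where
  "smallest_eigenvalue A = Min (eigenvalues A)"

text \<open>
  A convex function on a convex set \<open>\<Omega>\<close> is differentiable almost everywhere in \<open>\<Omega>\<close>, the
  boundary of \<open>\<Omega>\<close> being a null set. The integral is the Lebesgue integral for the complete
  measure \<^const>\<open>lebesgue\<close>, so the values of \<^const>\<open>grad\<close> on the exceptional null set
  influence neither measurability nor the value. The functional is a finite number exactly when
  \<open>energy_finite\<close> holds; the library integral would otherwise be the default value \<open>0\<close>.
\<close>

definition energy_finite :: "(real^2 \<Rightarrow> real) \<Rightarrow> (real^2) set \<Rightarrow> (real^2 \<Rightarrow> real) \<Rightarrow> bool" where
  "energy_finite f \<Omega> u \<longleftrightarrow> set_integrable lebesgue \<Omega> (\<lambda>x. f (grad u x))"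

definition energy :: "(real^2 \<Rightarrow> real) \<Rightarrow> (real^2) set \<Rightarrow> (real^2 \<Rightarrow> real) \<Rightarrow> real" where
  "energy f \<Omega> u = set_lebesgue_integral lebesgue \<Omega> (\<lambda>x. f (grad u x))"

lemma grad_eqI:
  assumes "GDERIV u x :> D"
  shows "grad u x = D"
  unfolding grad_def
proof (rule the_equality)
  show "GDERIV u x :> D" by fact
  fix E assume "GDERIV u x :> E"
  then have "(\<lambda>h. inner h E) = (\<lambda>h. inner h D)"
    using assms has_derivative_unique unfolding gderiv_def by blast
  then have "inner (E - D) (E - D) = 0"
    by (metis cancel_comm_monoid_add_class.diff_cancel inner_diff_right)
  then show "E = D" by simp
qed

end

theory Submission imports Defs begin

text \<open>
  Near the extreme point an affine function cuts a cap with compact base off the graph of \<open>u\<close>. Subtracting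
  it, we may assume that \<open>u \<ge> 0\<close> on a small disc, \<open>u > 0\<close> on the bounding circle and \<open>u m = 0\<close>, \<open>\<nabla>u m = 0\<close>
  at some point \<open>m\<close> of the disc. A change of \<open>u\<close> inside the disc does not change the integral of its gradient,
  so an affine function may be added to \<open>f\<close> at will. The smallest eigenvalue of the Hessian being nonzero,
  either the Hessian is positive definite or it is negative in some direction \<open>e\<close>.

  In the first case \<open>f\<close> minus its tangent at \<open>0\<close> is positive at all other gradients, and \<open>max u h\<close> has less
  energy than \<open>u\<close> for small \<open>h > 0\<close>. In the second case take two points \<open>p\<close>, \<open>q\<close> with \<open>q - p\<close> perpendicular
  to \<open>e\<close> and a small \<open>z < 0\<close>. The supporting planes of \<open>u\<close> through both \<open>(p, z)\<close> and \<open>(q, z)\<close> have gradients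
  \<open>r e\<close> and \<open>- r' e\<close>; add an affine function to \<open>f\<close> that makes it vanish there, so that it is positive on the
  segment in between. There are two competitors: the first has as epigraph the convex hull of the epigraph
  of \<open>u\<close> and of the two points, the second the intersection of the epigraph of \<open>u\<close> with its two dilations of
  ratio \<open>1 + s\<close> about these points. If \<open>E\<close> and \<open>E'\<close> are the energies of \<open>u\<close> and of the first competitor, then that
  of the second one is at most \<open>E + 2 s (E - E') - \<kappa> s + o(s)\<close> with \<open>\<kappa> > 0\<close>, so one of the two improves on \<open>u\<close>.
\<close>


subsection \<open>Convex functions are differentiable almost everywhere\<close>

text \<open>As \<open>u\<close> is merely C^1, nothing is known of its second derivatives and no
  second variation is available; the competitors come from the convex geometry of the epigraph
  alone. The factor 2 in \<open>2 s (E - E')\<close> is the dimension, since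
  \<open>(1 + s)^2 - 1\<close> is about \<open>2 s\<close>. The hull with one point is a cone over
  the part of the graph visible from it, and a dilation about its apex leaves a cone invariant; so a
  dilation about one point acts, to first order, as the reverse of adding that point. With a single
  point a tie \<open>E = E'\<close> would therefore decide nothing, and this is why two points are
  used. The two dilated graphs are shifted against each other along \<open>q - p\<close>, and a
  strip of the old graph is lost where the slope along \<open>q - p\<close> changes sign. Its area
  is of order \<open>s\<close>, and on a part of it of that order the integrand is bounded below by
  a positive constant: this is the gain \<open>\<kappa> s\<close>. On the hull with both points, the
  planes containing both tips have exactly the gradients at which the integrand was made to vanish,
  so the edge between the tips does not spoil the comparison.\<close>

lemma integral_lebesgue_affine:
  fixes g :: "'a::euclidean_space \<Rightarrow> real"
  assumes g[measurable]: "g \<in> borel_measurable lebesgue" and c: "c \<noteq> 0"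
  shows "integral\<^sup>L lebesgue g = \<bar>c\<bar> ^ DIM('a) * integral\<^sup>L lebesgue (\<lambda>x. g (t + c *\<^sub>R x))"
proof -
  let ?T = "\<lambda>x::'a. t + c *\<^sub>R x"
  have T: "(\<lambda>x. t + (\<Sum>j\<in>Basis. (c * (x \<bullet> j)) *\<^sub>R j)) = ?T"
    by (simp flip: scaleR_scaleR scaleR_sum_right add: euclidean_representation)
  have m[measurable]: "?T \<in> lebesgue \<rightarrow>\<^sub>M lebesgue"
    using lebesgue_affine_measurable[of "\<lambda>_. c" t] c by (simp add: T)
  have "lebesgue = density (distr lebesgue lebesgue ?T) (\<lambda>_. \<bar>c\<bar> ^ DIM('a))"
    using lebesgue_affine_euclidean[of "\<lambda>_. c" t] c by (simp add: T)
  then have "integral\<^sup>L lebesgue g = integral\<^sup>L (density (distr lebesgue lebesgue ?T) (\<lambda>_. \<bar>c\<bar> ^ DIM('a))) g"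
    by simp
  also have "\<dots> = \<bar>c\<bar> ^ DIM('a) * integral\<^sup>L lebesgue (\<lambda>x. g (?T x))"
    by (subst integral_density) (simp_all add: integral_distr)
  finally show ?thesis .
qed

text \<open>The translates of \<open>A\<close> by \<open>(k / N) i\<close> with \<open>k < N\<close>
  are disjoint and lie in one ball whatever \<open>N\<close> is, so \<open>N\<close> times the
  measure of \<open>A\<close> is bounded for all \<open>N\<close>. This elementary argument takes
  the place of Fubini.\<close>

lemma negligible_disjoint_translates:
  fixes A :: "'a::euclidean_space set"
  assumes A: "A \<in> sets lebesgue" "bounded A"
    and disj: "\<And>x t. x \<in> A \<Longrightarrow> t \<noteq> 0 \<Longrightarrow> x + t *\<^sub>R i \<notin> A"
  shows "negligible A"
proof -
  have lm: "A \<in> lmeasurable" using A bounded_set_imp_lmeasurable by blast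
  obtain r where r: "\<And>x. x \<in> A \<Longrightarrow> norm x \<le> r" using A(2) bounded_iff by metis
  let ?C = "cball (0::'a) (r + norm i)"
  have bd: "real N * measure lebesgue A \<le> measure lebesgue ?C" if "N > 0" for N :: nat
  proof -
    define T where "T k = (\<lambda>x. x + (real k / real N) *\<^sub>R i) ` A" for k :: nat
    have eq: "T k = (+) ((real k / real N) *\<^sub>R i) ` A" for k
      by (auto simp: T_def add.commute)
    have lmT: "T k \<in> lmeasurable" and mT: "measure lebesgue (T k) = measure lebesgue A" for k
      unfolding eq using lm by (simp_all add: measurable_translation measure_translation)
    have dj: "disjoint_family_on T {..<N}"
      unfolding disjoint_family_on_def
    proof (intro ballI impI, rule ccontr)
      fix m n assume mn: "m \<in> {..<N}" "n \<in> {..<N}" "m \<noteq> n" "T m \<inter> T n \<noteq> {}"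
      then obtain x y where xy: "x \<in> A" "y \<in> A"
        "x + (real m / real N) *\<^sub>R i = y + (real n / real N) *\<^sub>R i" by (auto simp: T_def)
      then have "y = x + (real m / real N - real n / real N) *\<^sub>R i"
        by (simp add: algebra_simps)
      moreover have "real m / real N - real n / real N \<noteq> 0" using mn that by simp
      ultimately show False using disj xy by metis
    qed
    have "real N * measure lebesgue A = (\<Sum>k<N. measure lebesgue (T k))" by (simp add: mT)
    also have "\<dots> = measure lebesgue (\<Union>k<N. T k)"
      using lmT dj by (intro measure_finite_Union[symmetric]) (use fmeasurableD[OF lmT] fmeasurableD2[OF lmT] in auto)
    also have "\<dots> \<le> measure lebesgue ?C"
    proof (rule measure_mono_fmeasurable)
      show "(\<Union>k<N. T k) \<subseteq> ?C"
      proof clarsimp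
        fix k y assume k: "k < N" and "y \<in> T k"
        then obtain x where x: "x \<in> A" "y = x + (real k / real N) *\<^sub>R i" by (auto simp: T_def)
        have "norm y \<le> norm x + norm ((real k / real N) *\<^sub>R i)" unfolding x by (rule norm_triangle_ineq)
        also have "norm ((real k / real N) *\<^sub>R i) \<le> 1 * norm i"
          using k by (simp add: divide_simps mult_right_mono mult.commute)
        finally show "norm y \<le> r + norm i" using r[OF x(1)] by simp
      qed
      show "(\<Union>k<N. T k) \<in> sets lebesgue" using lmT by (auto simp: fmeasurable_def)
    qed simp
    finally show ?thesis .
  qed
  have "measure lebesgue A = 0"
  proof (rule ccontr)
    assume "measure lebesgue A \<noteq> 0"
    then have pos: "measure lebesgue A > 0" by (simp add: zero_less_measure_iff)
    obtain N :: nat where N: "real N * measure lebesgue A > measure lebesgue ?C"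
      using reals_Archimedean3[OF pos] by blast
    have "N > 0" using N by (cases N) (auto simp: not_less)
    with bd[of N] N show False by simp
  qed
  then show ?thesis using lm negligible_iff_measure by blast
qed

lemma convex_near_zero:
  fixes p :: "'a::real_normed_vector \<Rightarrow> real"
  assumes p: "convex_on (ball 0 \<rho>) p" "p 0 = 0" and \<rho>: "\<rho> > 0"
  shows "\<lbrakk>norm h < \<rho>; 0 \<le> t; t \<le> 1\<rbrakk> \<Longrightarrow> p (t *\<^sub>R h) \<le> t * p h"
    and "norm h < \<rho> \<Longrightarrow> - p h \<le> p (- h)"
proof -
  assume h: "norm h < \<rho>" "0 \<le> t" "t \<le> 1"
  show "p (t *\<^sub>R h) \<le> t * p h"
    using convex_onD[OF p(1) h(2,3), of 0 h] h \<rho> p(2) by simp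
next
  assume h: "norm h < \<rho>"
  have "p ((1 - 1/2) *\<^sub>R h + (1/2) *\<^sub>R (- h)) \<le> (1 - 1/2) * p h + 1/2 * p (- h)"
    using h by (intro convex_onD[OF p(1)]) auto
  then show "- p h \<le> p (- h)" using p(2) by simp
qed

text \<open>A point is the mean of \<open>n\<close> points on the coordinate axes, so Jensen turns
  the bounds on the axes into an upper bound near 0. The lower bound is the upper one at
  \<open>- y\<close>, because \<open>- p y \<le> p (- y)\<close>.\<close>

lemma convex_differentiable_from_axes:
  fixes p :: "'a::euclidean_space \<Rightarrow> real"
  assumes p: "convex_on (ball 0 \<rho>) p" "p 0 = 0" and \<rho>: "\<rho> > 0"
    and axes: "\<And>i e. i \<in> Basis \<Longrightarrow> e > 0 \<Longrightarrow> \<exists>d>0. \<forall>t. \<bar>t\<bar> < d \<longrightarrow> p (t *\<^sub>R i) \<le> e * \<bar>t\<bar>"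
  shows "(p has_derivative (\<lambda>h. 0)) (at 0)"
proof -
  let ?n = "real DIM('a)"
  have n: "?n > 0" by simp
  have "\<exists>d>0. \<forall>y. norm y < d \<longrightarrow> \<bar>p y\<bar> \<le> e * norm y" if e: "e > 0" for e
  proof -
    let ?e = "e / ?n"
    have "?e > 0" using e by simp
    then have "\<forall>i\<in>Basis. \<exists>d>0. \<forall>t. \<bar>t\<bar> < d \<longrightarrow> p (t *\<^sub>R i) \<le> ?e * \<bar>t\<bar>" using axes by blast
    then obtain d where d: "\<And>i. i \<in> Basis \<Longrightarrow> d i > 0"
      "\<And>i t. i \<in> Basis \<Longrightarrow> \<bar>t\<bar> < d i \<Longrightarrow> p (t *\<^sub>R i) \<le> ?e * \<bar>t\<bar>" by metis
    \<comment> \<open>The axis points are \<open>n\<close> times the coordinates, so the radius is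
      divided by \<open>n\<close>; \<rho> enters to keep these points in the ball.\<close>
    define D where "D = min (Min (d ` Basis)) \<rho> / ?n"
    have D: "D > 0" using d(1) \<rho> by (auto simp: D_def)
    have Dd: "?n * D \<le> d i" if "i \<in> Basis" for i
    proof -
      have "?n * D = min (Min (d ` Basis)) \<rho>" by (simp add: D_def)
      also have "\<dots> \<le> Min (d ` Basis)" by simp
      also have "\<dots> \<le> d i" using that by simp
      finally show ?thesis .
    qed
    have Dr: "?n * D \<le> \<rho>" by (simp add: D_def)
    have D\<rho>: "D \<le> \<rho>"
    proof -
      have "1 * D \<le> ?n * D" using D by (intro mult_right_mono) auto
      then show ?thesis using Dr by linarith
    qed
    have up: "p y \<le> e * norm y" if y: "norm y < D" for y
    proof -
      have yi: "\<bar>?n * (y \<bullet> i)\<bar> < ?n * D" if "i \<in> Basis" for i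
        using Basis_le_norm[OF that, of y] y n by (simp add: abs_mult)
      have "y = (\<Sum>i\<in>Basis. (1 / ?n) *\<^sub>R ((?n * (y \<bullet> i)) *\<^sub>R i))"
        by (simp add: euclidean_representation)
      then have "p y = p (\<Sum>i\<in>Basis. (1 / ?n) *\<^sub>R ((?n * (y \<bullet> i)) *\<^sub>R i))" by simp
      also have "\<dots> \<le> (\<Sum>i\<in>Basis. (1 / ?n) * p ((?n * (y \<bullet> i)) *\<^sub>R i))"
      proof (rule convex_on_sum[OF _ _ p(1)])
        show "(?n * (y \<bullet> i)) *\<^sub>R i \<in> ball 0 \<rho>" if "i \<in> Basis" for i
          using yi[OF that] Dr that by simp
      qed auto
      also have "\<dots> \<le> (\<Sum>i\<in>(Basis::'a set). (1 / ?n) * (?e * (?n * norm y)))"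
      proof (intro sum_mono mult_left_mono)
        fix i :: 'a assume i: "i \<in> Basis"
        have "p ((?n * (y \<bullet> i)) *\<^sub>R i) \<le> ?e * \<bar>?n * (y \<bullet> i)\<bar>"
          using yi[OF i] Dd[OF i] by (intro d(2)[OF i]) linarith
        also have "\<dots> \<le> ?e * (?n * norm y)"
          using Basis_le_norm[OF i, of y] e by (intro mult_left_mono) (auto simp: abs_mult)
        finally show "p ((?n * (y \<bullet> i)) *\<^sub>R i) \<le> ?e * (?n * norm y)" .
      qed simp
      also have "\<dots> = e * norm y" by simp
      finally show ?thesis .
    qed
    have "\<bar>p y\<bar> \<le> e * norm y" if y: "norm y < D" for y
      using up[OF y] up[of "- y"] convex_near_zero(2)[OF p \<rho>, of y] y D\<rho> by simp
    then show ?thesis using D by blast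
  qed
  then show ?thesis
    unfolding has_derivative_at_alt using p(2) by simp
qed

lemma convex_slope_mono:
  fixes q :: "real \<Rightarrow> real"
  assumes q: "convex_on {-\<rho><..<\<rho>} q" "q 0 = 0" and h: "0 < h" "h \<le> k" "k < \<rho>"
  shows "q h / h \<le> q k / k" "- q (- k) / k \<le> - q (- h) / h" "- q (- k) / k \<le> q h / h"
proof -
  have b: "convex_on (ball 0 \<rho>) q" using q(1) by (simp add: ball_eq_greaterThanLessThan)
  have \<rho>: "\<rho> > 0" using h by simp
  have 1: "q ((h/k) *\<^sub>R k) \<le> h/k * q k" "q ((h/k) *\<^sub>R (-k)) \<le> h/k * q (-k)"
    by (rule convex_near_zero(1)[OF b q(2) \<rho>]; use h in \<open>auto simp: divide_simps\<close>)+
  then have 2: "q h \<le> h/k * q k" "q (-h) \<le> h/k * q (-k)" using h by auto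
  then show a: "q h / h \<le> q k / k" and c: "- q (- k) / k \<le> - q (- h) / h"
    using h by (auto simp: field_simps)
  have "- q h \<le> q (- h)" using convex_near_zero(2)[OF b q(2) \<rho>, of h] h by simp
  then have "- q (-h) / h \<le> q h / h" using h by (simp add: divide_simps)
  then show "- q (- k) / k \<le> q h / h" using c by linarith
qed

text \<open>\<open>R\<close> and \<open>S\<close> are the right and left derivatives at 0. If they
  differ, a rational slope between them gives a line touching the graph only at 0, and rational
  slopes form a countable family. If they agree, only the upper estimate is recorded; convexity
  supplies the lower one later.\<close>

lemma convex_partial_cases:
  fixes q :: "real \<Rightarrow> real"
  assumes q: "convex_on {-\<rho><..<\<rho>} q" "q 0 = 0" and \<rho>: "\<rho> > 0"
  obtains r where "r \<in> \<rat>" "\<And>t. t \<noteq> 0 \<Longrightarrow> \<bar>t\<bar> < \<rho> \<Longrightarrow> q t > r * t"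
    | L where "\<And>e. e > 0 \<Longrightarrow> \<exists>d>0. \<forall>t. \<bar>t\<bar> < d \<longrightarrow> q t - L * t \<le> e * \<bar>t\<bar>"
proof -
  define R where "R = Inf ((\<lambda>t. q t / t) ` {0<..<\<rho>})"
  define S where "S = Sup ((\<lambda>t. - q (- t) / t) ` {0<..<\<rho>})"
  have ne: "{0<..<\<rho>} \<noteq> {}" using \<rho> by simp
  have le: "- q (- s) / s \<le> q t / t" if "s \<in> {0<..<\<rho>}" "t \<in> {0<..<\<rho>}" for s t
  proof (cases "t \<le> s")
    case True then show ?thesis using convex_slope_mono(3)[OF q, of t s] that by simp
  next
    case False
    then show ?thesis
      using convex_slope_mono(3)[OF q, of s s] convex_slope_mono(1)[OF q, of s t] that by simp
  qed
  have bl: "bdd_below ((\<lambda>t. q t / t) ` {0<..<\<rho>})"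
    using le[of "\<rho>/2"] \<rho> by (intro bdd_belowI[of _ "- q (- (\<rho>/2)) / (\<rho>/2)"]) auto
  have ba: "bdd_above ((\<lambda>t. - q (- t) / t) ` {0<..<\<rho>})"
    using le[of _ "\<rho>/2"] \<rho> by (intro bdd_aboveI[of _ "q (\<rho>/2) / (\<rho>/2)"]) auto
  have Rle: "R \<le> q t / t" if "t \<in> {0<..<\<rho>}" for t
    unfolding R_def using bl that by (intro cInf_lower) auto
  have Sge: "- q (- t) / t \<le> S" if "t \<in> {0<..<\<rho>}" for t
    unfolding S_def using ba that by (intro cSup_upper) auto
  have SR: "S \<le> R" unfolding S_def R_def using ne le
    by (intro cSup_least cInf_greatest) auto
  show ?thesis
  proof (cases "S < R")
    case True
    obtain r where r: "r \<in> \<rat>" "S < r" "r < R" using Rats_dense_in_real[OF True] by blast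
    have "q t > r * t" if t: "t \<noteq> 0" "\<bar>t\<bar> < \<rho>" for t
    proof (cases "t > 0")
      case True
      then have "r < q t / t" using Rle[of t] r t by simp
      then show ?thesis using True by (simp add: field_simps)
    next
      case False
      then have *: "- q t / (- t) < r" using Sge[of "- t"] r t by simp
      have "- q t < r * (- t)" using * False t by (subst (asm) pos_divide_less_eq) auto
      then show ?thesis by simp
    qed
    then show thesis using r that(1) by blast
  next
    case False
    then have eq: "S = R" using SR by simp
    have "\<exists>d>0. \<forall>t. \<bar>t\<bar> < d \<longrightarrow> q t - R * t \<le> e * \<bar>t\<bar>" if e: "e > 0" for e
    proof -
      have "\<exists>t\<in>{0<..<\<rho>}. q t / t < R + e"
        using cInf_lessD[of "(\<lambda>t. q t / t) ` {0<..<\<rho>}" "R + e"] ne e by (auto simp: R_def)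
      then obtain a where a: "a \<in> {0<..<\<rho>}" "q a / a < R + e" by blast
      have "\<exists>t\<in>{0<..<\<rho>}. S - e < - q (- t) / t"
        using less_cSupD[of "(\<lambda>t. - q (- t) / t) ` {0<..<\<rho>}" "S - e"] ne e by (auto simp: S_def)
      then obtain b where b: "b \<in> {0<..<\<rho>}" "S - e < - q (- b) / b" by blast
      have "q t - R * t \<le> e * \<bar>t\<bar>" if t: "\<bar>t\<bar> < min a b" for t
      proof -
        consider "t = 0" | "t > 0" | "t < 0" by linarith
        then show ?thesis
        proof cases
          case 1 then show ?thesis using q(2) by simp
        next
          case 2
          have "q t / t \<le> q a / a" using convex_slope_mono(1)[OF q, of t a] 2 t a by simp
          then have "q t / t < R + e" using a by simp
          then have "q t < (R + e) * t" using 2 by (simp add: pos_divide_less_eq)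
          then show ?thesis using 2 by (simp add: algebra_simps)
        next
          case 3
          have "- q (- b) / b \<le> - q (- (- t)) / (- t)"
            using convex_slope_mono(2)[OF q, of "- t" b] 3 t b by simp
          then have "R - e < - q t / (- t)" using b eq by simp
          then have "(R - e) * (- t) < - q t" using 3 by (subst (asm) pos_less_divide_eq) auto
          then show ?thesis using 3 by (simp add: algebra_simps)
        qed
      qed
      then show ?thesis using a b by (intro exI[of _ "min a b"]) auto
    qed
    then show thesis using that(2) by blast
  qed
qed

text \<open>Where a partial derivative fails to exist, a line of rational slope parallel to an axis
  supports \<open>v\<close> strictly. For a given slope this happens at most once on each line
  parallel to that axis, since two such points would give contradictory strict inequalities. So
  these points form countably many sets disjoint from their own translates; elsewhere all partial
  derivatives exist, which suffices for a convex function.\<close>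

lemma negligible_not_differentiable_convex:
  fixes v :: "'a::euclidean_space \<Rightarrow> real"
  assumes v: "convex_on S v" and S: "open S" "bounded S"
  shows "negligible {x\<in>S. \<not> v differentiable (at x)}"
proof -
  define v0 where "v0 x = (if x \<in> S then v x else 0)" for x
  have cont: "continuous_on S v" using convex_on_continuous[OF S(1) v] .
  have Sb[measurable]: "S \<in> sets borel" using S by simp
  have v0[measurable]: "v0 \<in> borel_measurable borel"
    unfolding v0_def by (rule borel_measurable_continuous_on_if) (use cont S in auto)
  \<comment> \<open>Only the steps \<open>1 / (n + 1)\<close> of either sign are tested, a countable
    condition that keeps \<open>A\<close> Borel; by convexity the strict inequality passes to every
    step that stays in \<open>S\<close>.\<close>
  define A where "A i r = {x\<in>S. \<forall>n::nat. \<forall>s\<in>{1/real (Suc n), -1/real (Suc n)}. x + s *\<^sub>R i \<in> S \<longrightarrow>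
      v0 (x + s *\<^sub>R i) - v0 x > r * s}" for i :: 'a and r :: real
  have Am: "A i r \<in> sets borel" for i r
    unfolding A_def by measurable
  have strict: "v (x + t *\<^sub>R i) - v x > r * t" if x: "x \<in> A i r" and t: "t \<noteq> 0" "x + t *\<^sub>R i \<in> S" for x i r t
  proof -
    have xS: "x \<in> S" using x by (simp add: A_def)
    have cS: "convex S" using v by (simp add: convex_on_def)
    obtain n where n: "1 / real (Suc n) < \<bar>t\<bar>" using t reals_Archimedean[of "\<bar>t\<bar>"] by (auto simp: inverse_eq_divide)
    define s where "s = (if t > 0 then 1 / real (Suc n) else - 1 / real (Suc n))"
    have s: "s \<in> {1/real (Suc n), -1/real (Suc n)}" by (simp add: s_def)
    define c where "c = s / t"
    have c: "0 < c" "c \<le> 1" "s = c * t" using t n by (auto simp: c_def s_def divide_simps zero_less_mult_iff split: if_splits)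
    have eq: "x + s *\<^sub>R i = (1 - c) *\<^sub>R x + c *\<^sub>R (x + t *\<^sub>R i)"
      by (simp add: c(3) algebra_simps)
    have inS: "x + s *\<^sub>R i \<in> S" unfolding eq using cS xS t(2) c by (intro convexD) auto
    have "r * s < v (x + s *\<^sub>R i) - v x" using x s inS xS by (auto simp: A_def v0_def)
    also have "v (x + s *\<^sub>R i) \<le> (1 - c) * v x + c * v (x + t *\<^sub>R i)"
      unfolding eq using c xS t(2) by (intro convex_onD[OF v]) auto
    finally have "c * (r * t) < c * (v (x + t *\<^sub>R i) - v x)" by (simp add: c(3) algebra_simps)
    then show ?thesis using c by simp
  qed
  have negA: "negligible (A i r)" for i r
  proof (rule negligible_disjoint_translates)
    show "A i r \<in> sets lebesgue" using Am by (rule sets_completionI_sets[of _ lborel, simplified])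
    show "bounded (A i r)" using S(2) by (rule bounded_subset) (auto simp: A_def)
    fix x t assume x: "x \<in> A i r" and t: "t \<noteq> (0::real)"
    show "x + t *\<^sub>R i \<notin> A i r"
    proof
      assume y: "x + t *\<^sub>R i \<in> A i r"
      have "x + t *\<^sub>R i \<in> S" "x \<in> S" using x y by (auto simp: A_def)
      then show False using strict[OF x t] strict[OF y, of "-t"] t by simp
    qed
  qed
  have "{x\<in>S. \<not> v differentiable (at x)} \<subseteq> (\<Union>i\<in>Basis. \<Union>r\<in>\<rat>. A i r)"
  proof (rule subsetI, rule ccontr)
    fix x assume x: "x \<in> {x\<in>S. \<not> v differentiable (at x)}" "x \<notin> (\<Union>i\<in>Basis. \<Union>r\<in>\<rat>. A i r)"
    then have xS: "x \<in> S" and nd: "\<not> v differentiable (at x)" by auto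
    obtain \<rho> where \<rho>: "\<rho> > 0" "ball x \<rho> \<subseteq> S" using S(1) xS open_contains_ball by blast
    have vb: "convex_on (ball x \<rho>) v" using convex_on_subset[OF v \<rho>(2)] by simp
    have part: "\<exists>L. \<forall>e>0. \<exists>d>0. \<forall>t. \<bar>t\<bar> < d \<longrightarrow> (v (x + t *\<^sub>R i) - v x) - L * t \<le> e * \<bar>t\<bar>" if i: "i \<in> Basis" for i
    proof -
      let ?q = "\<lambda>t. v (x + t *\<^sub>R i) - v x"
      have ni: "norm i = 1" using i by simp
      have q: "convex_on {-\<rho><..<\<rho>} ?q"
      proof (rule convex_onI)
        fix t a b :: real assume h: "0 < t" "t < 1" "a \<in> {-\<rho><..<\<rho>}" "b \<in> {-\<rho><..<\<rho>}"
        have "v ((1 - t) *\<^sub>R (x + a *\<^sub>R i) + t *\<^sub>R (x + b *\<^sub>R i)) \<le> (1 - t) * v (x + a *\<^sub>R i) + t * v (x + b *\<^sub>R i)"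
          using h ni by (intro convex_onD[OF vb]) (auto simp: dist_norm)
        moreover have "(1 - t) *\<^sub>R (x + a *\<^sub>R i) + t *\<^sub>R (x + b *\<^sub>R i) = x + ((1 - t) *\<^sub>R a + t *\<^sub>R b) *\<^sub>R i"
          by (simp add: algebra_simps)
        ultimately show "?q ((1 - t) *\<^sub>R a + t *\<^sub>R b) \<le> (1 - t) * ?q a + t * ?q b"
          by (simp add: algebra_simps)
      qed simp
      show ?thesis
      proof (rule convex_partial_cases[OF q _ \<rho>(1)])
        fix r :: real assume r: "r \<in> \<rat>" "\<And>t. t \<noteq> 0 \<Longrightarrow> \<bar>t\<bar> < \<rho> \<Longrightarrow> r * t < ?q t"
        \<comment> \<open>Convexity extends the strict inequality from
          \<open>\<bar>t\<bar> < \<rho>\<close> to all steps that stay in \<open>S\<close>, as the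
          definition of \<open>A\<close> asks.\<close>
        have key: "r * t < ?q t" if t: "t \<noteq> 0" "x + t *\<^sub>R i \<in> S" for t
        proof -
          define c where "c = min 1 (\<rho> / (2 * \<bar>t\<bar>))"
          have c: "0 < c" "c \<le> 1" using \<rho> t by (auto simp: c_def)
          have "c * \<bar>t\<bar> \<le> \<rho> / (2 * \<bar>t\<bar>) * \<bar>t\<bar>" by (intro mult_right_mono) (auto simp: c_def)
          then have ct: "\<bar>c * t\<bar> < \<rho>" using c t \<rho> by (simp add: abs_mult)
          have "r * (c * t) < ?q (c * t)" using r(2)[of "c * t"] ct c t by simp
          also have "v (x + (c * t) *\<^sub>R i) \<le> (1 - c) * v x + c * v (x + t *\<^sub>R i)"
          proof -
            have "x + (c * t) *\<^sub>R i = (1 - c) *\<^sub>R x + c *\<^sub>R (x + t *\<^sub>R i)" by (simp add: algebra_simps)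
            then show ?thesis using convex_onD[OF v, of c x "x + t *\<^sub>R i"] c xS t(2) by simp
          qed
          finally have "c * (r * t) < c * ?q t" by (simp add: algebra_simps)
          then show ?thesis using c by simp
        qed
        have "x \<in> A i r" unfolding A_def mem_Collect_eq
        proof (intro conjI allI ballI impI)
          fix n s assume s: "s \<in> {1/real (Suc n), -1/real (Suc n)}" "x + s *\<^sub>R i \<in> S"
          have "s \<noteq> 0" using s by auto
          then show "r * s < v0 (x + s *\<^sub>R i) - v0 x" using key[OF _ s(2)] s(2) xS by (simp add: v0_def)
        qed (fact xS)
        then show ?thesis using x(2) i r(1) by blast
      next
        fix L assume "\<And>e. e > 0 \<Longrightarrow> \<exists>d>0. \<forall>t. \<bar>t\<bar> < d \<longrightarrow> ?q t - L * t \<le> e * \<bar>t\<bar>"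
        then show ?thesis by blast
      qed simp
    qed
    then obtain L where L: "\<And>i e. i \<in> Basis \<Longrightarrow> e > 0 \<Longrightarrow> \<exists>d>0. \<forall>t. \<bar>t\<bar> < d \<longrightarrow> (v (x + t *\<^sub>R i) - v x) - L i * t \<le> e * \<bar>t\<bar>"
      by metis
    define D where "D = (\<Sum>i\<in>Basis. L i *\<^sub>R i)"
    have Di: "i \<bullet> D = L i" if "i \<in> Basis" for i
      using that by (simp add: D_def inner_sum_right inner_Basis if_distrib sum.If_cases cong: if_cong)
    define p where "p h = v (x + h) - v x - h \<bullet> D" for h
    have pc: "convex_on (ball 0 \<rho>) p"
    proof (rule convex_onI)
      fix t :: real and a b :: 'a assume h: "0 < t" "t < 1" "a \<in> ball 0 \<rho>" "b \<in> ball 0 \<rho>"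
      have "v ((1 - t) *\<^sub>R (x + a) + t *\<^sub>R (x + b)) \<le> (1 - t) * v (x + a) + t * v (x + b)"
        using h by (intro convex_onD[OF vb]) (auto simp: dist_norm)
      moreover have "(1 - t) *\<^sub>R (x + a) + t *\<^sub>R (x + b) = x + ((1 - t) *\<^sub>R a + t *\<^sub>R b)"
        by (simp add: algebra_simps)
      ultimately show "p ((1 - t) *\<^sub>R a + t *\<^sub>R b) \<le> (1 - t) * p a + t * p b"
        by (simp add: p_def inner_simps algebra_simps)
    qed simp
    have "(p has_derivative (\<lambda>h. 0)) (at 0)"
    proof (rule convex_differentiable_from_axes[OF pc _ \<rho>(1)])
      show "\<exists>d>0. \<forall>t. \<bar>t\<bar> < d \<longrightarrow> p (t *\<^sub>R i) \<le> e * \<bar>t\<bar>" if "i \<in> Basis" "e > 0" for i e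
        using L[OF that] by (simp add: p_def Di[OF that(1)] mult.commute)
    qed (simp add: p_def)
    moreover have "((\<lambda>y. y - x) has_derivative (\<lambda>h. h)) (at x)" by (auto intro!: derivative_eq_intros)
    ultimately have "((\<lambda>y. p (y - x)) has_derivative (\<lambda>h. 0)) (at x)"
      using has_derivative_compose[of "\<lambda>y. y - x" "\<lambda>h. h" x UNIV p "\<lambda>h. 0"] by simp
    then have "((\<lambda>y. p (y - x) + v x + (y - x) \<bullet> D) has_derivative (\<lambda>h. h \<bullet> D)) (at x)"
      by (auto intro!: derivative_eq_intros)
    moreover have "(\<lambda>y. p (y - x) + v x + (y - x) \<bullet> D) = v" by (simp add: p_def)
    ultimately show False using nd by (auto simp: differentiable_def)
  qed
  moreover have "negligible (\<Union>i\<in>Basis. \<Union>r\<in>\<rat>. A i r)"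
    using negA countable_rat
    by (intro negligible_Union negligible_countable_Union) (auto intro!: negligible_countable_Union)
  ultimately show ?thesis by (rule negligible_subset[rotated])
qed

subsection \<open>Gluing convex functions\<close>

text \<open>The line through the graph at \<open>c\<close> and \<open>d\<close> lies below
  \<open>g\<close> at \<open>x\<close> and at \<open>z\<close>. Hence the chord from
  \<open>x\<close> to \<open>z\<close> passes above the graph at \<open>d\<close>, and on either
  side of \<open>d\<close> one of the two convexities applies.\<close>

lemma convex_on_overlap:
  fixes g :: "real \<Rightarrow> real"
  assumes g1: "convex_on J1 g" and g2: "convex_on J2 g" and K: "convex (J1 \<union> J2)"
    and x: "x \<in> J1" and z: "z \<in> J2" and cd: "x < c" "c < d" "d < z" "c \<in> J1 \<inter> J2" "d \<in> J1 \<inter> J2"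
    and y: "x < y" "y < z"
  shows "g y * (z - x) \<le> (z - y) * g x + (y - x) * g z"
proof -
  have comb: "(r - p) * g q \<le> (r - q) * g p + (q - p) * g r"
    if "convex_on J g" "p \<in> J" "r \<in> J" "p < q" "q < r" for J p q r
  proof -
    define t where "t = (q - p) / (r - p)"
    have t: "t * (r - p) = q - p" "0 \<le> t" "t \<le> 1" using that by (auto simp: t_def)
    have "(1 - t) *\<^sub>R p + t *\<^sub>R r = p + t * (r - p)" by (simp add: algebra_simps)
    then have eq: "(1 - t) *\<^sub>R p + t *\<^sub>R r = q" by (simp add: t)
    have "g q \<le> (1 - t) * g p + t * g r"
      using convex_onD[OF that(1) t(2,3) that(2,3)] by (simp only: eq)
    then have "(r - p) * g q \<le> (r - p) * ((1 - t) * g p + t * g r)"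
      using that by (intro mult_left_mono) auto
    also have "\<dots> = ((r - p) - t * (r - p)) * g p + (t * (r - p)) * g r" by (simp add: algebra_simps)
    also have "\<dots> = (r - q) * g p + (q - p) * g r" by (simp add: t)
    finally show ?thesis .
  qed
  define l where "l = (g d - g c) / (d - c)"
  have "l * (d - c) = g d - g c" using cd by (simp add: l_def)
  then have gc: "g c = g d - l * (d - c)" by simp
  have "(d - x) * g c \<le> (d - c) * g x + (c - x) * g d"
    using comb[OF g1, of x d c] x cd by simp
  then have "(d - c) * (g d - l * (d - x)) \<le> (d - c) * g x"
    unfolding gc by (simp add: algebra_simps)
  then have gx: "g x \<ge> g d - l * (d - x)" using cd by simp
  have "(z - c) * g d \<le> (z - d) * g c + (d - c) * g z"
    using comb[OF g2, of c z d] z cd by simp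
  then have "(d - c) * (g d + l * (z - d)) \<le> (d - c) * g z"
    unfolding gc by (simp add: algebra_simps)
  then have gz: "g z \<ge> g d + l * (z - d)" using cd by simp
  have gd: "g d * (z - x) \<le> (z - d) * g x + (d - x) * g z"
  proof -
    have "(z - d) * (g d - l * (d - x)) + (d - x) * (g d + l * (z - d)) \<le> (z - d) * g x + (d - x) * g z"
      using gx gz cd by (intro add_mono mult_left_mono) auto
    then show ?thesis by (simp add: algebra_simps)
  qed
  consider "y = d" | "y < d" | "y > d" by linarith
  then show ?thesis
  proof cases
      case 1 then show ?thesis using gd by simp
    next
      case 2
      have a: "g y * (d - x) \<le> (d - y) * g x + (y - x) * g d"
        using comb[OF g1, of x d y] x cd y 2 by (simp add: mult.commute)
      have "(g y * (z - x)) * (d - x) = (g y * (d - x)) * (z - x)" by simp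
      also have "\<dots> \<le> ((d - y) * g x + (y - x) * g d) * (z - x)"
        using a cd by (intro mult_right_mono) auto
      also have "\<dots> = (d - y) * g x * (z - x) + (y - x) * (g d * (z - x))" by (simp add: algebra_simps)
      also have "\<dots> \<le> (d - y) * g x * (z - x) + (y - x) * ((z - d) * g x + (d - x) * g z)"
        using gd y by (intro add_left_mono mult_left_mono) auto
      also have "\<dots> = ((z - y) * g x + (y - x) * g z) * (d - x)" by (simp add: algebra_simps)
      finally show ?thesis using cd by simp
    next
      case 3
      have a: "g y * (z - d) \<le> (z - y) * g d + (y - d) * g z"
        using comb[OF g2, of d z y] z cd y 3 by (simp add: mult.commute)
      have "(g y * (z - x)) * (z - d) = (g y * (z - d)) * (z - x)" by simp
      also have "\<dots> \<le> ((z - y) * g d + (y - d) * g z) * (z - x)"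
        using a cd by (intro mult_right_mono) auto
      also have "\<dots> = (y - d) * g z * (z - x) + (z - y) * (g d * (z - x))" by (simp add: algebra_simps)
      also have "\<dots> \<le> (y - d) * g z * (z - x) + (z - y) * ((z - d) * g x + (d - x) * g z)"
        using gd y by (intro add_left_mono mult_left_mono) auto
      also have "\<dots> = ((z - y) * g x + (y - x) * g z) * (z - d)" by (simp add: algebra_simps)
      finally show ?thesis using cd by simp
  qed
qed

lemma convex_on_intervals_glue:
  fixes g :: "real \<Rightarrow> real"
  assumes g1: "convex_on ({0..1} \<inter> {a1<..<b1}) g" and g2: "convex_on ({0..1} \<inter> {a2<..<b2}) g"
    and m: "a1 < m" "m < b1" "a2 < m" "m < b2" "0 \<le> m" "m \<le> 1" and "a1 \<le> m" "m \<le> b2"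
  shows "convex_on ({0..1} \<inter> {a1<..<b2}) g"
proof (rule convex_on_linorderI)
  fix t x z :: real
  assume t: "0 < t" "t < 1" and x: "x \<in> {0..1} \<inter> {a1<..<b2}" and z: "z \<in> {0..1} \<inter> {a1<..<b2}" and xz: "x < z"
  define y where "y = (1 - t) *\<^sub>R x + t *\<^sub>R z"
  have y: "x < y" "y < z"
  proof -
    have "0 < t * (z - x)" "0 < (1 - t) * (z - x)" using t xz by auto
    then have "0 < y - x" "0 < z - y" by (simp_all add: y_def algebra_simps)
    then show "x < y" "y < z" by simp_all
  qed
  consider "z < b1" | "a2 < x" | "b1 \<le> z" "x \<le> a2" by linarith
  then show "g ((1 - t) *\<^sub>R x + t *\<^sub>R z) \<le> (1 - t) * g x + t * g z"
  proof cases
    case 1 then show ?thesis using x z xz t by (intro convex_onD[OF g1]) auto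
  next
    case 2 then show ?thesis using x z xz t by (intro convex_onD[OF g2]) auto
  next
    case 3
    \<comment> \<open>\<open>c\<close> and \<open>m\<close> are two points of the overlap strictly
      between \<open>x\<close> and \<open>z\<close>.\<close>
    define c where "c = (max a2 x + m) / 2"
    have "x < m" using 3 m by simp
    moreover have "m < z" using 3 m by simp
    ultimately have c: "max a2 x < c" "c < m" using m by (auto simp: c_def)
    have "g y * (z - x) \<le> (z - y) * g x + (y - x) * g z"
    proof (rule convex_on_overlap[OF g1 g2 _ _ _ _ _ _ _ _ y, of c m])
      have "{0..1} \<inter> {a1<..<b1} \<union> {0..1} \<inter> {a2<..<b2} = {0..1} \<inter> ({a1<..<b1} \<union> {a2<..<b2})" by auto
      moreover have "{a1<..<b1} \<union> {a2<..<b2} = {min a1 a2<..<max b1 b2}" using m by auto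
      ultimately show "convex ({0..1} \<inter> {a1<..<b1} \<union> {0..1} \<inter> {a2<..<b2})"
        by (simp add: convex_Int)
    qed (use 3 c m x z \<open>x < m\<close> \<open>m < z\<close> in auto)
    also have "\<dots> = ((1 - t) * g x + t * g z) * (z - x)"
      by (simp add: y_def algebra_simps)
    finally show ?thesis using xz by (simp add: y_def)
  qed
qed (simp add: convex_Int)

text \<open>Bisection: convexity on slightly enlarged intervals passes from \<open>[a, b]\<close>
  and \<open>[b, c]\<close> to \<open>[a, c]\<close>, because the enlargements overlap around
  \<open>b\<close>.\<close>

lemma convex_on_unit_interval_local:
  fixes g :: "real \<Rightarrow> real"
  assumes loc: "\<And>t. t \<in> {0..1} \<Longrightarrow> \<exists>e>0. convex_on ({0..1} \<inter> {t - e<..<t + e}) g"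
  shows "convex_on {0..1} g"
proof -
  define P where "P a b \<longleftrightarrow> (0 \<le> a \<and> b \<le> 1 \<longrightarrow> (\<exists>e>0. convex_on ({0..1} \<inter> {a - e<..<b + e}) g))" for a b
  have "P 0 1"
  proof (rule Bolzano[of 0 1 P])
    fix a b c :: real assume ab: "P a b" "P b c" "a \<le> b" "b \<le> c"
    show "P a c" unfolding P_def
    proof
    assume abc: "0 \<le> a \<and> c \<le> 1"
    then obtain e1 e2 where e: "e1 > 0" "e2 > 0" "convex_on ({0..1} \<inter> {a - e1<..<b + e1}) g"
      "convex_on ({0..1} \<inter> {b - e2<..<c + e2}) g" using ab unfolding P_def by (meson order_trans)
    have *: "convex_on ({0..1} \<inter> {a - e1<..<c + e2}) g"
      by (rule convex_on_intervals_glue[OF e(3,4), of b]) (use e ab abc in auto)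
    have "convex_on ({0..1} \<inter> {a - min e1 e2<..<c + min e1 e2}) g"
      by (rule convex_on_subset[OF *]) (auto intro!: convex_Int)
    then show "\<exists>e>0. convex_on ({0..1} \<inter> {a - e<..<c + e}) g" using e
      by (intro exI[of _ "min e1 e2"]) auto
    qed
  next
    fix t :: real assume t: "0 \<le> t" "t \<le> 1"
    then obtain e where e: "e > 0" "convex_on ({0..1} \<inter> {t - e<..<t + e}) g" using loc[of t] by auto
    show "\<exists>d>0. \<forall>a b. a \<le> t \<and> t \<le> b \<and> b - a < d \<longrightarrow> P a b"
    proof (intro exI[of _ "e/2"] conjI allI impI)
      fix a b assume ab: "a \<le> t \<and> t \<le> b \<and> b - a < e/2"
      have "convex_on ({0..1} \<inter> {a - e/2<..<b + e/2}) g"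
        by (rule convex_on_subset[OF e(2)]) (use e ab in \<open>auto intro!: convex_Int\<close>)
      then show "P a b" unfolding P_def using e by (intro impI exI[of _ "e/2"]) auto
    qed (use e in simp)
  qed simp
  then obtain e where "e > 0" "convex_on ({0..1} \<inter> {0 - e<..<1 + e}) g" unfolding P_def by auto
  moreover have "{0..1} \<inter> {0 - e<..<1 + e} = {0..1::real}" using \<open>e > 0\<close> by auto
  ultimately show ?thesis by simp
qed

text \<open>On a segment convexity is a local property. Every point of it has a neighbourhood either
  inside the large ball, where \<open>k\<close> is convex, or off the small closed ball, where the
  glued function is \<open>u\<close>; these open sets cover because \<open>r < R\<close>.\<close>

lemma convex_on_glue_ball:
  fixes u k :: "'a::real_normed_vector \<Rightarrow> real"
  assumes u: "convex_on \<Omega> u" and k: "convex_on (ball b R) k" and r: "r < R"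
    and eq: "\<And>x. x \<in> ball b R - cball b r \<Longrightarrow> k x = u x"
  shows "convex_on \<Omega> (\<lambda>x. if x \<in> ball b R then k x else u x)" (is "convex_on _ ?v")
proof (rule convex_onI)
  show "convex \<Omega>" using u by (simp add: convex_on_def)
  fix t x y assume t: "0 < (t::real)" "t < 1" and x: "x \<in> \<Omega>" and y: "y \<in> \<Omega>"
  define L where "L s = (1 - s) *\<^sub>R x + s *\<^sub>R y" for s
  have Lc: "continuous_on UNIV L" unfolding L_def by (intro continuous_intros)
  have Laff: "L ((1 - c) *\<^sub>R p + c *\<^sub>R q) = (1 - c) *\<^sub>R L p + c *\<^sub>R L q" for c p q
    by (simp add: L_def algebra_simps)
  have L\<Omega>: "L s \<in> \<Omega>" if "s \<in> {0..1}" for s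
    unfolding L_def using that x y u by (intro convexD) (auto simp: convex_on_def)
  have "convex_on {0..1} (\<lambda>s. ?v (L s))"
  proof (rule convex_on_unit_interval_local)
    fix s :: real assume s: "s \<in> {0..1}"
    show "\<exists>e>0. convex_on ({0..1} \<inter> {s - e<..<s + e}) (\<lambda>s. ?v (L s))"
    proof (cases "L s \<in> ball b R")
      case True
      have "open (L -` ball b R)" using Lc open_ball by (simp add: open_vimage)
      then obtain e where e: "e > 0" "ball s e \<subseteq> L -` ball b R" using True open_contains_ball by blast
      have "convex_on ({0..1} \<inter> {s - e<..<s + e}) (\<lambda>s. ?v (L s))"
      proof (rule convex_onI)
        fix c p q :: real assume h: "0 < c" "c < 1" "p \<in> {0..1} \<inter> {s - e<..<s + e}" "q \<in> {0..1} \<inter> {s - e<..<s + e}"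
        have "p \<in> ball s e" "q \<in> ball s e" using h by (auto simp: dist_real_def)
        then have inb: "L p \<in> ball b R" "L q \<in> ball b R" using e by auto
        then have "(1 - c) *\<^sub>R L p + c *\<^sub>R L q \<in> ball b R" using h by (intro convexD) auto
        moreover have "k ((1 - c) *\<^sub>R L p + c *\<^sub>R L q) \<le> (1 - c) * k (L p) + c * k (L q)"
          using h inb by (intro convex_onD[OF k]) auto
        ultimately show "?v (L ((1 - c) *\<^sub>R p + c *\<^sub>R q)) \<le> (1 - c) * ?v (L p) + c * ?v (L q)"
          using inb by (simp only: Laff if_True)
      qed (simp add: convex_Int)
      then show ?thesis using e by blast
    next
      case False
      have "open (L -` (- cball b r))" using Lc by (simp add: open_vimage open_Compl)
      moreover have "s \<in> L -` (- cball b r)" using False r by auto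
      ultimately obtain e where e: "e > 0" "ball s e \<subseteq> L -` (- cball b r)" using open_contains_ball by blast
      have veq: "?v z = u z" if "z \<notin> cball b r" for z using eq that by auto
      have "convex_on ({0..1} \<inter> {s - e<..<s + e}) (\<lambda>s. ?v (L s))"
      proof (rule convex_onI)
        fix c p q :: real assume h: "0 < c" "c < 1" "p \<in> {0..1} \<inter> {s - e<..<s + e}" "q \<in> {0..1} \<inter> {s - e<..<s + e}"
        have pq: "p \<in> ball s e" "q \<in> ball s e" using h by (auto simp: dist_real_def)
        then have "(1 - c) *\<^sub>R p + c *\<^sub>R q \<in> ball s e" using h by (intro convexD) auto
        then have inb: "L p \<notin> cball b r" "L q \<notin> cball b r" "L ((1 - c) *\<^sub>R p + c *\<^sub>R q) \<notin> cball b r" using e pq by auto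
        have "u ((1 - c) *\<^sub>R L p + c *\<^sub>R L q) \<le> (1 - c) * u (L p) + c * u (L q)"
          using h L\<Omega> by (intro convex_onD[OF u]) auto
        then show "?v (L ((1 - c) *\<^sub>R p + c *\<^sub>R q)) \<le> (1 - c) * ?v (L p) + c * ?v (L q)"
          unfolding veq[OF inb(1)] veq[OF inb(2)] veq[OF inb(3)] by (simp only: Laff)
      qed (simp add: convex_Int)
      then show ?thesis using e by blast
    qed
  qed
  then have "?v (L ((1 - t) *\<^sub>R 0 + t *\<^sub>R 1)) \<le> (1 - t) * ?v (L 0) + t * ?v (L 1)"
    using t by (intro convex_onD) auto
  moreover have "L 0 = x" "L 1 = y" "L ((1 - t) *\<^sub>R 0 + t *\<^sub>R 1) = (1 - t) *\<^sub>R x + t *\<^sub>R y"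
    by (simp_all add: L_def)
  ultimately show "?v ((1 - t) *\<^sub>R x + t *\<^sub>R y) \<le> (1 - t) * ?v x + t * ?v y"
    by (simp only:)
qed

subsection \<open>Gradients of convex functions\<close>

lemma GDERIV_grad:
  fixes v :: "'a::euclidean_space \<Rightarrow> real"
  assumes "v differentiable (at x)"
  shows "GDERIV v x :> grad v x"
proof -
  obtain v' where v': "(v has_derivative v') (at x)" using assms by (auto simp: differentiable_def)
  then have lin: "linear v'" using has_derivative_bounded_linear bounded_linear.linear by blast
  have "v' h = h \<bullet> (\<Sum>i\<in>Basis. v' i *\<^sub>R i)" for h
  proof -
    have "v' h = v' (\<Sum>i\<in>Basis. (h \<bullet> i) *\<^sub>R i)" by (simp add: euclidean_representation)
    also have "\<dots> = (\<Sum>i\<in>Basis. (h \<bullet> i) * v' i)"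
      using lin by (simp add: linear_sum linear_cmul)
    finally show ?thesis by (simp add: inner_sum_right mult.commute)
  qed
  then have "v' = (\<lambda>h. h \<bullet> (\<Sum>i\<in>Basis. v' i *\<^sub>R i))" by blast
  then have "GDERIV v x :> (\<Sum>i\<in>Basis. v' i *\<^sub>R i)"
    unfolding gderiv_def using v' by simp
  then show ?thesis using grad_eqI by metis
qed

lemma AE_differentiable_convex:
  fixes v :: "'a::euclidean_space \<Rightarrow> real"
  assumes "convex_on S v" "open S" "bounded S"
  shows "AE x in lebesgue. x \<in> S \<longrightarrow> v differentiable (at x)"
  unfolding eventually_ae_filter_negligible
  using negligible_not_differentiable_convex[OF assms] by (intro exI conjI) auto

section \<open>Measurability of gradients and the integral of their difference\<close>

lemma GDERIV_quotient_limit: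
  fixes v :: "'a::real_inner \<Rightarrow> real"
  assumes "GDERIV v x :> D"
  shows "(\<lambda>n. (v (x + (1 / real (Suc n)) *\<^sub>R h) - v x) * real (Suc n)) \<longlonglongrightarrow> h \<bullet> D"
proof -
  have "((\<lambda>t. v (x + t *\<^sub>R h)) has_derivative (\<lambda>t. (t *\<^sub>R h) \<bullet> D)) (at 0)"
  proof -
    have 1: "((\<lambda>t. x + t *\<^sub>R h) has_derivative (\<lambda>t. t *\<^sub>R h)) (at 0)" by (auto intro!: derivative_eq_intros)
    have 2: "(v has_derivative (\<lambda>h. h \<bullet> D)) (at (x + 0 *\<^sub>R h))" using assms by (simp add: gderiv_def)
    show ?thesis using has_derivative_compose[OF 1 2] .
  qed
  then have "((\<lambda>t. v (x + t *\<^sub>R h)) has_real_derivative (h \<bullet> D)) (at 0)"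
    by (simp add: has_field_derivative_def ext[of "(*) (h \<bullet> D)" "\<lambda>t. t * (h \<bullet> D)"])
  then have "((\<lambda>t. (v (x + t *\<^sub>R h) - v x) / t) \<longlongrightarrow> h \<bullet> D) (at 0)"
    by (simp add: DERIV_def)
  moreover have "filterlim (\<lambda>n. 1 / real (Suc n)) (at 0) sequentially"
    unfolding filterlim_at using LIMSEQ_Suc[OF lim_1_over_n] by (auto simp: lim_inverse_n' intro!: eventuallyI)
  ultimately have "(\<lambda>n. (v (x + (1 / real (Suc n)) *\<^sub>R h) - v x) / (1 / real (Suc n))) \<longlonglongrightarrow> h \<bullet> D"
    by (rule filterlim_compose)
  then show ?thesis by (simp add: field_simps)
qed

text \<open>Almost everywhere the gradient is a limit of difference quotients. The values of
  \<open>grad\<close> at the remaining points are arbitrary, which is harmless because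
  \<open>lebesgue\<close> is complete; cutting \<open>v\<close> off outside \<open>S\<close> makes
  the quotients Borel on the whole space.\<close>

lemma borel_measurable_grad:
  fixes v :: "'a::euclidean_space \<Rightarrow> real"
  assumes v: "convex_on S v" and S: "open S" "bounded S"
  shows "(\<lambda>x. if x \<in> S then grad v x else 0) \<in> borel_measurable lebesgue"
proof -
  define v0 where "v0 x = (if x \<in> S then v x else 0)" for x
  have [measurable]: "S \<in> sets borel" using S by simp
  have v0[measurable]: "v0 \<in> borel_measurable borel"
    unfolding v0_def by (rule borel_measurable_continuous_on_if)
      (use convex_on_continuous[OF S(1) v] S in auto)
  define g where "g n x = (if x \<in> S then \<Sum>i\<in>Basis. ((v0 (x + (1 / real (Suc n)) *\<^sub>R i) - v0 x) * real (Suc n)) *\<^sub>R i else 0)" for n x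
  have "g n \<in> borel_measurable borel" for n unfolding g_def by measurable
  then have gm: "g n measurable_on UNIV" for n
    by (simp add: measurable_on_iff_borel_measurable lebesgue_on_UNIV_eq measurable_completion)
  have "(\<lambda>x. if x \<in> S then grad v x else 0) measurable_on UNIV"
  proof (rule measurable_on_limit[OF gm negligible_not_differentiable_convex[OF v S]])
    fix x assume x: "x \<in> UNIV - {x \<in> S. \<not> v differentiable at x}"
    show "(\<lambda>n. g n x) \<longlonglongrightarrow> (if x \<in> S then grad v x else 0)"
    proof (cases "x \<in> S")
      case True
      then have G: "GDERIV v x :> grad v x" using x GDERIV_grad by auto
      obtain \<rho> where \<rho>: "\<rho> > 0" "ball x \<rho> \<subseteq> S" using S(1) True open_contains_ball by blast
      have ev: "\<forall>\<^sub>F n in sequentially. 1 / real (Suc n) < \<rho>"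
        using LIMSEQ_Suc[OF lim_1_over_n] \<rho>(1) by (auto simp: lim_inverse_n' dest: order_tendstoD)
      have 1: "(\<lambda>n. (v0 (x + (1 / real (Suc n)) *\<^sub>R i) - v0 x) * real (Suc n)) \<longlonglongrightarrow> i \<bullet> grad v x"
        if "i \<in> Basis" for i
      proof (rule Lim_transform_eventually[OF GDERIV_quotient_limit[OF G, of i]])
        show "\<forall>\<^sub>F n in sequentially. (v (x + (1 / real (Suc n)) *\<^sub>R i) - v x) * real (Suc n) =
          (v0 (x + (1 / real (Suc n)) *\<^sub>R i) - v0 x) * real (Suc n)"
          using ev
        proof eventually_elim
          case (elim n)
          have "x + (1 / real (Suc n)) *\<^sub>R i \<in> S"
            using elim that \<rho>(2) by (intro subsetD[OF \<rho>(2)]) (simp add: dist_norm)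
          then show ?case using True by (simp add: v0_def)
        qed
      qed
      have "(\<lambda>n. \<Sum>i\<in>Basis. ((v0 (x + (1 / real (Suc n)) *\<^sub>R i) - v0 x) * real (Suc n)) *\<^sub>R i)
        \<longlonglongrightarrow> (\<Sum>i\<in>Basis. (i \<bullet> grad v x) *\<^sub>R i)"
        by (intro tendsto_sum tendsto_scaleR 1 tendsto_const)
      moreover have "(\<Sum>i\<in>Basis. (i \<bullet> grad v x) *\<^sub>R i) = grad v x"
        unfolding inner_commute[of _ "grad v x"] by (rule euclidean_representation)
      ultimately show ?thesis using True by (simp add: g_def)
    qed (simp add: g_def)
  qed
  then show ?thesis by (simp add: measurable_on_iff_borel_measurable lebesgue_on_UNIV_eq)
qed

text \<open>Slopes of a convex function are monotone, so the step \<rho> controls all shorter ones.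
  This provides the dominating function for the passage from quotients to gradients.\<close>

lemma convex_quotient_bound:
  fixes k :: "'a::real_normed_vector \<Rightarrow> real"
  assumes k: "convex_on (ball x r) k" and M: "\<And>y. y \<in> ball x r \<Longrightarrow> \<bar>k y\<bar> \<le> M"
    and \<rho>: "\<rho> > 0" "norm (\<rho> *\<^sub>R h) < r" and t: "0 < t" "t \<le> \<rho>"
  shows "\<bar>(k (x + t *\<^sub>R h) - k x) / t\<bar> \<le> 2 * M / \<rho>"
proof -
  have r: "r > 0" using \<rho> norm_ge_zero by (meson le_less_trans)
  define p where "p y = k (x + y) - k x" for y
  have pc: "convex_on (ball 0 r) p"
  proof (rule convex_onI)
    fix t :: real and a b :: 'a assume h: "0 < t" "t < 1" "a \<in> ball 0 r" "b \<in> ball 0 r"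
    have "k ((1 - t) *\<^sub>R (x + a) + t *\<^sub>R (x + b)) \<le> (1 - t) * k (x + a) + t * k (x + b)"
      using h by (intro convex_onD[OF k]) (auto simp: dist_norm)
    moreover have "(1 - t) *\<^sub>R (x + a) + t *\<^sub>R (x + b) = x + ((1 - t) *\<^sub>R a + t *\<^sub>R b)"
      by (simp add: algebra_simps)
    ultimately show "p ((1 - t) *\<^sub>R a + t *\<^sub>R b) \<le> (1 - t) * p a + t * p b"
      by (simp add: p_def algebra_simps)
  qed simp
  have p0: "p 0 = 0" by (simp add: p_def)
  have pM: "p y \<le> 2 * M" if "norm y < r" for y
    using M[of "x + y"] M[of x] that r by (simp add: p_def dist_norm)
  have up: "p (t *\<^sub>R w) \<le> 2 * M / \<rho> * t" if "norm (\<rho> *\<^sub>R w) < r" for w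
  proof -
    have "p ((t / \<rho>) *\<^sub>R (\<rho> *\<^sub>R w)) \<le> (t / \<rho>) * p (\<rho> *\<^sub>R w)"
      by (rule convex_near_zero(1)[OF pc p0 r that]) (use t \<rho> in auto)
    also have "\<dots> \<le> (t / \<rho>) * (2 * M)" using pM[OF that] t \<rho> by (intro mult_left_mono) auto
    finally show ?thesis using \<rho> by (simp add: field_simps)
  qed
  have "norm (t *\<^sub>R h) \<le> norm (\<rho> *\<^sub>R h)" using t by (simp add: mult_right_mono)
  then have "- p (t *\<^sub>R h) \<le> p (- (t *\<^sub>R h))" using \<rho> by (intro convex_near_zero(2)[OF pc p0 r]) simp
  moreover have "p (t *\<^sub>R (- h)) \<le> 2 * M / \<rho> * t" using up[of "- h"] \<rho> by simp
  ultimately have "\<bar>p (t *\<^sub>R h)\<bar> \<le> 2 * M / \<rho> * t" using up[OF \<rho>(2)] by simp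
  then show ?thesis using t by (simp add: p_def pos_divide_le_eq)
qed

lemma set_integrable_bounded:
  fixes f :: "'a::euclidean_space \<Rightarrow> real"
  assumes "f \<in> borel_measurable lebesgue" "A \<in> sets lebesgue" "bounded A"
    and "AE x in lebesgue. x \<in> A \<longrightarrow> \<bar>f x\<bar> \<le> C"
  shows "set_integrable lebesgue A f"
  unfolding set_integrable_def
proof (rule Bochner_Integration.integrable_bound)
  have "A \<in> lmeasurable" using assms bounded_set_imp_lmeasurable by blast
  then show "integrable lebesgue (\<lambda>x. C * indicator A x)"
    by (intro integrable_mult_right) (simp add: lmeasurable_iff_integrable)
  show "(\<lambda>x. indicator A x *\<^sub>R f x) \<in> borel_measurable lebesgue" using assms by measurable
  show "AE x in lebesgue. norm (indicator A x *\<^sub>R f x) \<le> norm (C * indicator A x)"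
    using assms(4) by eventually_elim (auto simp: indicator_def)
qed

lemma integral_translate_lebesgue:
  fixes g :: "'a::euclidean_space \<Rightarrow> real"
  assumes "g \<in> borel_measurable lebesgue"
  shows "integral\<^sup>L lebesgue (\<lambda>x. g (x + t)) = integral\<^sup>L lebesgue g"
  using integral_lebesgue_affine[OF assms, of 1 t] by (simp add: add.commute)

text \<open>Translation invariance replaces integration by parts: \<open>k - u\<close>, extended by
  0, and its translates have the same integral, so every difference quotient has integral 0, and
  dominated convergence passes to the derivative.\<close>

lemma integral_grad_difference_zero:
  fixes u k :: "'a::euclidean_space \<Rightarrow> real"
  assumes u: "convex_on (ball b R) u" and k: "convex_on (ball b R) k" and r: "r < R"
    and eq: "\<And>x. x \<in> ball b R - cball b r \<Longrightarrow> k x = u x"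
    and M: "\<And>x. x \<in> ball b R \<Longrightarrow> \<bar>u x\<bar> \<le> M" "\<And>x. x \<in> ball b R \<Longrightarrow> \<bar>k x\<bar> \<le> M"
  shows "(LINT x:ball b R|lebesgue. h \<bullet> (grad k x - grad u x)) = 0"
    and "set_integrable lebesgue (ball b R) (\<lambda>x. h \<bullet> (grad k x - grad u x))"
proof -
  define B where "B = ball b R"
  have Bo: "open B" "bounded B" by (auto simp: B_def)
  have [measurable]: "B \<in> sets borel" using Bo by simp
  define w where "w x = (if x \<in> B then k x - u x else 0)" for x
  have cu: "continuous_on B u" and ck: "continuous_on B k"
    using convex_on_continuous[of "ball b R"] u k by (auto simp: B_def)
  have w[measurable]: "w \<in> borel_measurable borel"
    unfolding w_def by (rule borel_measurable_continuous_on_if) (use cu ck Bo in \<open>auto intro!: continuous_intros\<close>)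
  have wl: "w \<in> borel_measurable lebesgue" by (simp add: measurable_completion)
  \<comment> \<open>An intermediate radius: from a point within \<open>R1\<close> of
    \<open>b\<close> the step stays in the ball and the convex bound applies; from a point beyond it
    both ends of the step lie where \<open>w\<close> vanishes.\<close>
  define R1 where "R1 = (r + R) / 2"
  have R1: "r < R1" "R1 < R" using r by (auto simp: R1_def)
  define \<rho> where "\<rho> = (R1 - r) / (2 * (norm h + 1))"
  have nh: "norm h + 1 > 0" using norm_ge_zero[of h] by linarith
  have \<rho>: "\<rho> > 0" using R1 nh by (simp add: \<rho>_def)
  have "norm (\<rho> *\<^sub>R h) = (R1 - r) / 2 * (norm h / (norm h + 1))" using R1 nh by (simp add: \<rho>_def)
  also have "\<dots> \<le> (R1 - r) / 2 * 1" using R1 nh by (intro mult_left_mono) auto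
  also have "\<dots> < R1 - r" using R1 by simp
  finally have \<rho>h: "norm (\<rho> *\<^sub>R h) < R1 - r" .
  obtain n0 where n0: "1 / real (Suc n0) < \<rho>" using reals_Archimedean[OF \<rho>] by (auto simp: inverse_eq_divide)
  \<comment> \<open>The quotients start at index \<open>n0\<close>, so that every step is at most
    \<rho>.\<close>
  define d where "d n x = (w (x + (1 / real (Suc (n + n0))) *\<^sub>R h) - w x) * real (Suc (n + n0))" for n x
  have tn: "0 < 1 / real (Suc (n + n0))" "1 / real (Suc (n + n0)) \<le> \<rho>" for n
  proof -
    have "1 / real (Suc (n + n0)) \<le> 1 / real (Suc n0)" by (intro divide_left_mono) auto
    then show "1 / real (Suc (n + n0)) \<le> \<rho>" using n0 by linarith
  qed simp
  have tnh: "norm ((1 / real (Suc (n + n0))) *\<^sub>R h) < R1 - r" for n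
  proof -
    have "norm ((1 / real (Suc (n + n0))) *\<^sub>R h) \<le> norm (\<rho> *\<^sub>R h)"
      unfolding norm_scaleR using tn[of n] \<rho> by (intro mult_right_mono) auto
    then show ?thesis using \<rho>h by linarith
  qed
  have w0: "w x = 0" if "dist b x > r" for x using eq that by (auto simp: w_def B_def)
  have bound: "\<bar>d n x\<bar> \<le> 4 * M / \<rho> * indicator B x" for n x
  proof (cases "dist b x < R1")
    case True
    have sub: "ball x (R1 - r) \<subseteq> B"
    proof
      fix y assume "y \<in> ball x (R1 - r)"
      then have "dist b y < R1 + (R1 - r)" using True dist_triangle[of b y x] by simp
      also have "\<dots> = R" by (simp add: R1_def field_simps)
      finally show "y \<in> B" by (simp add: B_def)
    qed
    have xB: "x \<in> B" using True R1 by (simp add: B_def)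
    let ?t = "1 / real (Suc (n + n0))"
    have inB: "x + ?t *\<^sub>R h \<in> B" using sub tnh[of n] by (intro subsetD[OF sub]) (simp add: dist_norm)
    have "\<bar>(k (x + ?t *\<^sub>R h) - k x) / ?t\<bar> \<le> 2 * M / \<rho>"
      using sub M(2) by (intro convex_quotient_bound[OF convex_on_subset[OF k] _ \<rho> \<rho>h tn]) (auto simp: B_def)
    moreover have "\<bar>(u (x + ?t *\<^sub>R h) - u x) / ?t\<bar> \<le> 2 * M / \<rho>"
      using sub M(1) by (intro convex_quotient_bound[OF convex_on_subset[OF u] _ \<rho> \<rho>h tn]) (auto simp: B_def)
    moreover have "d n x = (k (x + ?t *\<^sub>R h) - k x) / ?t - (u (x + ?t *\<^sub>R h) - u x) / ?t"
      using xB inB by (simp add: d_def w_def field_simps)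
    ultimately show ?thesis using xB by simp
  next
    case False
    have "dist b (x + (1 / real (Suc (n + n0))) *\<^sub>R h) > r"
      using False tnh[of n] dist_triangle[of b x "x + (1 / real (Suc (n + n0))) *\<^sub>R h"] by (simp add: dist_norm)
    then have "d n x = 0" using w0 False R1 by (simp add: d_def)
    moreover have "M \<ge> 0" if "x \<in> B" using M(1)[of x] that by (auto simp: B_def)
    ultimately show ?thesis using \<rho> by (auto simp: indicator_def)
  qed
  have dm: "d n \<in> borel_measurable lebesgue" for n
  proof -
    have "d n \<in> borel_measurable borel" unfolding d_def by measurable
    then show ?thesis by (simp add: measurable_completion)
  qed
  have iB: "integrable lebesgue (\<lambda>x. 4 * M / \<rho> * indicator B x)"
    using bounded_set_imp_lmeasurable[OF Bo(2)] Bo(1)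
    by (intro integrable_mult_right) (simp add: lmeasurable_iff_integrable)
  have int0: "integral\<^sup>L lebesgue (d n) = 0" for n
  proof -
    have wi: "integrable lebesgue w"
    proof (rule Bochner_Integration.integrable_bound)
      show "integrable lebesgue (\<lambda>x. 2 * M * indicator B x)"
        using bounded_set_imp_lmeasurable[OF Bo(2)] Bo(1)
        by (intro integrable_mult_right) (simp add: lmeasurable_iff_integrable)
      show "AE x in lebesgue. norm (w x) \<le> norm (2 * M * indicator B x)"
      proof (intro AE_I2)
        fix x show "norm (w x) \<le> norm (2 * M * indicator B x)"
          using M(1)[of x] M(2)[of x] by (auto simp: w_def B_def indicator_def)
      qed
    qed (fact wl)
    have wt: "integrable lebesgue (\<lambda>x. w (x + t))" for t
    proof (rule ccontr)
      assume n: "\<not> ?thesis"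
      have "integrable lebesgue (\<lambda>x. \<bar>w x\<bar>)" using wi by simp
      have "integrable lebesgue (\<lambda>x. w (x + t))"
      proof (rule Bochner_Integration.integrable_bound)
        have bt: "bounded ((\<lambda>x. x + - t) ` B)" using Bo(2) by (simp only: bounded_translation_minus flip: diff_conv_add_uminus)
        have ot: "open ((\<lambda>x. x + - t) ` B)" using open_translation_subtract[OF Bo(1), of t] by simp
        show "integrable lebesgue (\<lambda>x. 2 * M * indicator ((\<lambda>x. x + - t) ` B) x)"
          using bounded_set_imp_lmeasurable[OF bt] ot
          by (intro integrable_mult_right) (simp add: lmeasurable_iff_integrable)
        have "(\<lambda>x. w (x + t)) \<in> borel_measurable borel" by measurable
        then show "(\<lambda>x. w (x + t)) \<in> borel_measurable lebesgue" by (simp add: measurable_completion)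
        show "AE x in lebesgue. norm (w (x + t)) \<le> norm (2 * M * indicator ((\<lambda>x. x + - t) ` B) x)"
        proof (intro AE_I2)
          fix x
          have "x + t \<in> B \<Longrightarrow> x \<in> (\<lambda>x. x + - t) ` B" by (rule image_eqI[of _ _ "x + t"]) auto
          then show "norm (w (x + t)) \<le> norm (2 * M * indicator ((\<lambda>x. x + - t) ` B) x)"
            using M(1)[of "x + t"] M(2)[of "x + t"] by (auto simp: w_def B_def indicator_def)
        qed
      qed
      then show False using n by simp
    qed
    have "integral\<^sup>L lebesgue (d n) = (integral\<^sup>L lebesgue (\<lambda>x. w (x + (1 / real (Suc (n + n0))) *\<^sub>R h)) - integral\<^sup>L lebesgue w) * real (Suc (n + n0))"
      unfolding d_def using wt[of "(1 / real (Suc (n + n0))) *\<^sub>R h"] wi by simp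
    then show ?thesis using integral_translate_lebesgue[OF wl] by simp
  qed
  define L where "L x = (if x \<in> B then h \<bullet> (grad k x - grad u x) else 0)" for x
  have nk: "AE x in lebesgue. x \<in> B \<longrightarrow> k differentiable (at x)" and nu: "AE x in lebesgue. x \<in> B \<longrightarrow> u differentiable (at x)"
    using AE_differentiable_convex[OF k] AE_differentiable_convex[OF u] by (auto simp: B_def)
  have lim: "AE x in lebesgue. (\<lambda>n. d n x) \<longlonglongrightarrow> L x"
    using nk nu
  proof eventually_elim
    case (elim x)
    show ?case
    proof (cases "x \<in> B")
      case True
      have "GDERIV k x :> grad k x" "GDERIV u x :> grad u x" using True elim GDERIV_grad by auto
      then have "GDERIV (\<lambda>y. k y - u y) x :> grad k x - grad u x"
        by (rule GDERIV_diff)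
      then have G: "GDERIV w x :> grad k x - grad u x"
        unfolding gderiv_def
        by (rule has_derivative_transform_within_open[OF _ Bo(1) True]) (simp add: w_def)
      have "(\<lambda>n. d n x) \<longlonglongrightarrow> h \<bullet> (grad k x - grad u x)"
        unfolding d_def using LIMSEQ_ignore_initial_segment[OF GDERIV_quotient_limit[OF G, of h], of n0] by simp
      then show ?thesis using True by (simp add: L_def)
    next
      case False
      then have "d n x = 0" for n using bound[of n x] by simp
      then show ?thesis using False by (simp add: L_def)
    qed
  qed
  have Lm: "L \<in> borel_measurable lebesgue"
  proof -
    have "L = (\<lambda>x. h \<bullet> ((if x \<in> ball b R then grad k x else 0) - (if x \<in> ball b R then grad u x else 0)))"
      by (auto simp: L_def B_def)
    moreover have "(\<lambda>x. h \<bullet> ((if x \<in> ball b R then grad k x else 0) - (if x \<in> ball b R then grad u x else 0))) \<in> borel_measurable lebesgue"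
      by (intro borel_measurable_inner borel_measurable_diff borel_measurable_const
          borel_measurable_grad[OF k open_ball bounded_ball] borel_measurable_grad[OF u open_ball bounded_ball])
    ultimately show ?thesis by (simp only:)
  qed
  have bd: "AE x in lebesgue. norm (d n x) \<le> 4 * M / \<rho> * indicator B x" for n
    using bound by (intro AE_I2) simp
  have "(\<lambda>n. integral\<^sup>L lebesgue (d n)) \<longlonglongrightarrow> integral\<^sup>L lebesgue L"
    by (rule integral_dominated_convergence[OF Lm dm iB lim bd])
  then have I: "integral\<^sup>L lebesgue L = 0" using int0 by (simp add: LIMSEQ_const_iff)
  have J: "integrable lebesgue L" by (rule integrable_dominated_convergence[OF Lm dm iB lim bd])
  have Leq: "(\<lambda>x. indicator (ball b R) x *\<^sub>R (h \<bullet> (grad k x - grad u x))) = L"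
    by (auto simp: L_def B_def indicator_def)
  show "(LINT x:ball b R|lebesgue. h \<bullet> (grad k x - grad u x)) = 0"
    "set_integrable lebesgue (ball b R) (\<lambda>x. h \<bullet> (grad k x - grad u x))"
    unfolding set_lebesgue_integral_def set_integrable_def Leq using I J by auto
qed

subsection \<open>Cutting a nose into a convex graph\<close>

lemma convex_GDERIV_above_tangent:
  fixes v :: "'a::real_inner \<Rightarrow> real"
  assumes v: "convex_on S v" and x: "x \<in> S" and y: "y \<in> S" and D: "GDERIV v x :> D"
  shows "v x + D \<bullet> (y - x) \<le> v y"
proof -
  have "(y - x) \<bullet> D \<le> v y - v x"
  proof (rule LIMSEQ_le_const2[OF GDERIV_quotient_limit[OF D, of "y - x"]], intro exI allI impI)
    fix n :: nat
    define t where "t = 1 / real (Suc n)"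
    have t: "0 \<le> t" "t \<le> 1" "t * real (Suc n) = 1" by (simp_all add: t_def)
    have eq: "x + t *\<^sub>R (y - x) = (1 - t) *\<^sub>R x + t *\<^sub>R y" by (simp add: algebra_simps)
    have "v (x + t *\<^sub>R (y - x)) \<le> (1 - t) * v x + t * v y"
      unfolding eq by (rule convex_onD[OF v]) (use x y t in auto)
    then have "v (x + t *\<^sub>R (y - x)) - v x \<le> t * (v y - v x)" by (simp add: algebra_simps)
    then have "(v (x + t *\<^sub>R (y - x)) - v x) * real (Suc n) \<le> t * (v y - v x) * real (Suc n)"
      by (rule mult_right_mono) simp
    also have "\<dots> = (t * real (Suc n)) * (v y - v x)" by (simp only: mult_ac)
    finally show "(v (x + (1 / real (Suc n)) *\<^sub>R (y - x)) - v x) * real (Suc n) \<le> v y - v x"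
      by (simp only: t(3) mult_1 t_def[symmetric])
  qed
  then show ?thesis by (simp add: inner_commute)
qed

text \<open>The difference has a minimum at \<open>x\<close>. Gradients of suprema and hulls are
  found in this way throughout: differentiability holds almost everywhere, and any touching function
  then reveals the gradient.\<close>

lemma GDERIV_touching:
  fixes p k :: "'a::real_inner \<Rightarrow> real"
  assumes k: "GDERIV k x :> D" and p: "GDERIV p x :> D'" and S: "open S" "x \<in> S"
    and le: "\<And>y. y \<in> S \<Longrightarrow> p y \<le> k y" and eq: "p x = k x"
  shows "D = D'"
proof -
  have "GDERIV (\<lambda>y. k y - p y) x :> D - D'" using k p by (rule GDERIV_diff)
  then have "((\<lambda>y. k y - p y) has_derivative (\<lambda>h. h \<bullet> (D - D'))) (at x)" by (simp add: gderiv_def)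
  then have "(\<lambda>h. h \<bullet> (D - D')) = (\<lambda>v. 0)"
    by (rule differential_zero_maxmin[OF S(2,1)]) (use le eq in auto)
  then have "(D - D') \<bullet> (D - D') = 0" by metis
  then show ?thesis by simp
qed

lemma GDERIV_affine: "GDERIV (\<lambda>y. c + D \<bullet> (y - x)) w :> D"
  unfolding gderiv_def by (auto intro!: derivative_eq_intros simp: inner_commute)

text \<open>Differentiability is understood in the whole space at every point of the closed ball,
  the sphere included, as is the case for a closed ball inside an open set where \<open>u\<close> is
  C^1. So compactness arguments apply to \<open>G\<close>.\<close>

locale C1_ball =
  fixes b :: "'a::euclidean_space" and R :: real and u :: "'a \<Rightarrow> real" and G :: "'a \<Rightarrow> 'a"
  assumes R: "R > 0" and cv: "convex_on (cball b R) u"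
    and G: "\<And>x. x \<in> cball b R \<Longrightarrow> GDERIV u x :> G x"
    and Gc: "continuous_on (cball b R) G"
begin

abbreviation B where "B \<equiv> ball b R"
abbreviation K where "K \<equiv> cball b R"

text \<open>The foot of the tangent plane comes first. Mostly this is read as a function of
  \<open>x\<close> with a tip \<open>p\<close> as second argument: \<open>T x p > z\<close> says
  that \<open>(p, z)\<close> lies strictly below the tangent plane at \<open>x\<close>.\<close>

definition T :: "'a \<Rightarrow> 'a \<Rightarrow> real" where "T x y = u x + G x \<bullet> (y - x)"

lemma T_le: "x \<in> K \<Longrightarrow> y \<in> K \<Longrightarrow> T x y \<le> u y"
  unfolding T_def using convex_GDERIV_above_tangent[OF cv _ _ G] by blast

lemma T_self [simp]: "T x x = u x" by (simp add: T_def)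

lemma u_cont: "continuous_on K u"
  using G has_derivative_continuous unfolding gderiv_def
  by (intro continuous_at_imp_continuous_on) blast

lemma T_cont: "continuous_on K (\<lambda>x. T x p)"
  unfolding T_def by (intro continuous_intros u_cont Gc)

lemma u_upper:
  assumes "x \<in> K" "y \<in> K"
  shows "u y \<le> T x y + norm (G y - G x) * norm (y - x)"
proof -
  have "T y x \<le> u x" using T_le assms by blast
  then have "u y \<le> T x y + (G y - G x) \<bullet> (y - x)" by (simp add: T_def inner_simps algebra_simps)
  also have "(G y - G x) \<bullet> (y - x) \<le> norm (G y - G x) * norm (y - x)" by (rule norm_cauchy_schwarz)
  finally show ?thesis by simp
qed

text \<open>
  Quantitative form of: an affine minorant touching \<open>u\<close> at an interior point is the tangent there.
\<close>

lemma near_touch: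
  assumes x: "cball x r \<subseteq> K" "r > 0"
    and low: "\<And>y. y \<in> K \<Longrightarrow> c + \<xi> \<bullet> (y - x) \<le> u y"
    and c: "u x - \<tau> \<le> c" and \<omega>: "\<And>y. y \<in> K \<Longrightarrow> dist y x \<le> r \<Longrightarrow> norm (G y - G x) \<le> \<omega>"
  shows "norm (\<xi> - G x) \<le> \<tau> / r + \<omega>"
proof (cases "\<xi> = G x")
  case True
  have xK: "x \<in> K" using x by (intro subsetD[OF x(1)]) simp
  have "\<omega> \<ge> 0" using \<omega>[OF xK] x by simp
  moreover have "\<tau> \<ge> 0" using low[OF xK] c by simp
  ultimately show ?thesis using True x by simp
next
  case False
  define n where "n = norm (\<xi> - G x)"
  have n: "n > 0" using False by (simp add: n_def)
  \<comment> \<open>The test point lies in the direction in which the minorant rises fastest against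
    the tangent plane, at distance exactly \<open>r\<close>.\<close>
  define h where "h = (r / n) *\<^sub>R (\<xi> - G x)"
  have nh: "norm h = r" using n x by (simp add: h_def flip: n_def)
  have xK: "x \<in> K" using x by (intro subsetD[OF x(1)]) simp
  have yK: "x + h \<in> K" using x nh by (intro subsetD[OF x(1)]) (simp add: dist_norm)
  have "(\<xi> - G x) \<bullet> h = (r / n) * (n * n)" by (simp add: h_def n_def flip: power2_norm_eq_inner power2_eq_square)
  then have e: "(\<xi> - G x) \<bullet> h = r * n" using n by simp
  have "c + \<xi> \<bullet> h \<le> u (x + h)" using low[OF yK] by simp
  also have "\<dots> \<le> u x + G x \<bullet> h + norm (G (x + h) - G x) * r"
    using u_upper[OF xK yK] nh by (simp add: T_def)
  also have "\<dots> \<le> u x + G x \<bullet> h + \<omega> * r"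
    using \<omega>[OF yK] nh x(2) by (intro add_left_mono mult_right_mono) (auto simp: dist_norm)
  finally have "r * n \<le> \<tau> + \<omega> * r" using e c by (simp add: inner_simps)
  then have "n \<le> (\<tau> + \<omega> * r) / r" using x(2) by (simp add: pos_le_divide_eq mult.commute)
  then show ?thesis using x(2) by (simp add: n_def add_divide_distrib)
qed

lemma minorant_touch:
  assumes x: "x \<in> B" and low: "\<And>y. y \<in> K \<Longrightarrow> c + \<xi> \<bullet> (y - x) \<le> u y" and c: "c = u x"
  shows "\<xi> = G x"
  by (rule GDERIV_touching[OF G GDERIV_affine[of c \<xi> x] open_ball x, symmetric])
    (use x low c in auto)

section \<open>Noses as envelopes of affine functions\<close>

definition adm :: "'a set \<Rightarrow> real \<Rightarrow> (real \<times> 'a) set" where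
  "adm X z = {(a, \<xi>). (\<forall>y\<in>K. a + \<xi> \<bullet> y \<le> u y) \<and> (\<forall>p\<in>X. a + \<xi> \<bullet> p \<le> z)}"

text \<open>
  \<open>nose X z\<close> is the function whose epigraph is the closed convex hull of the epigraph of \<open>u\<close>
  over the ball together with the points \<open>(p, z)\<close>, \<open>p \<in> X\<close>.
\<close>

definition nose :: "'a set \<Rightarrow> real \<Rightarrow> 'a \<Rightarrow> real" where
  "nose X z x = (SUP (a, \<xi>)\<in>adm X z. a + \<xi> \<bullet> x)"

lemma adm_nonempty: "adm X z \<noteq> {}"
proof -
  have ne: "K \<noteq> {}" using R by auto
  obtain m where m: "m \<in> K" "\<And>y. y \<in> K \<Longrightarrow> u m \<le> u y"
    using continuous_attains_inf[OF compact_cball ne u_cont] by blast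
  then have "(min (u m) z, 0) \<in> adm X z" by (auto simp: adm_def intro: order_trans[OF min.cobounded1])
  then show ?thesis by blast
qed

text \<open>Basis of the perturbation arguments below. \<open>adm {} z\<close> consists of all
  affine minorants of \<open>u\<close>; a combination of two of them is again a minorant, so only
  its heights at the tips are left to check.\<close>

lemma adm_convex:
  assumes "(a, \<xi>) \<in> adm {} z" "(a', \<xi>') \<in> adm {} z" "0 \<le> t" "t \<le> 1"
    and "\<And>p. p \<in> X \<Longrightarrow> (1 - t) * (a + \<xi> \<bullet> p) + t * (a' + \<xi>' \<bullet> p) \<le> z"
  shows "((1 - t) * a + t * a', (1 - t) *\<^sub>R \<xi> + t *\<^sub>R \<xi>') \<in> adm X z"
proof -
  have e: "(1 - t) * a + t * a' + ((1 - t) *\<^sub>R \<xi> + t *\<^sub>R \<xi>') \<bullet> y = (1 - t) * (a + \<xi> \<bullet> y) + t * (a' + \<xi>' \<bullet> y)" for y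
    by (simp add: inner_simps algebra_simps)
  have "(1 - t) * (a + \<xi> \<bullet> y) + t * (a' + \<xi>' \<bullet> y) \<le> (1 - t) * u y + t * u y" if "y \<in> K" for y
    using assms(1-4) that by (intro add_mono mult_left_mono) (auto simp: adm_def)
  then show ?thesis using assms(5) by (auto simp: adm_def e algebra_simps)
qed

lemma nose_ge:
  assumes "(a, \<xi>) \<in> adm X z" "x \<in> K"
  shows "a + \<xi> \<bullet> x \<le> nose X z x"
  unfolding nose_def
proof (rule cSUP_upper2[OF _ assms(1)])
  show "bdd_above ((\<lambda>(a, \<xi>). a + \<xi> \<bullet> x) ` adm X z)"
    using assms(2) by (intro bdd_aboveI[of _ "u x"]) (auto simp: adm_def)
qed simp

lemma nose_le:
  assumes "\<And>a \<xi>. (a, \<xi>) \<in> adm X z \<Longrightarrow> a + \<xi> \<bullet> x \<le> c"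
  shows "nose X z x \<le> c"
  unfolding nose_def using adm_nonempty assms by (intro cSUP_least) auto

lemma nose_le_u: "x \<in> K \<Longrightarrow> nose X z x \<le> u x"
  by (rule nose_le) (auto simp: adm_def)

lemma nose_tip: "p \<in> X \<Longrightarrow> nose X z p \<le> z"
  by (rule nose_le) (auto simp: adm_def)

lemma nose_antimono: "Y \<subseteq> X \<Longrightarrow> x \<in> K \<Longrightarrow> nose X z x \<le> nose Y z x"
  by (rule nose_le, rule nose_ge) (auto simp: adm_def)

lemma nose_convex: "convex_on K (nose X z)"
proof (rule convex_onI)
  fix t x y assume t: "0 < (t::real)" "t < 1" and xy: "x \<in> K" "y \<in> K"
  show "nose X z ((1 - t) *\<^sub>R x + t *\<^sub>R y) \<le> (1 - t) * nose X z x + t * nose X z y"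
  proof (rule nose_le)
    fix a \<xi> assume l: "(a, \<xi>) \<in> adm X z"
    have "a + \<xi> \<bullet> ((1 - t) *\<^sub>R x + t *\<^sub>R y) = (1 - t) * (a + \<xi> \<bullet> x) + t * (a + \<xi> \<bullet> y)"
      by (simp add: inner_simps algebra_simps)
    also have "\<dots> \<le> (1 - t) * nose X z x + t * nose X z y"
      using t xy nose_ge[OF l] by (intro add_mono mult_left_mono) auto
    finally show "a + \<xi> \<bullet> ((1 - t) *\<^sub>R x + t *\<^sub>R y) \<le> (1 - t) * nose X z x + t * nose X z y" .
  qed
qed simp

text \<open>The tangent plane at \<open>x\<close>, lowered by \<open>M\<close>, is
  admissible.\<close>

lemma nose_lower:
  assumes x: "x \<in> K" and M: "0 \<le> M" "\<And>p. p \<in> X \<Longrightarrow> T x p \<le> z + M"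
  shows "u x - M \<le> nose X z x"
proof -
  have "(u x - G x \<bullet> x - M, G x) \<in> adm X z"
    unfolding adm_def using T_le[OF x] M by (force simp: T_def inner_simps algebra_simps)
  from nose_ge[OF this x] show ?thesis by simp
qed

lemma nose_eq_u:
  assumes x: "x \<in> K" and "\<And>p. p \<in> X \<Longrightarrow> T x p \<le> z"
  shows "nose X z x = u x"
  using nose_lower[OF x, of 0 X z] nose_le_u[OF x, of X z] assms(2) by simp

lemma nose_support:
  assumes X: "X \<subseteq> K" and x: "x \<in> B" and D: "GDERIV (nose X z) x :> D"
  shows "y \<in> K \<Longrightarrow> nose X z x + D \<bullet> (y - x) \<le> nose X z y"
    and "(nose X z x - D \<bullet> x, D) \<in> adm X z"
proof -
  show *: "nose X z x + D \<bullet> (y - x) \<le> nose X z y" if "y \<in> K" for y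
    by (rule convex_GDERIV_above_tangent[OF nose_convex _ that D]) (use x in auto)
  have e: "nose X z x - D \<bullet> x + D \<bullet> y = nose X z x + D \<bullet> (y - x)" for y by (simp add: inner_simps)
  show "(nose X z x - D \<bullet> x, D) \<in> adm X z"
    unfolding adm_def mem_Collect_eq prod.case e
  proof (intro conjI ballI)
    show "nose X z x + D \<bullet> (y - x) \<le> u y" if "y \<in> K" for y
      using *[OF that] nose_le_u[OF that] by (rule order_trans)
    show "nose X z x + D \<bullet> (p - x) \<le> z" if "p \<in> X" for p
      using *[of p] nose_tip[OF that] X that by (meson order_trans subsetD)
  qed
qed

lemma tangent_adm: "x \<in> K \<Longrightarrow> (u x - G x \<bullet> x, G x) \<in> adm {} z"
  unfolding adm_def using T_le[of x] by (auto simp: T_def inner_simps algebra_simps)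

text \<open>Equality would make the supporting plane of the nose a minorant of \<open>u\<close>
  touching at \<open>x\<close>, that is the tangent plane there, which passes above the tip
  \<open>(p, z)\<close>.\<close>

lemma nose_less_u:
  assumes X: "X \<subseteq> K" and x: "x \<in> B" and D: "GDERIV (nose X z) x :> D" and p: "p \<in> X" "T x p > z"
  shows "nose X z x < u x"
proof (rule ccontr)
  assume "\<not> ?thesis"
  then have eq: "nose X z x = u x" using nose_le_u[of x X z] x by simp
  have "nose X z x + D \<bullet> (y - x) \<le> u y" if "y \<in> K" for y
    using nose_support(1)[OF X x D that] nose_le_u[OF that] by (rule order_trans)
  then have "D = G x" by (rule minorant_touch[OF x _ eq])
  then have "T x p \<le> nose X z p" using nose_support(1)[OF X x D, of p] p X eq by (auto simp: T_def)
  then show False using nose_tip[OF p(1), of z] p(2) by simp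
qed

text \<open>If the supporting plane passed strictly below all of the finitely many tips, a little of
  the tangent plane at \<open>x\<close>, which is higher at \<open>x\<close>, could be mixed
  in.\<close>

lemma nose_support_tip:
  assumes X: "X \<subseteq> K" "finite X" and x: "x \<in> B" and D: "GDERIV (nose X z) x :> D" and less: "nose X z x < u x"
  shows "\<exists>p\<in>X. nose X z x + D \<bullet> (p - x) = z"
proof (rule ccontr)
  assume n: "\<not> ?thesis"
  define l where "l p = nose X z x + D \<bullet> (p - x)" for p
  have xK: "x \<in> K" using x by simp
  have adm: "(nose X z x - D \<bullet> x, D) \<in> adm X z" using nose_support(2)[OF X(1) x D] .
  have le: "l p < z" if "p \<in> X" for p
    using adm n that by (force simp: adm_def l_def inner_simps)
  have "\<exists>t\<in>{0<..1}. \<forall>p\<in>X. (1 - t) * l p + t * T x p \<le> z"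
  proof -
    have "\<forall>\<^sub>F t in at_right 0. (1 - t) * l p + t * T x p < z" if "p \<in> X" for p
    proof -
      have "((\<lambda>t. (1 - t) * l p + t * T x p) \<longlongrightarrow> (1 - 0) * l p + 0 * T x p) (at_right 0)" by (intro tendsto_intros)
      then show ?thesis using order_tendstoD(2) le[OF that] by fastforce
    qed
    then have "\<forall>\<^sub>F t in at_right 0. \<forall>p\<in>X. (1 - t) * l p + t * T x p < z" using X(2) by (simp add: eventually_ball_finite)
    moreover have "\<forall>\<^sub>F t in at_right (0::real). t \<in> {0<..<1}" by (rule eventually_at_right_real) simp
    ultimately have "\<forall>\<^sub>F t in at_right 0. t \<in> {0<..<1} \<and> (\<forall>p\<in>X. (1 - t) * l p + t * T x p < z)" by eventually_elim auto
    then obtain t where "t \<in> {0<..<1} \<and> (\<forall>p\<in>X. (1 - t) * l p + t * T x p < z)"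
      using eventually_happens[of _ "at_right (0::real)"] trivial_limit_at_right_real by blast
    then show ?thesis by (intro bexI[of _ t]) (auto intro: less_imp_le)
  qed
  then obtain t where t: "0 < t" "t \<le> 1" "\<And>p. p \<in> X \<Longrightarrow> (1 - t) * l p + t * T x p \<le> z" by auto
  have adm0: "(nose X z x - D \<bullet> x, D) \<in> adm {} z" using adm by (auto simp: adm_def)
  have "((1 - t) * (nose X z x - D \<bullet> x) + t * (u x - G x \<bullet> x), (1 - t) *\<^sub>R D + t *\<^sub>R G x) \<in> adm X z"
  proof (rule adm_convex[OF adm0 tangent_adm[OF xK]])
    fix p assume "p \<in> X"
    from t(3)[OF this] show "(1 - t) * (nose X z x - D \<bullet> x + D \<bullet> p) + t * (u x - G x \<bullet> x + G x \<bullet> p) \<le> z"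
      by (simp add: l_def T_def inner_simps algebra_simps)
  qed (use t in auto)
  from nose_ge[OF this xK] have "(1 - t) * nose X z x + t * u x \<le> nose X z x"
    by (simp add: inner_simps algebra_simps)
  then have "t * u x \<le> t * nose X z x" by (simp add: algebra_simps)
  then show False using t less by simp
qed

text \<open>The supporting plane at \<open>x\<close> contains the tip, so convexity makes the nose
  affine along the segment from \<open>x\<close> to \<open>p\<close>, and the plane touches it there
  as well. Over the visible part the nose is thus a cone with apex \<open>(p, z)\<close>.\<close>

lemma nose_homogeneous:
  assumes p: "p \<in> B" and x: "x \<in> B" "T x p > z" and D: "GDERIV (nose {p} z) x :> D"
    and s: "0 \<le> s" "s \<le> 1" and D': "GDERIV (nose {p} z) ((1 - s) *\<^sub>R x + s *\<^sub>R p) :> D'"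
  shows "D' = D"
proof -
  let ?N = "nose {p} z" and ?y = "(1 - s) *\<^sub>R x + s *\<^sub>R p"
  have X: "{p} \<subseteq> K" using p by simp
  have tip: "?N x + D \<bullet> (p - x) = z"
    using nose_support_tip[OF X _ x(1) D nose_less_u[OF X x(1) D _ x(2)]] by simp
  have yB: "?y \<in> B" using p x s by (intro convexD) auto
  have "?N ?y \<le> (1 - s) * ?N x + s * ?N p"
    using p x s by (intro convex_onD[OF nose_convex]) auto
  also have "\<dots> \<le> (1 - s) * ?N x + s * z" using nose_tip[of p "{p}" z] s by (intro add_left_mono mult_left_mono) auto
  also have "\<dots> = ?N x + D \<bullet> (?y - x)"
  proof -
    have "D \<bullet> (?y - x) = s * (D \<bullet> (p - x))" by (simp add: inner_simps algebra_simps)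
    moreover have "s * (D \<bullet> (p - x)) = s * (z - ?N x)" using tip by (intro arg_cong[where f="(*) s"]) linarith
    ultimately show ?thesis by (simp add: algebra_simps)
  qed
  finally have "?N ?y = ?N x + D \<bullet> (?y - x)"
    using nose_support(1)[OF X x(1) D, of ?y] yB by simp
  then show ?thesis
    by (intro GDERIV_touching[OF D' GDERIV_affine[of "?N x" D x] open_ball yB])
      (use nose_support(1)[OF X x(1) D] in auto)
qed

text \<open>
  Where the gradient points away from \<open>q\<close>, the tip at \<open>q\<close> is invisible.
\<close>

lemma nose_two_one:
  assumes p: "p \<in> B" "q \<in> B" and x: "x \<in> B" and D: "GDERIV (nose {p, q} z) x :> D" "GDERIV (nose {p} z) x :> D'"
    and neg: "D \<bullet> (q - p) < 0 \<or> D' \<bullet> (q - p) < 0"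
  shows "D' = D"
proof -
  let ?N = "nose {p, q} z" and ?M = "nose {p} z"
  have X: "{p, q} \<subseteq> K" "{p} \<subseteq> K" using p by auto
  have xK: "x \<in> K" using x by simp
  have le: "?N y \<le> ?M y" if "y \<in> K" for y using that by (intro nose_antimono) auto
  have "?M x \<le> ?N x"
  proof (rule ccontr)
    assume n: "\<not> ?thesis"
    show False
    proof (cases "D' \<bullet> (q - p) < 0")
      case True
      have a: "(?M x - D' \<bullet> x, D') \<in> adm {p} z" by (rule nose_support(2)[OF X(2) x D(2)])
      then have "(?M x - D' \<bullet> x, D') \<in> adm {p, q} z"
        using True by (auto simp: adm_def inner_simps)
      from nose_ge[OF this xK] n show False by simp
    next
      case False
      \<comment> \<open>The supporting plane leaves room at \<open>q\<close>, so a little of a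
        minorant that is admissible for \<open>p\<close> alone and higher at \<open>x\<close> can be
        mixed in.\<close>
      then have neg: "D \<bullet> (q - p) < 0" using neg by blast
      have adm: "(?N x - D \<bullet> x, D) \<in> adm {p, q} z" using nose_support(2)[OF X(1) x D(1)] .
      define l where "l y = ?N x - D \<bullet> x + D \<bullet> y" for y
      have lp: "l p \<le> z" and lq: "l q < z" using adm neg by (auto simp: adm_def l_def inner_simps)
      have "\<exists>l\<in>adm {p} z. ?N x < (case l of (a, \<xi>) \<Rightarrow> a + \<xi> \<bullet> x)"
      proof (rule ccontr)
        assume "\<not> ?thesis"
        then have "?M x \<le> ?N x" by (intro nose_le) (force simp: not_less)
        then show False using n by simp
      qed
      then obtain a \<xi> where a: "(a, \<xi>) \<in> adm {p} z" "?N x < a + \<xi> \<bullet> x" by auto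
      have "((\<lambda>t. (1 - t) * l q + t * (a + \<xi> \<bullet> q)) \<longlongrightarrow> (1 - 0) * l q + 0 * (a + \<xi> \<bullet> q)) (at_right 0)"
        by (intro tendsto_intros)
      then have "\<forall>\<^sub>F t in at_right 0. (1 - t) * l q + t * (a + \<xi> \<bullet> q) < z"
        using order_tendstoD(2) lq by fastforce
      moreover have "\<forall>\<^sub>F t in at_right (0::real). t \<in> {0<..<1}" by (rule eventually_at_right_real) simp
      ultimately have "\<forall>\<^sub>F t in at_right 0. t \<in> {0<..<1} \<and> (1 - t) * l q + t * (a + \<xi> \<bullet> q) < z" by eventually_elim auto
      then obtain t where t: "t \<in> {0<..<1} \<and> (1 - t) * l q + t * (a + \<xi> \<bullet> q) < z"
        using eventually_happens[of _ "at_right (0::real)"] trivial_limit_at_right_real by blast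
      have adm0: "(?N x - D \<bullet> x, D) \<in> adm {} z" "(a, \<xi>) \<in> adm {} z" using adm a by (auto simp: adm_def)
      have "((1 - t) * (?N x - D \<bullet> x) + t * a, (1 - t) *\<^sub>R D + t *\<^sub>R \<xi>) \<in> adm {p, q} z"
      proof (rule adm_convex[OF adm0])
        fix y assume y: "y \<in> {p, q}"
        have "(1 - t) * l p + t * (a + \<xi> \<bullet> p) \<le> (1 - t) * z + t * z"
          using t lp a by (intro add_mono mult_left_mono) (auto simp: adm_def)
        then have "(1 - t) * l p + t * (a + \<xi> \<bullet> p) \<le> z" by (simp add: algebra_simps)
        then show "(1 - t) * (?N x - D \<bullet> x + D \<bullet> y) + t * (a + \<xi> \<bullet> y) \<le> z"
          using t y by (auto simp: l_def)
      qed (use t in auto)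
      from nose_ge[OF this xK] have "(1 - t) * ?N x + t * (a + \<xi> \<bullet> x) \<le> ?N x"
        by (simp add: inner_simps algebra_simps)
      then have "t * (a + \<xi> \<bullet> x) \<le> t * ?N x" by (simp add: algebra_simps)
      then show False using t a by simp
    qed
  qed
  then have "?N x = ?M x" using le[OF xK] by simp
  then show ?thesis by (intro GDERIV_touching[OF D(2) D(1) open_ball x]) (use le in auto)
qed

text \<open>Were there a positive gap to \<open>u\<close>, the supporting plane could be tilted
  about a hyperplane separating \<open>x\<close> from the tips: raised at \<open>x\<close>, lowered
  at the tips, and nowhere raised by more than the gap.\<close>

lemma nose_support_touches:
  assumes X: "X \<subseteq> K" "finite X" and x: "x \<in> B" "x \<notin> convex hull X" and D: "GDERIV (nose X z) x :> D"
  shows "\<exists>y\<in>K. nose X z x + D \<bullet> (y - x) = u y"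
proof (rule ccontr)
  assume n: "\<not> ?thesis"
  have xK: "x \<in> K" using x by simp
  define l where "l y = nose X z x + D \<bullet> (y - x)" for y
  have adm: "(nose X z x - D \<bullet> x, D) \<in> adm X z" using nose_support(2)[OF X(1) x(1) D] .
  have lt: "l y < u y" if "y \<in> K" for y
    using nose_support(1)[OF X(1) x(1) D that] nose_le_u[OF that, of X z] n that by (force simp: l_def)
  have cl: "continuous_on K (\<lambda>y. u y - l y)" unfolding l_def by (intro continuous_intros u_cont)
  have ne: "K \<noteq> {}" using R by auto
  obtain m where m: "m \<in> K" "\<And>y. y \<in> K \<Longrightarrow> u m - l m \<le> u y - l y"
    using continuous_attains_inf[OF compact_cball ne cl] by blast
  define \<gamma> where "\<gamma> = u m - l m"
  have \<gamma>: "\<gamma> > 0" using lt[OF m(1)] by (simp add: \<gamma>_def)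
  have "compact (convex hull X)" using X(2) by (simp add: finite_imp_compact_convex_hull)
  then obtain a c where ac: "a \<bullet> x < c" "\<And>y. y \<in> convex hull X \<Longrightarrow> a \<bullet> y > c"
    using separating_hyperplane_closed_point[OF convex_convex_hull compact_imp_closed x(2)] by blast
  define Q where "Q = \<bar>c\<bar> + norm a * (norm b + R) + 1"
  have Q: "c - a \<bullet> y \<le> Q" if "y \<in> K" for y
  proof -
    have "norm (b + (y - b)) \<le> norm b + norm (y - b)" by (rule norm_triangle_ineq)
    then have "norm y \<le> norm b + R" using that by (simp add: dist_norm norm_minus_commute)
    then have "norm a * norm y \<le> norm a * (norm b + R)" by (rule mult_left_mono) simp
    then have "\<bar>a \<bullet> y\<bar> \<le> norm a * (norm b + R)" using Cauchy_Schwarz_ineq2[of a y] by linarith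
    then show ?thesis unfolding Q_def by linarith
  qed
  have "0 \<le> norm a * (norm b + R)" using R by simp
  then have Q0: "Q > 0" unfolding Q_def by linarith
  define \<epsilon> where "\<epsilon> = \<gamma> / Q"
  have \<epsilon>: "\<epsilon> > 0" "\<epsilon> * Q = \<gamma>" using \<gamma> Q0 by (auto simp: \<epsilon>_def)
  have "(nose X z x - D \<bullet> x + \<epsilon> * c, D - \<epsilon> *\<^sub>R a) \<in> adm X z"
    unfolding adm_def mem_Collect_eq prod.case
  proof (intro conjI ballI)
    fix y assume y: "y \<in> K"
    have "nose X z x - D \<bullet> x + \<epsilon> * c + (D - \<epsilon> *\<^sub>R a) \<bullet> y = l y + \<epsilon> * (c - a \<bullet> y)"
      by (simp add: l_def inner_simps algebra_simps)
    also have "\<dots> \<le> l y + \<epsilon> * Q" using Q[OF y] \<epsilon> by (intro add_left_mono mult_left_mono) auto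
    also have "\<dots> \<le> u y" using m(2)[OF y] by (simp add: \<epsilon> \<gamma>_def)
    finally show "nose X z x - D \<bullet> x + \<epsilon> * c + (D - \<epsilon> *\<^sub>R a) \<bullet> y \<le> u y" .
  next
    fix p assume p: "p \<in> X"
    have "nose X z x - D \<bullet> x + \<epsilon> * c + (D - \<epsilon> *\<^sub>R a) \<bullet> p = (nose X z x - D \<bullet> x + D \<bullet> p) + \<epsilon> * (c - a \<bullet> p)"
      by (simp add: inner_simps algebra_simps)
    also have "\<epsilon> * (c - a \<bullet> p) \<le> 0" using ac(2)[of p] p \<epsilon> by (simp add: hull_inc mult_nonneg_nonpos)
    also have "nose X z x - D \<bullet> x + D \<bullet> p \<le> z" using adm p by (auto simp: adm_def)
    finally show "nose X z x - D \<bullet> x + \<epsilon> * c + (D - \<epsilon> *\<^sub>R a) \<bullet> p \<le> z" by simp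
  qed
  from nose_ge[OF this xK] have "\<epsilon> * (c - a \<bullet> x) \<le> 0" by (simp add: inner_simps algebra_simps)
  then show False using \<epsilon>(1) ac(1) by (simp add: mult_le_0_iff)
qed

end

subsection \<open>Dilations of the graph\<close>

lemma AE_lebesgue_affine:
  fixes t :: "'a::euclidean_space"
  assumes c: "c \<noteq> 0" and ae: "AE x in lebesgue. P x"
  shows "AE x in lebesgue. P (t + c *\<^sub>R x)"
proof -
  obtain N where N: "{x\<in>space lebesgue. \<not> P x} \<subseteq> N" "emeasure lebesgue N = 0" "N \<in> sets lebesgue"
    using AE_E[OF ae] .
  let ?T = "\<lambda>x::'a. t + c *\<^sub>R x"
  have T: "(\<lambda>x. t + (\<Sum>j\<in>Basis. (c * (x \<bullet> j)) *\<^sub>R j)) = ?T"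
    by (simp flip: scaleR_scaleR scaleR_sum_right add: euclidean_representation)
  have m: "?T \<in> lebesgue \<rightarrow>\<^sub>M lebesgue"
    using lebesgue_affine_measurable[of "\<lambda>_. c" t] c by (simp add: T)
  have d: "lebesgue = density (distr lebesgue lebesgue ?T) (\<lambda>_. \<bar>c\<bar> ^ DIM('a))"
    using lebesgue_affine_euclidean[of "\<lambda>_. c" t] c by (simp add: T)
  have "emeasure (density (distr lebesgue lebesgue ?T) (\<lambda>_. \<bar>c\<bar> ^ DIM('a))) N = 0"
    using N(2) by (subst d[symmetric])
  then have "ennreal (\<bar>c\<bar> ^ DIM('a)) * emeasure lebesgue (?T -` N) = 0"
    using N(3) m by (simp add: emeasure_density emeasure_distr nn_integral_cmult)
  then have "emeasure lebesgue (?T -` N) = 0" using c by simp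
  moreover have "?T -` N \<in> sets lebesgue" using measurable_sets[OF m N(3)] by simp
  ultimately have "?T -` N \<in> null_sets lebesgue" by blast
  then show ?thesis by (rule AE_I') (use N(1) in auto)
qed

context C1_ball
begin

text \<open>
  \<open>dil p s\<close> is the dilation with centre \<open>p\<close> and ratio \<open>1 + s\<close>, and \<open>cen p s\<close> is its inverse. The graph of
  \<open>hom p z s\<close> is the image of the graph of \<open>u\<close> under the dilation with centre \<open>(p, z)\<close> and ratio \<open>1 + s\<close>.
\<close>

definition cen :: "'a \<Rightarrow> real \<Rightarrow> 'a \<Rightarrow> 'a" where "cen p s x = (s / (1 + s)) *\<^sub>R p + (1 / (1 + s)) *\<^sub>R x"
definition dil :: "'a \<Rightarrow> real \<Rightarrow> 'a \<Rightarrow> 'a" where "dil p s y = (1 + s) *\<^sub>R y - s *\<^sub>R p"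

definition hom :: "'a \<Rightarrow> real \<Rightarrow> real \<Rightarrow> 'a \<Rightarrow> real" where
  "hom p z s x = (1 + s) * u (cen p s x) - s * z"

lemma cen_dil [simp]: "s > 0 \<Longrightarrow> cen p s (dil p s y) = y"
  by (simp add: cen_def dil_def scaleR_diff_right)

lemma dil_cen [simp]: "s > 0 \<Longrightarrow> dil p s (cen p s x) = x"
  by (simp add: cen_def dil_def scaleR_add_right)

lemma cen_in:
  assumes "s > 0" "convex S" "p \<in> S" "x \<in> S"
  shows "cen p s x \<in> S"
proof -
  have "s / (1 + s) + 1 / (1 + s) = 1" using assms(1) by (simp add: field_simps)
  then show ?thesis unfolding cen_def using assms by (intro convexD) auto
qed

lemma cen_convex_comb: "s > 0 \<Longrightarrow> cen p s x = (1 - s / (1 + s)) *\<^sub>R x + (s / (1 + s)) *\<^sub>R p"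
proof -
  assume "s > 0"
  then have "1 - s / (1 + s) = 1 / (1 + s)" by (simp add: field_simps)
  then show ?thesis by (simp add: cen_def)
qed

lemma cen_diff: "s > 0 \<Longrightarrow> cen p s x - x = (s / (1 + s)) *\<^sub>R (p - x)"
  unfolding cen_convex_comb by (simp add: algebra_simps)

lemma dist_K: "x \<in> K \<Longrightarrow> y \<in> K \<Longrightarrow> dist x y \<le> 2 * R"
  using dist_triangle[of x y b] by (simp add: dist_commute)

lemma dist_cen:
  assumes "s > 0" "x \<in> K" "p \<in> K"
  shows "dist (cen p s x) x \<le> 2 * R * s"
proof -
  have "dist (cen p s x) x = (s / (1 + s)) * dist p x"
    using assms(1) by (simp add: dist_norm cen_diff)
  also have "\<dots> \<le> s * (2 * R)"
    using assms dist_K R by (intro mult_mono) (auto simp: divide_simps)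
  finally show ?thesis by (simp add: mult_ac)
qed

lemma dist_dil:
  assumes "s > 0" "y \<in> K" "p \<in> K"
  shows "dist (dil p s y) y \<le> 2 * R * s"
proof -
  have "dil p s y - y = s *\<^sub>R (y - p)" by (simp add: dil_def algebra_simps)
  then have "dist (dil p s y) y = s * dist y p" using assms(1) by (simp add: dist_norm)
  also have "\<dots> \<le> s * (2 * R)" using assms dist_K by (intro mult_left_mono) auto
  finally show ?thesis by (simp add: mult_ac)
qed

text \<open>The dilation takes the tangent plane at \<open>x\<close> to a plane below the dilated
  graph, and above \<open>x\<close> that plane has the height on the left.\<close>

lemma hom_ge:
  assumes "s > 0" "x \<in> K" "p \<in> K"
  shows "u x + s * (T x p - z) \<le> hom p z s x"
proof -
  have "T x (cen p s x) = u x + (s / (1 + s)) * (G x \<bullet> (p - x))"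
    using assms(1) by (simp add: T_def cen_diff)
  then have "(1 + s) * T x (cen p s x) = (1 + s) * u x + s * (G x \<bullet> (p - x))"
    using assms(1) by (simp add: distrib_left)
  moreover have "(1 + s) * T x (cen p s x) \<le> (1 + s) * u (cen p s x)"
    using assms by (intro mult_left_mono T_le cen_in) auto
  ultimately show ?thesis unfolding hom_def by (simp add: T_def algebra_simps)
qed

lemma T_dil: "T y (dil p s y) = (1 + s) * u y - s * T y p"
  by (simp add: T_def dil_def algebra_simps)

lemma hom_dil: "s > 0 \<Longrightarrow> hom p z s (dil p s y) = (1 + s) * u y - s * z"
  by (simp add: hom_def)

text \<open>Here the tangent plane is taken at the preimage \<open>y\<close>: where the dilated
  graph is above the old one, the preimage is visible from the tip.\<close>

lemma hom_gt_imp: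
  assumes "s > 0" "y \<in> K" "dil p s y \<in> K" "hom p z s (dil p s y) > u (dil p s y)"
  shows "T y p > z"
proof -
  have "(1 + s) * u y - s * T y p < (1 + s) * u y - s * z"
    using T_le[OF assms(2,3)] assms(4) by (simp add: T_dil hom_dil[OF assms(1)])
  then show ?thesis using assms(1) by simp
qed

lemma hom_gderiv:
  assumes "s > 0" "x \<in> K" "p \<in> K"
  shows "GDERIV (hom p z s) x :> G (cen p s x)"
proof -
  have "(u has_derivative (\<lambda>h. h \<bullet> G (cen p s x))) (at (cen p s x))"
    using G[OF cen_in[OF assms(1) convex_cball assms(3,2)]] by (simp add: gderiv_def)
  moreover have "(cen p s has_derivative (\<lambda>h. (1 / (1 + s)) *\<^sub>R h)) (at x)"
    unfolding cen_def by (auto intro!: derivative_eq_intros)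
  ultimately have "((\<lambda>x. u (cen p s x)) has_derivative (\<lambda>h. ((1 / (1 + s)) *\<^sub>R h) \<bullet> G (cen p s x))) (at x)"
    using has_derivative_compose by blast
  then have "((\<lambda>x. (1 + s) * u (cen p s x) - s * z) has_derivative (\<lambda>h. (1 + s) * (((1 / (1 + s)) *\<^sub>R h) \<bullet> G (cen p s x)))) (at x)"
    by (auto intro!: derivative_eq_intros)
  moreover have "(1 + s) * (((1 / (1 + s)) *\<^sub>R h) \<bullet> G (cen p s x)) = h \<bullet> G (cen p s x)" for h
    using assms(1) by simp
  ultimately show ?thesis unfolding gderiv_def hom_def[abs_def] by simp
qed

lemma hom_convex:
  assumes "s > 0" "p \<in> K"
  shows "convex_on K (hom p z s)"
proof (rule convex_onI)
  fix t x y assume t: "0 < (t::real)" "t < 1" and xy: "x \<in> K" "y \<in> K"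
  have eq: "cen p s ((1 - t) *\<^sub>R x + t *\<^sub>R y) = (1 - t) *\<^sub>R cen p s x + t *\<^sub>R cen p s y"
  proof -
    define c where "c = s / (1 + s)"
    show ?thesis unfolding cen_convex_comb[OF assms(1)] c_def[symmetric] by (simp add: algebra_simps)
  qed
  have "u (cen p s ((1 - t) *\<^sub>R x + t *\<^sub>R y)) \<le> (1 - t) * u (cen p s x) + t * u (cen p s y)"
    unfolding eq using t xy assms by (intro convex_onD[OF cv] cen_in) auto
  then have "(1 + s) * u (cen p s ((1 - t) *\<^sub>R x + t *\<^sub>R y)) \<le> (1 + s) * ((1 - t) * u (cen p s x) + t * u (cen p s y))"
    using assms by (intro mult_left_mono) auto
  then show "hom p z s ((1 - t) *\<^sub>R x + t *\<^sub>R y) \<le> (1 - t) * hom p z s x + t * hom p z s y"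
    by (simp add: hom_def algebra_simps)
qed simp

lemma hom_cont: "s > 0 \<Longrightarrow> p \<in> K \<Longrightarrow> continuous_on K (hom p z s)"
  unfolding hom_def
  by (intro continuous_intros continuous_on_compose2[OF u_cont]) (auto simp: cen_def intro!: continuous_intros cen_in[unfolded cen_def])

text \<open>
  \<open>Dset p z\<close> is the part of the graph visible from \<open>(p, z)\<close>; \<open>Ds p z s\<close> is the part cut off by the dilation.
\<close>

definition Dset :: "'a \<Rightarrow> real \<Rightarrow> 'a set" where "Dset p z = {x\<in>B. T x p > z}"
definition Ds :: "'a \<Rightarrow> real \<Rightarrow> real \<Rightarrow> 'a set" where "Ds p z s = {x\<in>B. hom p z s x > u x}"

text \<open>The gradients are cut off to 0 outside the open ball, so that they are measurable on the
  whole space; inside, \<open>gn\<close> has arbitrary values at the null set of points where the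
  nose is not differentiable.\<close>

definition gu :: "'a \<Rightarrow> 'a" where "gu x = (if x \<in> B then G x else 0)"
definition gn :: "'a set \<Rightarrow> real \<Rightarrow> 'a \<Rightarrow> 'a" where "gn X z x = (if x \<in> B then grad (nose X z) x else 0)"

lemma gu_measurable: "gu \<in> borel_measurable borel"
  unfolding gu_def[abs_def]
  by (rule borel_measurable_continuous_on_if) (auto intro: continuous_on_subset[OF Gc])

lemma gn_measurable: "gn X z \<in> borel_measurable lebesgue"
  unfolding gn_def[abs_def] by (rule borel_measurable_grad) (auto intro: convex_on_subset[OF nose_convex])

lemma open_less_on_ball:
  assumes "continuous_on K f" "continuous_on K g"
  shows "open {x\<in>B. f x < (g x :: real)}"
proof -
  have "continuous_on B (\<lambda>x. g x - f x)"
    using assms by (intro continuous_intros) (auto intro: continuous_on_subset)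
  then have "open ((\<lambda>x. g x - f x) -` {0<..} \<inter> B)" by (simp add: continuous_on_open_vimage)
  moreover have "(\<lambda>x. g x - f x) -` {0<..} \<inter> B = {x\<in>B. f x < g x}" by auto
  ultimately show ?thesis by simp
qed

lemma Dset_open: "open (Dset p z)"
  unfolding Dset_def by (rule open_less_on_ball[OF continuous_on_const T_cont])

lemma Ds_open: "s > 0 \<Longrightarrow> p \<in> K \<Longrightarrow> open (Ds p z s)"
  unfolding Ds_def by (rule open_less_on_ball[OF u_cont hom_cont])

lemma Dset_sub_Ds:
  assumes "s > 0" "p \<in> K"
  shows "Dset p z \<subseteq> Ds p z s"
proof
  fix x assume x: "x \<in> Dset p z"
  then have "0 < s * (T x p - z)" using assms by (simp add: Dset_def)
  then show "x \<in> Ds p z s" using hom_ge[OF assms(1) _ assms(2), of x z] x by (auto simp: Ds_def Dset_def)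
qed

text \<open>Together with \<open>Dset_sub_Ds\<close> this encloses \<open>Dset\<close> between the
  contracted \<open>Ds\<close> and \<open>Ds\<close> itself. As the contraction changes measures by
  a factor \<open>1 - O(s)\<close>, the three sets differ by a measure of order
  \<open>s\<close>.\<close>

lemma cen_Ds:
  assumes s: "s > 0" and p: "p \<in> B" and x: "x \<in> Ds p z s"
  shows "cen p s x \<in> Dset p z"
proof -
  have "cen p s x \<in> B" using x p s by (intro cen_in) (auto simp: Ds_def)
  moreover have "T (cen p s x) p > z"
    by (rule hom_gt_imp[OF s]) (use x s \<open>cen p s x \<in> B\<close> in \<open>auto simp: Ds_def\<close>)
  ultimately show ?thesis by (simp add: Dset_def)
qed

lemma integral_dil:
  fixes F :: "'a \<Rightarrow> real"
  assumes s: "s > 0" and F: "F \<in> borel_measurable lebesgue" and S: "cen p s ` S \<in> sets lebesgue"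
  shows "(LINT x:S|lebesgue. F (cen p s x)) = (1 + s) ^ DIM('a) * (LINT y:cen p s ` S|lebesgue. F y)"
proof -
  have inj: "cen p s x \<in> cen p s ` S \<longleftrightarrow> x \<in> S" for x
    using dil_cen[OF s] by (metis image_iff)
  let ?g = "\<lambda>y. indicator (cen p s ` S) y *\<^sub>R F y"
  have "integral\<^sup>L lebesgue ?g = \<bar>1 / (1 + s)\<bar> ^ DIM('a) * integral\<^sup>L lebesgue (\<lambda>x. ?g (cen p s x))"
    unfolding cen_def using F S s by (intro integral_lebesgue_affine) (auto simp: cen_def)
  moreover have "(\<lambda>x. ?g (cen p s x)) = (\<lambda>x. indicator S x *\<^sub>R F (cen p s x))"
    by (auto simp: inj indicator_def)
  ultimately show ?thesis using s by (simp add: set_lebesgue_integral_def power_divide)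
qed

text \<open>The touching point may lie on the sphere, where the minorant need not be the tangent
  plane; one-sided slopes along the segment from \<open>y\<close> to \<open>p\<close> still order
  the two at \<open>p\<close>.\<close>

lemma minorant_le_tangent:
  assumes y: "y \<in> K" and p: "p \<in> K" and le: "\<And>w. w \<in> K \<Longrightarrow> u y + D \<bullet> (w - y) \<le> u w"
  shows "u y + D \<bullet> (p - y) \<le> T y p"
proof -
  have "D \<bullet> (p - y) \<le> (p - y) \<bullet> G y"
  proof (rule LIMSEQ_le_const[OF GDERIV_quotient_limit[OF G[OF y], of "p - y"]], intro exI allI impI)
    fix n :: nat
    define t where "t = 1 / real (Suc n)"
    have t: "0 \<le> t" "t \<le> 1" "t * real (Suc n) = 1" by (simp_all add: t_def)
    have "y + t *\<^sub>R (p - y) = (1 - t) *\<^sub>R y + t *\<^sub>R p" by (simp add: algebra_simps)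
    also have "\<dots> \<in> K" using t y p by (intro convexD) auto
    finally have "u y + D \<bullet> (y + t *\<^sub>R (p - y) - y) \<le> u (y + t *\<^sub>R (p - y))" by (rule le)
    then have "t * (D \<bullet> (p - y)) \<le> u (y + t *\<^sub>R (p - y)) - u y" by simp
    then have "t * (D \<bullet> (p - y)) * real (Suc n) \<le> (u (y + t *\<^sub>R (p - y)) - u y) * real (Suc n)"
      by (rule mult_right_mono) simp
    moreover have "t * (D \<bullet> (p - y)) * real (Suc n) = D \<bullet> (p - y)"
      using t(3) by (metis mult.assoc mult.commute mult_1)
    ultimately show "D \<bullet> (p - y) \<le> (u (y + (1 / real (Suc n)) *\<^sub>R (p - y)) - u y) * real (Suc n)"
      by (simp only: t_def)
  qed
  then show ?thesis by (simp add: T_def inner_commute)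
qed

text \<open>
  By the tangency condition the gradient of a nose only takes values that \<open>u\<close> already has.
\<close>

lemma nose_gradient_tangent:
  assumes X: "X \<subseteq> B" "finite X" and off: "\<And>y p. y \<in> sphere b R \<Longrightarrow> p \<in> X \<Longrightarrow> T y p < z"
    and x: "x \<in> B" "x \<notin> convex hull X" and D: "GDERIV (nose X z) x :> D" and less: "nose X z x < u x"
  shows "\<exists>y\<in>B. D = G y \<and> (\<forall>p\<in>X. T y p \<le> z) \<and> (\<exists>p\<in>X. T y p = z)"
proof -
  have XK: "X \<subseteq> K" using X(1) by auto
  define l where "l y = nose X z x + D \<bullet> (y - x)" for y
  obtain y where y: "y \<in> K" "l y = u y"
    using nose_support_touches[OF XK X(2) x D] by (auto simp: l_def)
  have lle: "l w \<le> u w" if "w \<in> K" for w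
    using nose_support(1)[OF XK x(1) D that] nose_le_u[OF that, of X z] by (simp add: l_def)
  have ltip: "l p \<le> z" if "p \<in> X" for p
    using nose_support(1)[OF XK x(1) D, of p] nose_tip[OF that, of z] XK that by (auto simp: l_def)
  obtain p where p: "p \<in> X" "l p = z"
    using nose_support_tip[OF XK X(2) x(1) D less] by (auto simp: l_def)
  have leq: "l w = u y + D \<bullet> (w - y)" for w
    using y(2) by (simp add: l_def inner_simps)
  \<comment> \<open>The hypothesis on the sphere enters here: a contact point there would put the
    supporting plane strictly below a tip that it contains.\<close>
  have yB: "y \<in> B"
  proof (rule ccontr)
    assume "y \<notin> B"
    then have "y \<in> sphere b R" using y(1) by auto
    then have "T y p < z" using off p(1) by blast
    moreover have "l p \<le> T y p"
      unfolding leq by (rule minorant_le_tangent[OF y(1)]) (use p(1) XK lle leq in auto)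
    ultimately show False using p(2) by simp
  qed
  have DG: "D = G y"
    by (rule minorant_touch[OF yB _ refl]) (use lle leq in auto)
  then have "T y w = l w" for w by (simp add: T_def leq)
  then show ?thesis using yB DG ltip p by (intro bexI[of _ y]) auto
qed

lemma AE_nose_differentiable: "AE x in lebesgue. x \<in> B \<longrightarrow> GDERIV (nose X z) x :> grad (nose X z) x"
proof -
  have "AE x in lebesgue. x \<in> B \<longrightarrow> nose X z differentiable (at x)"
    by (rule AE_differentiable_convex) (auto intro: convex_on_subset[OF nose_convex])
  then show ?thesis by eventually_elim (auto intro: GDERIV_grad)
qed

lemma nose_grad_eq:
  assumes x: "x \<in> B" and D: "GDERIV (nose X z) x :> D" and eq: "nose X z x = u x"
  shows "D = G x"
  by (rule GDERIV_touching[OF G D open_ball x, symmetric]) (use nose_le_u eq x in auto)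

end

subsection \<open>First variation of the energy under one dilation\<close>

lemma set_integral_bound_AE:
  fixes f :: "'a::euclidean_space \<Rightarrow> real"
  assumes f: "f \<in> borel_measurable lebesgue" and S: "S \<in> sets lebesgue" "bounded S" and e: "0 \<le> e"
    and ae: "AE x in lebesgue. x \<in> S \<longrightarrow> \<bar>f x\<bar> \<le> e"
  shows "\<bar>LINT x:S|lebesgue. f x\<bar> \<le> e * measure lebesgue S"
proof -
  have lm: "S \<in> lmeasurable" using S bounded_set_imp_lmeasurable by blast
  have i: "set_integrable lebesgue S f" by (rule set_integrable_bounded[OF f S ae])
  have "\<bar>LINT x:S|lebesgue. f x\<bar> \<le> (LINT x|lebesgue. norm (indicator S x *\<^sub>R f x))"
    unfolding set_lebesgue_integral_def real_norm_def[symmetric] by (rule integral_norm_bound)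
  also have "\<dots> \<le> (LINT x|lebesgue. e * indicator S x)"
  proof (rule integral_mono_AE)
    show "integrable lebesgue (\<lambda>x. norm (indicator S x *\<^sub>R f x))"
      using i by (intro integrable_norm) (simp add: set_integrable_def)
    show "integrable lebesgue (\<lambda>x. e * indicator S x)"
      using lm by (intro integrable_mult_right) (simp add: lmeasurable_iff_integrable)
    show "AE x in lebesgue. norm (indicator S x *\<^sub>R f x) \<le> e * indicator S x"
      using ae by eventually_elim (auto simp: indicator_def e)
  qed
  also have "\<dots> = e * measure lebesgue S" by simp
  finally show ?thesis .
qed

text \<open>Bounds the proportion of measure that a set loses under the contraction
  \<open>cen\<close>.\<close>

lemma inverse_power_bernoulli:
  assumes "(s::real) > 0"
  shows "1 - 1 / (1 + s) ^ n \<le> real n * s"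
proof -
  have "- 1 \<le> - s / (1 + s)" using assms by (simp add: divide_simps)
  then have "1 + real n * (- s / (1 + s)) \<le> (1 + (- s / (1 + s))) ^ n" by (rule Bernoulli_inequality)
  moreover have "1 + (- s / (1 + s)) = 1 / (1 + s)" using assms by (simp add: field_simps)
  ultimately have "1 - 1 / (1 + s) ^ n \<le> real n * (s / (1 + s))" by (simp add: power_divide)
  also have "\<dots> \<le> real n * s" using assms by (intro mult_left_mono) (auto simp: divide_simps)
  finally show ?thesis .
qed

context C1_ball
begin

lemma G_bounded: obtains M where "M > 0" "\<And>x. x \<in> K \<Longrightarrow> norm (G x) \<le> M"
proof -
  have "bounded (G ` K)" using compact_imp_bounded compact_continuous_image[OF Gc compact_cball] by blast
  then show ?thesis using that unfolding bounded_pos by auto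
qed

lemma uniform_modulus:
  assumes "continuous_on K (f :: 'a \<Rightarrow> 'c::metric_space)" "e > 0"
  obtains d where "d > 0" "\<And>x y. x \<in> K \<Longrightarrow> y \<in> K \<Longrightarrow> dist x y < d \<Longrightarrow> dist (f x) (f y) \<le> e"
proof -
  have "uniformly_continuous_on K f" by (rule compact_uniformly_continuous[OF assms(1) compact_cball])
  then obtain d where d: "d > 0" "\<forall>x\<in>K. \<forall>y\<in>K. dist y x < d \<longrightarrow> dist (f y) (f x) < e"
    unfolding uniformly_continuous_on_def using assms(2) by meson
  show ?thesis
  proof (rule that[OF d(1)])
    fix x y assume "x \<in> K" "y \<in> K" "dist x y < d"
    then have "dist (f x) (f y) < e" using d(2) by blast
    then show "dist (f x) (f y) \<le> e" by simp
  qed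
qed

text \<open>Confines the gradients of the nose to those of \<open>u\<close>, a bounded set on which
  a continuous integrand is bounded.\<close>

lemma AE_gn_range:
  assumes X: "X \<subseteq> B" "finite X" "negligible (convex hull X)"
    and off: "\<And>y p. y \<in> sphere b R \<Longrightarrow> p \<in> X \<Longrightarrow> T y p < z"
  shows "AE x in lebesgue. x \<in> B \<longrightarrow> gn X z x \<in> G ` B"
proof -
  have "AE x in lebesgue. x \<notin> convex hull X"
    unfolding eventually_ae_filter_negligible using X(3) by (intro exI[of _ "convex hull X"]) auto
  with AE_nose_differentiable[of X z] show ?thesis
  proof eventually_elim
    case (elim x)
    show ?case
    proof
      assume x: "x \<in> B"
      have D: "GDERIV (nose X z) x :> gn X z x" using elim(1) x by (simp add: gn_def)
      have "nose X z x \<le> u x" using nose_le_u x by simp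
      then consider "nose X z x = u x" | "nose X z x < u x" by linarith
      then show "gn X z x \<in> G ` B"
      proof cases
        case 1
        show ?thesis using nose_grad_eq[OF x D 1] x by blast
      next
        case 2
        show ?thesis using nose_gradient_tangent[OF X(1,2) off x elim(2) D 2] by blast
      qed
    qed
  qed
qed

text \<open>Let \<open>A \<subseteq> D \<subseteq> E\<close> be the contracted, the visible and the
  cut-off set. Split \<open>F (gu x)\<close> into its excess \<open>g\<close> over the value for the
  nose and that value. The excess vanishes on \<open>E\<close> minus \<open>D\<close>; on
  \<open>D\<close> the nose is a cone, so its value does not change under the contraction. What
  remains are integrals over \<open>D\<close> minus \<open>A\<close> and \<open>E\<close> minus
  \<open>D\<close>. These sets have measure of order \<open>s\<close>, and near the edge of
  \<open>D\<close> the nose almost touches \<open>u\<close>, so the integrands are small.\<close>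

lemma homothety_nose:
  fixes F :: "'a \<Rightarrow> real"
  assumes p: "p \<in> B" and R': "R' < R" and off: "\<And>x. x \<in> K - ball b R' \<Longrightarrow> T x p < z"
    and F: "continuous_on UNIV F" and e: "e > 0"
  shows "\<exists>s0>0. \<forall>s. 0 < s \<and> s < s0 \<longrightarrow>
    \<bar>(1 + s) ^ DIM('a) * (LINT x:cen p s ` Ds p z s|lebesgue. F (gu x)) - (LINT x:Ds p z s|lebesgue. F (gu x))
      - ((1 + s) ^ DIM('a) - 1) * (LINT x:Dset p z|lebesgue. F (gu x) - F (gn {p} z x))\<bar> \<le> e * s"
proof -
  have pK: "p \<in> K" using p by simp
  let ?n = "DIM('a)"
  obtain M where M: "M > 0" "\<And>x. x \<in> K \<Longrightarrow> norm (G x) \<le> M" using G_bounded by blast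
  define mB where "mB = measure lebesgue B"
  have mB: "mB \<ge> 0" by (simp add: mB_def)
  \<comment> \<open>\<open>2 ^ n\<close> bounds the Jacobian for \<open>s < 1\<close> and
    \<open>mB * n * s\<close> the measures of the two leftover sets; \<open>e1\<close> is the bound
    for the integrands there.\<close>
  define e1 where "e1 = e / ((2 ^ ?n + 1) * (mB * ?n + 1))"
  have den: "(2 ^ ?n + 1) * (mB * ?n + 1) > 0" using mB by (intro mult_pos_pos add_nonneg_pos) auto
  then have e1: "e1 > 0" using e by (simp add: e1_def)
  have "uniformly_continuous_on (cball 0 M) F"
    using continuous_on_subset[OF F] by (intro compact_uniformly_continuous) auto
  then obtain \<omega> where \<omega>: "\<omega> > 0" "\<And>\<xi> \<eta>. norm \<xi> \<le> M \<Longrightarrow> norm \<eta> \<le> M \<Longrightarrow> norm (\<xi> - \<eta>) < \<omega> \<Longrightarrow> \<bar>F \<xi> - F \<eta>\<bar> < e1"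
    unfolding uniformly_continuous_on_def using e1 by (force simp: dist_norm norm_minus_commute dist_real_def)
  obtain d1 where d1: "d1 > 0" "\<And>x y. x \<in> K \<Longrightarrow> y \<in> K \<Longrightarrow> dist x y < d1 \<Longrightarrow> dist (G x) (G y) \<le> \<omega> / 4"
    using uniform_modulus[OF Gc, of "\<omega> / 4"] \<omega>(1) by auto
  define r0 where "r0 = min (R - R') (d1 / 2)"
  have r0: "r0 > 0" "r0 \<le> R - R'" "r0 < d1" using R' d1 by (auto simp: r0_def)
  \<comment> \<open>Chosen so that \<open>near_touch\<close> with radius \<open>r0\<close> gives
    \<open>\<omega> / 8 + \<omega> / 4\<close>, which is below \<open>\<omega> / 2\<close>.\<close>
  define \<tau> where "\<tau> = r0 * (\<omega> / 8)"
  have \<tau>: "\<tau> > 0" using r0 \<omega> by (simp add: \<tau>_def)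
  obtain d2 where d2: "d2 > 0" "\<And>x y. x \<in> K \<Longrightarrow> y \<in> K \<Longrightarrow> dist x y < d2 \<Longrightarrow> dist (T x p) (T y p) \<le> \<tau>"
    using uniform_modulus[OF T_cont \<tau>] by blast
  have \<tau>R: "\<tau> / (2 * R) > 0" using \<tau> R by simp
  obtain d3 where d3: "d3 > 0" "\<And>x y. x \<in> K \<Longrightarrow> y \<in> K \<Longrightarrow> dist x y < d3 \<Longrightarrow> dist (G x) (G y) \<le> \<tau> / (2 * R)"
    using uniform_modulus[OF Gc \<tau>R] by blast
  define d where "d = min (min d1 d2) (min d3 (R - R'))"
  have d: "d > 0" "d \<le> d1" "d \<le> d2" "d \<le> d3" "d \<le> R - R'" using d1 d2 d3 R' by (auto simp: d_def)
  define s0 where "s0 = min 1 (d / (2 * R))"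
  have s0: "s0 > 0" using d R by (simp add: s0_def)
  have D_R': "x \<in> ball b R'" if "x \<in> Dset p z" for x
    using off[of x] that by (force simp: Dset_def)
  \<comment> \<open>Near the edge of the visible set the tangent plane barely clears the tip, so the
    nose is within \<tau> of \<open>u\<close> and its gradient is close to that of
    \<open>u\<close>.\<close>
  have near: "norm (gn {p} z y - G y) \<le> \<omega> / 2"
    if y: "y \<in> Dset p z" "T y p \<le> z + \<tau>" and D: "GDERIV (nose {p} z) y :> gn {p} z y" for y
  proof -
    have yB: "y \<in> B" using y by (simp add: Dset_def)
    have "norm (gn {p} z y - G y) \<le> \<tau> / r0 + \<omega> / 4"
    proof (rule near_touch)
      show "cball y r0 \<subseteq> K"
      proof
        fix w assume "w \<in> cball y r0"
        then show "w \<in> K" using D_R'[OF y(1)] r0(2) dist_triangle[of b w y] by simp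
      qed
      show "nose {p} z y + gn {p} z y \<bullet> (w - y) \<le> u w" if "w \<in> K" for w
        using nose_support(1)[OF _ yB D that] nose_le_u[OF that, of "{p}" z] pK by simp
      show "u y - \<tau> \<le> nose {p} z y" using y(2) yB \<tau> by (intro nose_lower) auto
      show "norm (G w - G y) \<le> \<omega> / 4" if "w \<in> K" "dist w y \<le> r0" for w
        using d1(2)[OF that(1), of y] that(2) r0 yB by (simp add: dist_norm)
    qed (use r0 in auto)
    then show ?thesis using r0 \<omega> by (simp add: \<tau>_def)
  qed
  define \<phi> where "\<phi> x = F (gu x)" for x
  define \<psi> where "\<psi> x = F (gn {p} z x)" for x
  have Fb: "F \<in> borel_measurable borel" using F by (rule borel_measurable_continuous_onI)
  have \<phi>m: "\<phi> \<in> borel_measurable lebesgue"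
    unfolding \<phi>_def using measurable_compose[OF gu_measurable Fb] by (simp add: measurable_completion)
  have \<psi>m: "\<psi> \<in> borel_measurable lebesgue"
    unfolding \<psi>_def by (rule measurable_compose[OF gn_measurable Fb])
  have "bounded (F ` cball 0 M)"
    by (intro compact_imp_bounded compact_continuous_image continuous_on_subset[OF F]) auto
  then obtain C where "\<forall>y\<in>F ` cball 0 M. norm y \<le> C" unfolding bounded_iff by blast
  then have C: "\<bar>F \<xi>\<bar> \<le> C" if "norm \<xi> \<le> M" for \<xi> using that by simp
  have range: "AE x in lebesgue. x \<in> B \<longrightarrow> norm (gn {p} z x) \<le> M"
  proof -
    have "AE x in lebesgue. x \<in> B \<longrightarrow> gn {p} z x \<in> G ` B"
      by (rule AE_gn_range) (use p off R' in auto)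
    then show ?thesis by eventually_elim (use M(2) in auto)
  qed
  have \<phi>b: "AE x in lebesgue. x \<in> S \<longrightarrow> \<bar>\<phi> x\<bar> \<le> C" if "S \<subseteq> B" for S
    using that by (intro AE_I2) (auto simp: \<phi>_def gu_def intro!: C M(2))
  have \<psi>b: "AE x in lebesgue. x \<in> S \<longrightarrow> \<bar>\<psi> x\<bar> \<le> C" if "S \<subseteq> B" for S
    using range by eventually_elim (use that in \<open>auto simp: \<psi>_def intro!: C\<close>)
  show ?thesis
  proof (intro exI[of _ s0] conjI allI impI)
    fix s assume s': "0 < s \<and> s < s0"
    then have s: "0 < s" "s < 1" "2 * R * s < d" using R by (auto simp: s0_def field_simps)
    let ?A = "cen p s ` Ds p z s" and ?E = "Ds p z s" and ?D = "Dset p z"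
    define c where "c = (1 + s) ^ ?n"
    have c: "c \<ge> 1" "c \<le> 2 ^ ?n" using s by (auto simp: c_def intro!: power_mono one_le_power)
    have AD: "?A \<subseteq> ?D" using cen_Ds[OF s(1) p] by auto
    have DE: "?D \<subseteq> ?E" by (rule Dset_sub_Ds[OF s(1) pK])
    have EB: "?E \<subseteq> B" by (auto simp: Ds_def)
    have Aeq: "?A = dil p s -` ?E" using s by (force intro: image_eqI[where x = "dil p s _"])
    have "open ?A" unfolding Aeq dil_def using Ds_open[OF s(1) pK]
      by (intro open_vimage) (auto intro!: continuous_intros)
    then have sets: "?A \<in> sets lebesgue" "?D \<in> sets lebesgue" "?E \<in> sets lebesgue"
      using Dset_open Ds_open[OF s(1) pK] by auto
    have bdd: "bounded S" if "S \<subseteq> B" for S using that bounded_ball bounded_subset by blast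
    have DB: "?D \<subseteq> B" and AB: "?A \<subseteq> B" using AD DE EB by auto
    have i\<phi>: "set_integrable lebesgue S \<phi>" and i\<psi>: "set_integrable lebesgue S \<psi>"
      if "S \<in> sets lebesgue" "S \<subseteq> B" for S
      using set_integrable_bounded[OF \<phi>m that(1) bdd[OF that(2)] \<phi>b[OF that(2)]]
        set_integrable_bounded[OF \<psi>m that(1) bdd[OF that(2)] \<psi>b[OF that(2)]] by auto
    define g where "g x = \<phi> x - \<psi> x" for x
    have ig: "set_integrable lebesgue S g" if "S \<in> sets lebesgue" "S \<subseteq> B" for S
      unfolding g_def using i\<phi>[OF that] i\<psi>[OF that] by (rule set_integral_diff(1))
    have gI: "(LINT x:S|lebesgue. g x) = (LINT x:S|lebesgue. \<phi> x) - (LINT x:S|lebesgue. \<psi> x)"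
      if "S \<in> sets lebesgue" "S \<subseteq> B" for S
      unfolding g_def by (rule set_integral_diff(2)[OF i\<phi>[OF that] i\<psi>[OF that]])
    define h where "h x = \<psi> (cen p s x) - \<psi> x" for x
    have cenm: "cen p s \<in> lebesgue \<rightarrow>\<^sub>M lebesgue"
    proof -
      have "(\<lambda>x. (s / (1 + s)) *\<^sub>R p + (\<Sum>j\<in>Basis. (1 / (1 + s) * (x \<bullet> j)) *\<^sub>R j)) = cen p s"
        by (simp only: cen_def[abs_def] scaleR_scaleR[symmetric] scaleR_sum_right[symmetric] euclidean_representation)
      then show ?thesis
        using lebesgue_affine_measurable[of "\<lambda>_. 1 / (1 + s)" "(s / (1 + s)) *\<^sub>R p"] s by simp
    qed
    have \<psi>cm: "(\<lambda>x. \<psi> (cen p s x)) \<in> borel_measurable lebesgue" by (rule measurable_compose[OF cenm \<psi>m])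
    have hm: "h \<in> borel_measurable lebesgue" unfolding h_def using \<psi>cm \<psi>m by measurable
    have cB: "cen p s x \<in> B" if "x \<in> B" for x using that p s by (intro cen_in) auto
    have AEcen: "AE x in lebesgue. P (cen p s x)" if "AE x in lebesgue. P x" for P
      unfolding cen_def by (rule AE_lebesgue_affine[OF _ that]) (use s in auto)
    have \<psi>cb: "AE x in lebesgue. x \<in> B \<longrightarrow> \<bar>\<psi> (cen p s x)\<bar> \<le> C"
      using AEcen[OF \<psi>b[OF order_refl]] by eventually_elim (use cB in auto)
    have i\<psi>c: "set_integrable lebesgue S (\<lambda>x. \<psi> (cen p s x))" if "S \<in> sets lebesgue" "S \<subseteq> B" for S
      using \<psi>cb that by (intro set_integrable_bounded[OF \<psi>cm that(1) bdd[OF that(2)]]) (auto elim!: eventually_mono)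
    have ih: "set_integrable lebesgue S h" if "S \<in> sets lebesgue" "S \<subseteq> B" for S
      unfolding h_def using i\<psi>c[OF that] i\<psi>[OF that] by (rule set_integral_diff(1))
    have hI: "(LINT x:?E|lebesgue. h x) = c * (LINT x:?A|lebesgue. \<psi> x) - (LINT x:?E|lebesgue. \<psi> x)"
      unfolding h_def c_def using set_integral_diff(2)[OF i\<psi>c[OF sets(3) EB] i\<psi>[OF sets(3) EB]]
        integral_dil[OF s(1) \<psi>m sets(1)] by simp
    have split: "(LINT x:S|lebesgue. f x) = (LINT x:S'|lebesgue. f x) + (LINT x:S-S'|lebesgue. f x)"
      if "S' \<subseteq> S" "S \<in> sets lebesgue" "S' \<in> sets lebesgue" "S \<subseteq> B"
        "\<And>S. S \<in> sets lebesgue \<Longrightarrow> S \<subseteq> B \<Longrightarrow> set_integrable lebesgue S f" for S S' and f :: "'a \<Rightarrow> real"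
    proof -
      have "(LINT x:S' \<union> (S - S')|lebesgue. f x) = (LINT x:S'|lebesgue. f x) + (LINT x:S-S'|lebesgue. f x)"
        using that by (intro set_integral_Un that(5)) auto
      moreover have "S' \<union> (S - S') = S" using that by auto
      ultimately show ?thesis by simp
    qed
    have \<psi>D: "AE x in lebesgue. x \<in> B \<longrightarrow> GDERIV (nose {p} z) x :> gn {p} z x"
      using AE_nose_differentiable[of "{p}" z] by eventually_elim (simp add: gn_def)
    have zero1: "(LINT x:?E-?D|lebesgue. g x) = 0"
    proof -
      have "AE x in lebesgue. x \<in> ?E - ?D \<longrightarrow> \<bar>g x\<bar> \<le> 0"
        using \<psi>D
      proof eventually_elim
        case (elim x)
        show ?case
        proof
          assume x: "x \<in> ?E - ?D"
          then have xB: "x \<in> B" and t: "T x p \<le> z" using EB by (auto simp: Dset_def)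
          have "nose {p} z x = u x" using xB t by (intro nose_eq_u) auto
          then have "gn {p} z x = G x" using nose_grad_eq[of x "{p}" z] p xB elim by simp
          then show "\<bar>g x\<bar> \<le> 0" using xB by (simp add: g_def \<phi>_def \<psi>_def gu_def)
        qed
      qed
      then have "\<bar>LINT x:?E-?D|lebesgue. g x\<bar> \<le> 0 * measure lebesgue (?E - ?D)"
        using \<phi>m \<psi>m sets bdd EB by (intro set_integral_bound_AE) (auto simp: g_def[abs_def])
      then show ?thesis by simp
    qed
    have zero2: "(LINT x:?D|lebesgue. h x) = 0"
    proof -
      have "AE x in lebesgue. x \<in> ?D \<longrightarrow> \<bar>h x\<bar> \<le> 0"
        using \<psi>D AEcen[OF \<psi>D]
      proof eventually_elim
        case (elim x)
        show ?case
        proof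
          assume x: "x \<in> ?D"
          then have xB: "x \<in> B" and t: "T x p > z" by (auto simp: Dset_def)
          have "GDERIV (nose {p} z) ((1 - s / (1 + s)) *\<^sub>R x + (s / (1 + s)) *\<^sub>R p) :> gn {p} z (cen p s x)"
            using elim(2) cB[OF xB] by (simp add: cen_convex_comb[OF s(1), symmetric])
          then have "gn {p} z (cen p s x) = gn {p} z x"
            by (rule nose_homogeneous[OF p xB t, rotated 3]) (use elim(1) xB s in auto)
          then show "\<bar>h x\<bar> \<le> 0" by (simp add: h_def \<psi>_def)
        qed
      qed
      then have "\<bar>LINT x:?D|lebesgue. h x\<bar> \<le> 0 * measure lebesgue ?D"
        using hm sets bdd DB by (intro set_integral_bound_AE) auto
      then show ?thesis by simp
    qed
    have mEA: "measure lebesgue (?E - ?A) \<le> mB * ?n * s"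
    proof -
      have lmE: "?E \<in> lmeasurable" and lmA: "?A \<in> lmeasurable"
        using sets bdd EB AB bounded_set_imp_lmeasurable by blast+
      have "?A = (\<lambda>x. (1 / (1 + s)) *\<^sub>R x + (s / (1 + s)) *\<^sub>R p) ` ?E"
        by (simp add: cen_def[abs_def] add.commute)
      then have mA: "measure lebesgue ?A = measure lebesgue ?E / c"
        using measure_lebesgue_affine[of "1 / (1 + s)" "(s / (1 + s)) *\<^sub>R p" ?E] s
        by (simp add: c_def power_divide)
      have "measure lebesgue (?E - ?A) = measure lebesgue ?E - measure lebesgue ?A"
        using lmE lmA AD DE by (intro measurable_measure_Diff) (auto intro: fmeasurableD)
      also have "\<dots> = measure lebesgue ?E * (1 - 1 / c)" by (simp add: mA algebra_simps)
      also have "\<dots> \<le> mB * (?n * s)"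
      proof (rule mult_mono)
        show "measure lebesgue ?E \<le> mB"
          unfolding mB_def by (rule measure_mono_fmeasurable[OF EB sets(3)]) simp
        show "1 - 1 / c \<le> ?n * s" unfolding c_def by (rule inverse_power_bernoulli[OF s(1)])
        show "0 \<le> 1 - 1 / c" using c by simp
      qed (fact mB)
      finally show ?thesis by simp
    qed
    have m1: "measure lebesgue (?D - ?A) \<le> mB * ?n * s" and m2: "measure lebesgue (?E - ?D) \<le> mB * ?n * s"
    proof -
      have lm: "?E - ?A \<in> lmeasurable"
        using sets bdd[of "?E - ?A"] EB bounded_set_imp_lmeasurable by blast
      have "measure lebesgue (?D - ?A) \<le> measure lebesgue (?E - ?A)"
        by (rule measure_mono_fmeasurable[OF _ _ lm]) (use DE sets in auto)
      then show "measure lebesgue (?D - ?A) \<le> mB * ?n * s" using mEA by (rule order_trans)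
      have "measure lebesgue (?E - ?D) \<le> measure lebesgue (?E - ?A)"
        by (rule measure_mono_fmeasurable[OF _ _ lm]) (use AD sets in auto)
      then show "measure lebesgue (?E - ?D) \<le> mB * ?n * s" using mEA by (rule order_trans)
    qed
    have b1: "\<bar>LINT x:?D-?A|lebesgue. g x\<bar> \<le> e1 * measure lebesgue (?D - ?A)"
    proof (rule set_integral_bound_AE)
      show "AE x in lebesgue. x \<in> ?D - ?A \<longrightarrow> \<bar>g x\<bar> \<le> e1"
        using \<psi>D range
      proof eventually_elim
        case (elim x)
        show ?case
        proof
          assume x: "x \<in> ?D - ?A"
          then have xD: "x \<in> ?D" and xB: "x \<in> B" using DB by auto
          \<comment> \<open>As \<open>x\<close> is not the contraction of a cut-off point, its
            dilated image is not cut off; hence the tangent plane at \<open>x\<close> passes at most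
            \<tau> above the tip.\<close>
          have nd: "dil p s x \<notin> ?E" using x Aeq by auto
          have dd: "dist (dil p s x) x < d" using dist_dil[OF s(1) _ pK, of x] xB s by simp
          have dB: "dil p s x \<in> B"
            using D_R'[OF xD] dd d(5) dist_triangle[of b "dil p s x" x] by (simp add: dist_commute)
          have "hom p z s (dil p s x) \<le> u (dil p s x)" using nd dB by (simp add: Ds_def)
          also have "\<dots> \<le> T x (dil p s x) + norm (G (dil p s x) - G x) * norm (dil p s x - x)"
            using xB dB by (intro u_upper) auto
          also have "\<dots> \<le> T x (dil p s x) + \<tau> / (2 * R) * (2 * R * s)"
            using d3(2)[of "dil p s x" x] dd d(4) xB dB dist_dil[OF s(1) _ pK, of x] \<tau>R
            by (intro add_left_mono mult_mono) (auto simp: dist_norm)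
          finally have "s * T x p \<le> s * (z + \<tau>)" using R by (simp add: hom_dil[OF s(1)] T_dil algebra_simps)
          then have "T x p \<le> z + \<tau>" using s by simp
          then have "norm (gn {p} z x - G x) \<le> \<omega> / 2" using near[OF xD] elim xB by simp
          then have "norm (G x - gn {p} z x) < \<omega>" using \<omega>(1) by (simp add: norm_minus_commute)
          then have "\<bar>F (G x) - F (gn {p} z x)\<bar> < e1" using elim xB M(2) by (intro \<omega>(2)) auto
          then show "\<bar>g x\<bar> \<le> e1" using xB by (simp add: g_def \<phi>_def \<psi>_def gu_def)
        qed
      qed
    qed (use \<phi>m \<psi>m sets bdd DB e1 in \<open>auto simp: g_def[abs_def]\<close>)
    have b2: "\<bar>LINT x:?E-?D|lebesgue. h x\<bar> \<le> e1 * measure lebesgue (?E - ?D)"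
    proof (rule set_integral_bound_AE)
      show "AE x in lebesgue. x \<in> ?E - ?D \<longrightarrow> \<bar>h x\<bar> \<le> e1"
        using \<psi>D AEcen[OF \<psi>D] AEcen[OF range]
      proof eventually_elim
        case (elim x)
        show ?case
        proof
          assume x: "x \<in> ?E - ?D"
          then have xE: "x \<in> ?E" and xB: "x \<in> B" and t: "T x p \<le> z" using EB by (auto simp: Dset_def)
          have "nose {p} z x = u x" using xB t by (intro nose_eq_u) auto
          then have gx: "gn {p} z x = G x" using nose_grad_eq[of x "{p}" z] p xB elim by simp
          let ?y = "cen p s x"
          have yD: "?y \<in> ?D" using cen_Ds[OF s(1) p xE] .
          have yB: "?y \<in> B" using cB[OF xB] .
          have dd: "dist ?y x < d" using dist_cen[OF s(1) _ pK, of x] xB s by simp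
          have "dist (T ?y p) (T x p) \<le> \<tau>" using d2(2)[of ?y x] dd d(3) xB yB by simp
          then have "T ?y p \<le> z + \<tau>" using t by (simp add: dist_real_def)
          then have n1: "norm (gn {p} z ?y - G ?y) \<le> \<omega> / 2" using near[OF yD] elim(2) yB by simp
          have n2: "norm (G ?y - G x) \<le> \<omega> / 4" using d1(2)[of ?y x] dd d(2) xB yB by (simp add: dist_norm)
          have "norm (gn {p} z ?y - G x) \<le> norm (gn {p} z ?y - G ?y) + norm (G ?y - G x)"
            using norm_triangle_ineq[of "gn {p} z ?y - G ?y" "G ?y - G x"] by simp
          also have "\<dots> < \<omega>" using n1 n2 \<omega>(1) by simp
          finally have "\<bar>F (gn {p} z ?y) - F (G x)\<bar> < e1" using elim(3) yB xB M(2) by (intro \<omega>(2)) auto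
          then show "\<bar>h x\<bar> \<le> e1" by (simp add: h_def \<psi>_def gx)
        qed
      qed
    qed (use hm sets bdd[of "?E - ?D"] EB e1 in auto)
    have "c * (LINT x:?A|lebesgue. \<phi> x) - (LINT x:?E|lebesgue. \<phi> x) - (c - 1) * (LINT x:?D|lebesgue. g x)
      = - c * (LINT x:?D-?A|lebesgue. g x) + (LINT x:?E-?D|lebesgue. h x)"
    proof -
      have "(LINT x:?D|lebesgue. g x) = (LINT x:?A|lebesgue. g x) + (LINT x:?D-?A|lebesgue. g x)"
        by (rule split[OF AD sets(2,1) DB ig])
      moreover have "(LINT x:?E|lebesgue. g x) = (LINT x:?D|lebesgue. g x) + (LINT x:?E-?D|lebesgue. g x)"
        by (rule split[OF DE sets(3,2) EB ig])
      moreover have "(LINT x:?E|lebesgue. h x) = (LINT x:?D|lebesgue. h x) + (LINT x:?E-?D|lebesgue. h x)"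
        by (rule split[OF DE sets(3,2) EB ih])
      \<comment> \<open>Stated for arbitrary reals: \<open>p\<close>, \<open>q\<close>,
        \<open>g\<close>, \<open>h\<close> stand for the integrals of \<phi>, \<psi>,
        \<open>g\<close>, \<open>h\<close> over the sets named by the following letters, where
        \<open>DA\<close> and \<open>ED\<close> are the differences.\<close>
      moreover have "c * pA - pE - (c - 1) * gD = - c * gDA + hED"
        if "gD = gA + gDA" "gE = gD + gED" "hE = hD + hED" "gED = 0" "hD = 0" "gA = pA - qA" "gE = pE - qE" "hE = c * qA - qE"
        for pA pE gD gDA gED gE gA hED hE hD qA qE :: real
      proof -
        have e: "pA = gD - gDA + qA" "pE = gD + qE" "hED = c * qA - qE" using that by auto
        show ?thesis unfolding e by (simp add: algebra_simps)
      qed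
      ultimately show ?thesis
        using zero1 zero2 gI[OF sets(1) AB] gI[OF sets(3) EB] hI by metis
    qed
    also have "\<bar>\<dots>\<bar> \<le> c * (e1 * (mB * ?n * s)) + e1 * (mB * ?n * s)"
    proof -
      have "\<bar>LINT x:?D-?A|lebesgue. g x\<bar> \<le> e1 * (mB * ?n * s)"
        using b1 m1 e1 by (meson less_imp_le mult_left_mono order_trans)
      then have "c * \<bar>LINT x:?D-?A|lebesgue. g x\<bar> \<le> c * (e1 * (mB * ?n * s))" using c by (intro mult_left_mono) auto
      moreover have "\<bar>LINT x:?E-?D|lebesgue. h x\<bar> \<le> e1 * (mB * ?n * s)"
        using b2 m2 e1 by (meson less_imp_le mult_left_mono order_trans)
      moreover have "\<bar>- c * (LINT x:?D-?A|lebesgue. g x) + (LINT x:?E-?D|lebesgue. h x)\<bar>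
        \<le> c * \<bar>LINT x:?D-?A|lebesgue. g x\<bar> + \<bar>LINT x:?E-?D|lebesgue. h x\<bar>"
        using c abs_triangle_ineq[of "- c * (LINT x:?D-?A|lebesgue. g x)" "LINT x:?E-?D|lebesgue. h x"]
        by (simp add: abs_mult)
      ultimately show ?thesis by linarith
    qed
    also have "\<dots> \<le> (2 ^ ?n + 1) * (e1 * ((mB * ?n + 1) * s))"
    proof -
      have "e1 * (mB * ?n * s) \<le> e1 * ((mB * ?n + 1) * s)" using e1 s by (intro mult_left_mono mult_right_mono) auto
      then have "(c + 1) * (e1 * (mB * ?n * s)) \<le> (2 ^ ?n + 1) * (e1 * ((mB * ?n + 1) * s))"
        using c e1 s mB by (intro mult_mono) auto
      then show ?thesis by (simp add: algebra_simps)
    qed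
    also have "\<dots> = (e1 * ((2 ^ ?n + 1) * (mB * ?n + 1))) * s" by (simp only: mult_ac)
    also have "e1 * ((2 ^ ?n + 1) * (mB * ?n + 1)) = e"
      unfolding e1_def using den by (simp only: times_divide_eq_left nonzero_mult_div_cancel_right[OF less_imp_neq[OF den, symmetric]])
    finally show "\<bar>(1 + s) ^ DIM('a) * (LINT x:?A|lebesgue. F (gu x)) - (LINT x:?E|lebesgue. F (gu x))
      - ((1 + s) ^ DIM('a) - 1) * (LINT x:?D|lebesgue. F (gu x) - F (gn {p} z x))\<bar> \<le> e * s"
      by (simp add: c_def \<phi>_def g_def \<psi>_def)
  qed (fact s0)
qed

subsection \<open>Two dilations\<close>

text \<open>
  Every coset of the translations by multiples of \<open>w\<close> that meets a sublevel set contains a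
  discrete minimum, so the discrete minima occupy a proportion of order \<open>norm w\<close> of the sublevel set.
\<close>

lemma discrete_minima_measure:
  assumes w: "w \<noteq> 0" "norm w < R - R'" and sub: "\<And>y. y \<in> K \<Longrightarrow> u y < l \<Longrightarrow> y \<in> ball b R'"
  defines "M \<equiv> {y\<in>B. u y < l \<and> u y < u (y + w) \<and> u y \<le> u (y - w)}"
  shows "M \<in> sets lebesgue"
    and "measure lebesgue {y\<in>B. u y < l} \<le> (4 * R / norm w + 1) * measure lebesgue M"
proof -
  define u0 where "u0 x = (if x \<in> K then u x else 0)" for x
  have u0[measurable]: "u0 \<in> borel_measurable borel"
    unfolding u0_def[abs_def] by (rule borel_measurable_continuous_on_if) (use u_cont in auto)
  have nb: "y + w \<in> K" "y - w \<in> K" if "y \<in> K" "u y < l" for y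
    using sub[OF that] w dist_triangle[of b "y + w" y] dist_triangle[of b "y - w" y] by (auto simp: dist_norm)
  have "M = {y\<in>B. u0 y < l \<and> u0 y < u0 (y + w) \<and> u0 y \<le> u0 (y - w)}"
    unfolding M_def using nb by (auto simp: u0_def)
  also have "\<dots> \<in> sets borel" by measurable
  finally show Ms: "M \<in> sets lebesgue" by simp
  have Mlm: "M \<in> lmeasurable"
    using Ms by (intro bounded_set_imp_lmeasurable bounded_subset[OF bounded_ball[of b R]]) (auto simp: M_def)
  \<comment> \<open>At most \<open>N\<close> steps of length \<open>norm w\<close> fit into the
    diameter, so \<open>2 N + 1\<close> translates cover the sublevel set; this is the origin of the
    factor in the claim.\<close>
  define N where "N = nat \<lfloor>2 * R / norm w\<rfloor>"
  have N: "real N \<le> 2 * R / norm w" using R w by (simp add: N_def)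
  define I where "I = {- int N..int N}"
  have cover: "{y\<in>B. u y < l} \<subseteq> (\<Union>k\<in>I. (+) (- (of_int k *\<^sub>R w)) ` M)"
  proof
    fix y assume y: "y \<in> {y\<in>B. u y < l}"
    define S where "S = {k::int. y + of_int k *\<^sub>R w \<in> K}"
    have SI: "S \<subseteq> I"
    proof
      fix k assume "k \<in> S"
      then have "dist (y + of_int k *\<^sub>R w) y \<le> 2 * R" using y by (intro dist_K) (auto simp: S_def)
      then have "real_of_int \<bar>k\<bar> \<le> 2 * R / norm w" using w by (simp add: dist_norm pos_le_divide_eq)
      then have "\<bar>k\<bar> \<le> int N" unfolding N_def by linarith
      then show "k \<in> I" by (auto simp: I_def)
    qed
    then have fS: "finite S" using finite_subset by (auto simp: I_def)
    have S0: "0 \<in> S" using y by (simp add: S_def)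
    define f where "f k = u (y + of_int k *\<^sub>R w)" for k :: int
    define m where "m = Min (f ` S)"
    \<comment> \<open>The last minimiser on the coset: a strict inequality one step forward, a weak
      one step backward. The same asymmetry governs \<open>E1\<close> and \<open>E2\<close>
      below.\<close>
    define k where "k = Max {k\<in>S. f k = m}"
    have "m \<in> f ` S" unfolding m_def using fS S0 by (intro Min_in) auto
    then have ne: "{k\<in>S. f k = m} \<noteq> {}" by auto
    then have k: "k \<in> S" "f k = m" using Max_in[of "{k\<in>S. f k = m}"] fS by (auto simp: k_def)
    have fm: "m \<le> f j" if "j \<in> S" for j using fS that by (simp add: m_def)
    have gt: "m < f j" if "j \<in> S" "j > k" for j
    proof (rule ccontr)
      assume "\<not> m < f j"
      then have "j \<in> {k\<in>S. f k = m}" using fm[OF that(1)] that by simp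
      then have "j \<le> k" unfolding k_def using fS by (intro Max_ge) auto
      then show False using that by simp
    qed
    let ?y = "y + of_int k *\<^sub>R w"
    have yK: "?y \<in> K" and ul: "u ?y < l" using k fm[OF S0] y by (auto simp: S_def f_def)
    have "k + 1 \<in> S" "k - 1 \<in> S" using nb[OF yK ul] by (auto simp: S_def algebra_simps)
    then have "u ?y < u (?y + w)" "u ?y \<le> u (?y - w)"
      using gt[of "k + 1"] fm[of "k - 1"] k(2) by (auto simp: f_def algebra_simps)
    moreover have "R' < R" using w(2) norm_ge_zero[of w] by linarith
    then have "?y \<in> B" using sub[OF yK ul] by simp
    ultimately have "?y \<in> M" using ul by (simp add: M_def)
    then have "y \<in> (+) (- (of_int k *\<^sub>R w)) ` M" by (intro image_eqI[of _ _ ?y]) auto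
    then show "y \<in> (\<Union>k\<in>I. (+) (- (of_int k *\<^sub>R w)) ` M)" using SI k by blast
  qed
  have fin: "finite I" by (simp add: I_def)
  have lm: "(+) (- (of_int k *\<^sub>R w)) ` M \<in> lmeasurable" for k :: int
    using Mlm by (rule measurable_translation)
  have "measure lebesgue {y\<in>B. u y < l} \<le> measure lebesgue (\<Union>k\<in>I. (+) (- (of_int k *\<^sub>R w)) ` M)"
  proof (rule measure_mono_fmeasurable[OF cover])
    show "{y\<in>B. u y < l} \<in> sets lebesgue"
      using open_less_on_ball[OF u_cont continuous_on_const, of l] by simp
    show "(\<Union>k\<in>I. (+) (- (of_int k *\<^sub>R w)) ` M) \<in> lmeasurable"
      using fin lm by (intro fmeasurable.finite_UN) auto
  qed
  also have "\<dots> \<le> (\<Sum>k\<in>I. measure lebesgue ((+) (- (of_int k *\<^sub>R w)) ` M))"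
    by (rule measure_UNION_le[OF fin]) (use lm in \<open>auto intro: fmeasurableD\<close>)
  also have "\<dots> = real (card I) * measure lebesgue M" by (simp only: measure_translation sum_constant)
  also have "\<dots> \<le> (4 * R / norm w + 1) * measure lebesgue M"
    using N by (intro mult_right_mono) (auto simp: I_def)
  finally show "measure lebesgue {y\<in>B. u y < l} \<le> (4 * R / norm w + 1) * measure lebesgue M" .
qed

text \<open>Makes an implication between exact conditions robust. On the compact set where
  \<open>P \<le> - e\<close> the violation of the premises, measured by the maximum of
  \<open>- f\<close> and \<open>\<bar>h\<bar>\<close>, is positive and hence bounded away from
  0.\<close>

lemma compact_margin:
  fixes f h :: "'a \<Rightarrow> real" and P :: "'a \<Rightarrow> real"
  assumes f: "continuous_on K f" "continuous_on K h" "continuous_on K P" and e: "e > 0"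
    and imp: "\<And>y. y \<in> K \<Longrightarrow> 0 \<le> f y \<Longrightarrow> h y = 0 \<Longrightarrow> 0 \<le> P y"
  shows "\<exists>\<eta>>0. \<forall>y\<in>K. - \<eta> \<le> f y \<and> \<bar>h y\<bar> \<le> \<eta> \<longrightarrow> - e \<le> P y"
proof -
  define S where "S = {y\<in>K. P y \<le> - e}"
  define v where "v y = max (- f y) \<bar>h y\<bar>" for y
  have cS: "compact S"
  proof -
    have "closed (K \<inter> P -` {..- e})"
      by (rule continuous_closed_preimage[OF f(3)]) auto
    moreover have "K \<inter> P -` {..- e} = S" by (auto simp: S_def)
    ultimately have "closed S" by simp
    moreover have "bounded S" by (rule bounded_subset[OF bounded_cball[of b R]]) (auto simp: S_def)
    ultimately show ?thesis by (simp add: compact_eq_bounded_closed)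
  qed
  have vc: "continuous_on S v"
    unfolding v_def by (intro continuous_intros continuous_on_subset[OF f(1)] continuous_on_subset[OF f(2)]) (auto simp: S_def)
  have pos: "v y > 0" if "y \<in> S" for y
  proof (rule ccontr)
    assume "\<not> v y > 0"
    then have "0 \<le> f y" "h y = 0" by (auto simp: v_def)
    then have "0 \<le> P y" using imp that by (auto simp: S_def)
    then show False using that e by (auto simp: S_def)
  qed
  show ?thesis
  proof (cases "S = {}")
    case True
    then show ?thesis by (intro exI[of _ 1]) (auto simp: S_def)
  next
    case False
    obtain m where m: "m \<in> S" "\<And>y. y \<in> S \<Longrightarrow> v m \<le> v y" using continuous_attains_inf[OF cS False vc] by blast
    show ?thesis
    proof (intro exI[of _ "v m / 2"] conjI ballI impI)
      show "v m / 2 > 0" using pos m by simp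
      fix y assume y: "y \<in> K" "- (v m / 2) \<le> f y \<and> \<bar>h y\<bar> \<le> v m / 2"
      show "- e \<le> P y"
      proof (rule ccontr)
        assume "\<not> ?thesis"
        then have "y \<in> S" using y by (simp add: S_def)
        then have "v m \<le> v y" by (rule m)
        moreover have "v y \<le> v m / 2" using y by (auto simp: v_def)
        ultimately show False using pos[OF m(1)] by simp
      qed
    qed
  qed
qed

lemma cen_shift: "cen q s x = cen p s x + (s / (1 + s)) *\<^sub>R (q - p)"
  by (simp add: cen_def algebra_simps)

lemma increase_imp_gradient_pos:
  assumes "x \<in> K" "x + w \<in> K" "u x < u (x + w)"
  shows "0 < G (x + w) \<bullet> w"
  using T_le[OF assms(2,1)] assms(3) by (simp add: T_def)

lemma decrease_imp_gradient_nonpos: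
  assumes "x \<in> K" "x + w \<in> K" "u (x + w) \<le> u x"
  shows "G x \<bullet> w \<le> 0"
  using T_le[OF assms(1,2)] assms(3) by (simp add: T_def)

text \<open>The function whose epigraph is the intersection of that of \<open>u\<close> with its two dilations.\<close>

definition dila :: "'a \<Rightarrow> 'a \<Rightarrow> real \<Rightarrow> real \<Rightarrow> 'a \<Rightarrow> real" where
  "dila p q z s x = max (u x) (max (hom p z s x) (hom q z s x))"

lemma dila_convex:
  assumes "s > 0" "p \<in> K" "q \<in> K"
  shows "convex_on K (dila p q z s)"
proof (rule convex_onI)
  fix t x y assume t: "0 < (t::real)" "t < 1" and xy: "x \<in> K" "y \<in> K"
  have *: "(1 - t) * a + t * a' \<le> (1 - t) * c + t * c'" if "a \<le> c" "a' \<le> c'" for a a' c c' :: real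
    using that t by (intro add_mono mult_left_mono) auto
  show "dila p q z s ((1 - t) *\<^sub>R x + t *\<^sub>R y) \<le> (1 - t) * dila p q z s x + t * dila p q z s y"
    unfolding dila_def
  proof (intro max.boundedI)
    show "u ((1 - t) *\<^sub>R x + t *\<^sub>R y) \<le> (1 - t) * max (u x) (max (hom p z s x) (hom q z s x)) + t * max (u y) (max (hom p z s y) (hom q z s y))"
      using t xy by (intro order_trans[OF convex_onD[OF cv] *]) auto
    show "hom p z s ((1 - t) *\<^sub>R x + t *\<^sub>R y) \<le> (1 - t) * max (u x) (max (hom p z s x) (hom q z s x)) + t * max (u y) (max (hom p z s y) (hom q z s y))"
      using t xy by (intro order_trans[OF convex_onD[OF hom_convex[OF assms(1,2)]] *]) auto
    show "hom q z s ((1 - t) *\<^sub>R x + t *\<^sub>R y) \<le> (1 - t) * max (u x) (max (hom p z s x) (hom q z s x)) + t * max (u y) (max (hom p z s y) (hom q z s y))"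
      using t xy by (intro order_trans[OF convex_onD[OF hom_convex[OF assms(1,3)]] *]) auto
  qed
qed simp

text \<open>The region cut off is divided according to the higher dilation. Ties go to the first
  piece, so that the pieces are disjoint and their preimages avoid the points with the mixed strict
  and weak inequalities of a discrete minimum.\<close>

definition E1 :: "'a \<Rightarrow> 'a \<Rightarrow> real \<Rightarrow> real \<Rightarrow> 'a set" where
  "E1 p q z s = {x\<in>B. u x < hom p z s x \<and> hom q z s x \<le> hom p z s x}"
definition E2 :: "'a \<Rightarrow> 'a \<Rightarrow> real \<Rightarrow> real \<Rightarrow> 'a set" where
  "E2 p q z s = {x\<in>B. u x < hom q z s x \<and> hom p z s x < hom q z s x}"

lemma E_disjoint: "E1 p q z s \<inter> E2 p q z s = {}"
  by (auto simp: E1_def E2_def)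

lemma E_union: "E1 p q z s \<union> E2 p q z s = Ds p z s \<union> Ds q z s"
  by (auto simp: E1_def E2_def Ds_def)

lemma E_sub: "E1 p q z s \<subseteq> Ds p z s" "E2 p q z s \<subseteq> Ds q z s"
  by (auto simp: E1_def E2_def Ds_def)

lemma E_sets:
  assumes "s > 0" "p \<in> K" "q \<in> K"
  shows "E1 p q z s \<in> sets borel" "E2 p q z s \<in> sets borel"
proof -
  have o: "open {x\<in>B. hom p z s x < hom q z s x}"
    using assms by (intro open_less_on_ball hom_cont)
  have "E1 p q z s = Ds p z s - {x\<in>B. hom p z s x < hom q z s x}"
    by (auto simp: E1_def Ds_def)
  then show "E1 p q z s \<in> sets borel" using o Ds_open[OF assms(1,2)] by auto
  have "E2 p q z s = Ds q z s \<inter> {x\<in>B. hom p z s x < hom q z s x}"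
    by (auto simp: E2_def Ds_def)
  then show "E2 p q z s \<in> sets borel" using o Ds_open[OF assms(1,3)] by auto
qed

lemma cen_image_borel:
  assumes "s > 0" "S \<in> sets borel"
  shows "cen p s ` S \<in> sets borel"
proof -
  have "cen p s ` S = dil p s -` S \<inter> space borel" using assms(1) by (force intro: image_eqI[where x = "dil p s _"])
  also have "\<dots> \<in> sets borel"
    by (rule measurable_sets[OF _ assms(2)]) (simp add: dil_def[abs_def])
  finally show ?thesis .
qed

text \<open>At a common point both dilations carry the same constant, so comparing them compares
  \<open>u\<close> at the two preimages, which differ by \<open>w\<close>. The sign of the slope
  then follows from the tangent plane at \<open>y\<close>.\<close>

lemma A1_char:
  assumes s: "s > 0" and p: "p \<in> B" "q \<in> B" and y: "y \<in> cen p s ` E1 p q z s"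
  defines "w \<equiv> (s / (1 + s)) *\<^sub>R (q - p)"
  shows "y \<in> Dset p z" "y + w \<in> K" "u (y + w) \<le> u y" "G y \<bullet> (q - p) \<le> 0"
proof -
  obtain x where x: "x \<in> E1 p q z s" "y = cen p s x" using y by blast
  then have xB: "x \<in> B" by (auto simp: E1_def)
  show D: "y \<in> Dset p z" using cen_Ds[OF s p(1)] E_sub x by blast
  have e: "cen q s x = y + w" unfolding x w_def by (rule cen_shift)
  show "y + w \<in> K" using cen_in[OF s convex_cball, of q b R x] p xB e by simp
  have "hom q z s x \<le> hom p z s x" using x by (simp add: E1_def)
  then show le: "u (y + w) \<le> u y" using s by (simp add: hom_def e x(2)[symmetric])
  have "G y \<bullet> w \<le> 0" using decrease_imp_gradient_nonpos[OF _ \<open>y + w \<in> K\<close> le] D by (simp add: Dset_def)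
  then show "G y \<bullet> (q - p) \<le> 0" using s by (simp add: w_def mult_le_0_iff divide_simps)
qed

lemma A2_char:
  assumes s: "s > 0" and p: "p \<in> B" "q \<in> B" and y: "y \<in> cen q s ` E2 p q z s"
  defines "w \<equiv> (s / (1 + s)) *\<^sub>R (q - p)"
  shows "y \<in> Dset q z" "y - w \<in> K" "u (y - w) < u y" "0 < G y \<bullet> (q - p)"
proof -
  obtain x where x: "x \<in> E2 p q z s" "y = cen q s x" using y by blast
  then have xB: "x \<in> B" by (auto simp: E2_def)
  show D: "y \<in> Dset q z" using cen_Ds[OF s p(2)] E_sub x by blast
  have e: "cen p s x = y - w" unfolding x w_def using cen_shift[of q s x p] by simp
  show "y - w \<in> K" using cen_in[OF s convex_cball, of p b R x] p xB e by simp
  have "hom p z s x < hom q z s x" using x by (simp add: E2_def)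
  then show le: "u (y - w) < u y" using s by (simp add: hom_def e x(2)[symmetric])
  have "0 < G (y - w + w) \<bullet> w"
    by (rule increase_imp_gradient_pos) (use \<open>y - w \<in> K\<close> le D in \<open>auto simp: Dset_def\<close>)
  then show "0 < G y \<bullet> (q - p)" using s by (simp add: w_def zero_less_mult_iff zero_less_divide_iff)
qed

lemma A_disjoint:
  assumes "s > 0" "p \<in> B" "q \<in> B"
  shows "cen p s ` E1 p q z s \<inter> cen q s ` E2 p q z s = {}"
  using A1_char(4)[OF assms, of _ z] A2_char(4)[OF assms, of _ z] by fastforce

text \<open>At a point of differentiability every function touching the maximum from below has its
  gradient, so the sets where two of the functions agree call for no separate argument.\<close>

lemma AE_dila_gradient:
  assumes s: "s > 0" and p: "p \<in> B" "q \<in> B"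
  shows "AE x in lebesgue. x \<in> B \<longrightarrow> GDERIV (dila p q z s) x :>
    (if x \<in> E1 p q z s then G (cen p s x) else if x \<in> E2 p q z s then G (cen q s x) else G x)"
proof -
  have pK: "p \<in> K" "q \<in> K" using p by auto
  have "AE x in lebesgue. x \<in> B \<longrightarrow> dila p q z s differentiable (at x)"
    by (rule AE_differentiable_convex) (auto intro: convex_on_subset[OF dila_convex[OF s pK]])
  then show ?thesis
  proof eventually_elim
    case (elim x)
    show ?case
    proof
      assume x: "x \<in> B"
      then have D: "GDERIV (dila p q z s) x :> grad (dila p q z s) x" using elim GDERIV_grad by blast
      have xK: "x \<in> K" using x by simp
      have 1: "grad (dila p q z s) x = G (cen p s x)" if "x \<in> E1 p q z s"
        by (rule GDERIV_touching[OF D hom_gderiv[OF s xK pK(1), of z] open_ball x])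
          (use that in \<open>auto simp: dila_def E1_def\<close>)
      have 2: "grad (dila p q z s) x = G (cen q s x)" if "x \<in> E2 p q z s"
        by (rule GDERIV_touching[OF D hom_gderiv[OF s xK pK(2), of z] open_ball x])
          (use that in \<open>auto simp: dila_def E2_def\<close>)
      have 3: "grad (dila p q z s) x = G x" if "x \<notin> E1 p q z s" "x \<notin> E2 p q z s"
      proof (rule GDERIV_touching[OF D G[OF xK] open_ball x])
        have "x \<notin> Ds p z s \<union> Ds q z s" using that E_union by blast
        then show "u x = dila p q z s x" using x by (auto simp: dila_def Ds_def max_def)
      qed (auto simp: dila_def)
      show "GDERIV (dila p q z s) x :>
        (if x \<in> E1 p q z s then G (cen p s x) else if x \<in> E2 p q z s then G (cen q s x) else G x)"
        using D 1 2 3 by auto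
    qed
  qed
qed

lemma set_integral_grad_in_B:
  "(LINT x:B|lebesgue. F (gn X z x)) = (LINT x:B|lebesgue. F (grad (nose X z) x))"
  "(LINT x:B|lebesgue. F (gu x)) = (LINT x:B|lebesgue. F (G x))"
  by (auto intro!: set_lebesgue_integral_cong simp: gn_def gu_def)

lemma u_bounded: obtains C where "C > 0" "\<And>x. x \<in> K \<Longrightarrow> \<bar>u x\<bar> \<le> C"
proof -
  have "bounded (u ` K)" by (intro compact_imp_bounded compact_continuous_image u_cont) auto
  then show ?thesis using that unfolding bounded_pos by auto
qed

lemma F_bounded_on_gradients:
  fixes F :: "'a \<Rightarrow> real"
  assumes "continuous_on UNIV F"
  obtains C where "\<And>x. x \<in> K \<Longrightarrow> \<bar>F (G x)\<bar> \<le> C"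
proof -
  have "bounded ((\<lambda>x. F (G x)) ` K)"
    by (intro compact_imp_bounded compact_continuous_image continuous_on_compose2[OF assms Gc]) auto
  then obtain C where "\<forall>y\<in>(\<lambda>x. F (G x)) ` K. norm y \<le> C" unfolding bounded_iff by blast
  then show ?thesis by (intro that[of C]) auto
qed

lemma F_gu:
  fixes F :: "'a \<Rightarrow> real"
  assumes F: "continuous_on UNIV F"
  shows "(\<lambda>x. F (gu x)) \<in> borel_measurable lebesgue"
    and "S \<in> sets lebesgue \<Longrightarrow> S \<subseteq> B \<Longrightarrow> set_integrable lebesgue S (\<lambda>x. F (gu x))"
proof -
  have Fb: "F \<in> borel_measurable borel" using F by (rule borel_measurable_continuous_onI)
  show m: "(\<lambda>x. F (gu x)) \<in> borel_measurable lebesgue"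
    using measurable_compose[OF gu_measurable Fb] by (simp add: measurable_completion)
  obtain C where C: "\<And>x. x \<in> K \<Longrightarrow> \<bar>F (G x)\<bar> \<le> C" using F_bounded_on_gradients[OF F] by blast
  show "set_integrable lebesgue S (\<lambda>x. F (gu x))" if "S \<in> sets lebesgue" "S \<subseteq> B"
    by (rule set_integrable_bounded[OF m that(1) bounded_subset[OF bounded_ball that(2)]])
      (use that(2) in \<open>auto intro!: AE_I2 C simp: gu_def\<close>)
qed

lemma F_gn:
  fixes F :: "'a \<Rightarrow> real"
  assumes F: "continuous_on UNIV F" and range: "AE x in lebesgue. x \<in> B \<longrightarrow> gn X z x \<in> G ` B"
  shows "(\<lambda>x. F (gn X z x)) \<in> borel_measurable lebesgue"
    and "S \<in> sets lebesgue \<Longrightarrow> S \<subseteq> B \<Longrightarrow> set_integrable lebesgue S (\<lambda>x. F (gn X z x))"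
proof -
  have Fb: "F \<in> borel_measurable borel" using F by (rule borel_measurable_continuous_onI)
  show m: "(\<lambda>x. F (gn X z x)) \<in> borel_measurable lebesgue"
    by (rule measurable_compose[OF gn_measurable Fb])
  obtain C where C: "\<And>x. x \<in> K \<Longrightarrow> \<bar>F (G x)\<bar> \<le> C" using F_bounded_on_gradients[OF F] by blast
  have "AE x in lebesgue. x \<in> S \<longrightarrow> \<bar>F (gn X z x)\<bar> \<le> C" if SB: "S \<subseteq> B" for S
    using range
  proof eventually_elim
    case (elim x)
    show ?case
    proof
      assume "x \<in> S"
      then obtain y where "y \<in> B" "gn X z x = G y" using elim SB by blast
      then show "\<bar>F (gn X z x)\<bar> \<le> C" using C[of y] by simp
    qed
  qed
  then show "set_integrable lebesgue S (\<lambda>x. F (gn X z x))" if "S \<in> sets lebesgue" "S \<subseteq> B"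
    using that by (intro set_integrable_bounded[OF m that(1) bounded_subset[OF bounded_ball that(2)]]) auto
qed

lemma gn_eq_gu_off:
  assumes X: "X \<subseteq> B" and D: "GDERIV (nose X z) x :> gn X z x" and x: "x \<in> B" "\<And>p. p \<in> X \<Longrightarrow> x \<notin> Dset p z"
  shows "gn X z x = gu x"
proof -
  have "T x p \<le> z" if "p \<in> X" for p using x(2)[OF that] x(1) by (simp add: Dset_def)
  then have "nose X z x = u x" using x by (intro nose_eq_u) auto
  then show ?thesis using nose_grad_eq[OF x(1) D] x by (simp add: gu_def)
qed

lemma AE_gn: "AE x in lebesgue. x \<in> B \<longrightarrow> GDERIV (nose X z) x :> gn X z x"
  using AE_nose_differentiable[of X z] by eventually_elim (simp add: gn_def)

text \<open>
  Energies restricted to gradients with \<open>\<xi> \<bullet> (q - p) \<le> - \<eta>\<close> only see the tip \<open>p\<close>.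
\<close>

lemma homothety_one_side:
  fixes F :: "'a \<Rightarrow> real"
  assumes pq: "p \<in> B" "q \<in> B" and R': "R' < R" and off: "\<And>x. x \<in> K - ball b R' \<Longrightarrow> T x p < z"
    "\<And>x. x \<in> K - ball b R' \<Longrightarrow> T x q < z"
    and F: "continuous_on UNIV F" and \<eta>: "\<eta> > 0" and supp: "\<And>\<xi>. - \<eta> \<le> \<xi> \<bullet> (q - p) \<Longrightarrow> F \<xi> = 0"
    and e: "e > 0" and neg: "negligible (convex hull {p, q})"
  shows "\<exists>s0>0. \<forall>s. 0 < s \<and> s < s0 \<longrightarrow>
    \<bar>(1 + s) ^ DIM('a) * (LINT x:cen p s ` Ds p z s|lebesgue. F (gu x)) - (LINT x:Ds p z s|lebesgue. F (gu x))
      - ((1 + s) ^ DIM('a) - 1) * (LINT x:B|lebesgue. F (gu x) - F (gn {p, q} z x))\<bar> \<le> e * s"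
proof -
  have rp: "AE x in lebesgue. x \<in> B \<longrightarrow> gn {p} z x \<in> G ` B"
    by (rule AE_gn_range) (use pq off R' in auto)
  have rpq: "AE x in lebesgue. x \<in> B \<longrightarrow> gn {p, q} z x \<in> G ` B"
    by (rule AE_gn_range) (use pq off R' neg in auto)
  note iu = F_gu[OF F] and ip = F_gn[OF F rp] and ipq = F_gn[OF F rpq]
  have Dl: "Dset p z \<in> sets lebesgue" using Dset_open by simp
  have DB: "Dset p z \<subseteq> B" by (auto simp: Dset_def)
  have "(LINT x:Dset p z|lebesgue. F (gu x) - F (gn {p} z x)) = (LINT x:B|lebesgue. F (gu x) - F (gn {p, q} z x))"
    unfolding set_lebesgue_integral_def
  proof (rule integral_cong_AE)
    show "AE x in lebesgue. indicat_real (Dset p z) x *\<^sub>R (F (gu x) - F (gn {p} z x)) = indicat_real B x *\<^sub>R (F (gu x) - F (gn {p, q} z x))"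
      using AE_gn[of "{p}" z] AE_gn[of "{p, q}" z]
    proof eventually_elim
      case (elim x)
      show ?case
      proof (cases "x \<in> B")
        case True
        have D: "GDERIV (nose {p} z) x :> gn {p} z x" "GDERIV (nose {p, q} z) x :> gn {p, q} z x" using elim True by auto
        have eq: "F (gn {p} z x) = F (gn {p, q} z x)"
        proof (cases "gn {p, q} z x \<bullet> (q - p) < 0 \<or> gn {p} z x \<bullet> (q - p) < 0")
          case t: True
          then show ?thesis using nose_two_one[OF pq True D(2,1) t] by simp
        next
          case False
          \<comment> \<open>If neither gradient points away from \<open>q\<close>, both lie where
            \<open>F\<close> vanishes.\<close>
          then show ?thesis using supp \<eta> by (auto simp: not_less)
        qed
        have "x \<notin> Dset p z \<Longrightarrow> gn {p} z x = gu x"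
          using gn_eq_gu_off[OF _ D(1) True] pq by simp
        then show ?thesis using True eq by (auto simp: indicator_def)
      next
        case False
        then show ?thesis using DB by (auto simp: indicator_def)
      qed
    qed
    show "(\<lambda>x. indicat_real (Dset p z) x *\<^sub>R (F (gu x) - F (gn {p} z x))) \<in> borel_measurable lebesgue"
      by (intro borel_measurable_scaleR borel_measurable_indicator borel_measurable_diff iu(1) ip(1) Dl)
    show "(\<lambda>x. indicat_real B x *\<^sub>R (F (gu x) - F (gn {p, q} z x))) \<in> borel_measurable lebesgue"
      by (intro borel_measurable_scaleR borel_measurable_indicator borel_measurable_diff iu(1) ipq(1)) simp
  qed
  then show ?thesis using homothety_nose[OF pq(1) R' off(1) F e] by simp
qed

text \<open>On \<open>E1\<close> and \<open>E2\<close> the gradient is that of \<open>u\<close> at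
  the contracted point, and a change of variables brings out the Jacobian. The contracted pieces are
  disjoint by \<open>A_disjoint\<close>, so their integrals add up; off both pieces nothing
  changes.\<close>

lemma dila_energy:
  fixes F :: "'a \<Rightarrow> real"
  assumes s: "s > 0" and p: "p \<in> B" "q \<in> B" and F: "continuous_on UNIV F"
  shows "(LINT x:B|lebesgue. F (grad (dila p q z s) x)) - (LINT x:B|lebesgue. F (gu x)) =
    (1 + s) ^ DIM('a) * (LINT x:cen p s ` E1 p q z s \<union> cen q s ` E2 p q z s|lebesgue. F (gu x))
      - (LINT x:Ds p z s \<union> Ds q z s|lebesgue. F (gu x))"
    and "set_integrable lebesgue B (\<lambda>x. F (grad (dila p q z s) x))"
proof -
  have pK: "p \<in> K" "q \<in> K" using p by auto
  let ?E1 = "E1 p q z s" and ?E2 = "E2 p q z s"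
  define \<phi> where "\<phi> x = F (gu x)" for x
  note \<phi>m = F_gu(1)[OF F, folded \<phi>_def] and i\<phi> = F_gu(2)[OF F, folded \<phi>_def]
  have E: "?E1 \<in> sets lebesgue" "?E2 \<in> sets lebesgue" using E_sets[OF s pK] by auto
  have EB: "?E1 \<subseteq> B" "?E2 \<subseteq> B" by (auto simp: E1_def E2_def)
  define W where "W = B - (?E1 \<union> ?E2)"
  have W: "W \<in> sets lebesgue" "W \<subseteq> B" using E by (auto simp: W_def)
  define k where "k x = F (if x \<in> B then grad (dila p q z s) x else 0)" for x
  have Fb: "F \<in> borel_measurable borel" using F by (rule borel_measurable_continuous_onI)
  have km: "k \<in> borel_measurable lebesgue"
    unfolding k_def
    by (rule measurable_compose[OF borel_measurable_grad Fb]) (auto intro: convex_on_subset[OF dila_convex[OF s pK]])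
  obtain C where C: "\<And>x. x \<in> K \<Longrightarrow> \<bar>F (G x)\<bar> \<le> C" using F_bounded_on_gradients[OF F] by blast
  have AEk: "AE x in lebesgue. x \<in> B \<longrightarrow> k x = (if x \<in> ?E1 then \<phi> (cen p s x) else if x \<in> ?E2 then \<phi> (cen q s x) else \<phi> x)"
    using AE_dila_gradient[OF s p, of z]
  proof eventually_elim
    case (elim x)
    have "cen p s x \<in> B" "cen q s x \<in> B" if "x \<in> B"
      using that cen_in[OF s convex_ball p(1)] cen_in[OF s convex_ball p(2)] by blast+
    then show ?case using elim by (auto simp: k_def \<phi>_def gu_def dest!: grad_eqI)
  qed
  have ik: "set_integrable lebesgue S k" if "S \<in> sets lebesgue" "S \<subseteq> B" for S
  proof (rule set_integrable_bounded[OF km that(1) bounded_subset[OF bounded_ball that(2)]])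
    show "AE x in lebesgue. x \<in> S \<longrightarrow> \<bar>k x\<bar> \<le> C"
      using AEk
    proof eventually_elim
      case (elim x)
      have "cen p s x \<in> B" "cen q s x \<in> B" if "x \<in> B"
        using that cen_in[OF s convex_ball p(1)] cen_in[OF s convex_ball p(2)] by blast+
      then show ?case using elim that(2) C by (auto simp: \<phi>_def gu_def)
    qed
  qed
  have keq: "(LINT x:S|lebesgue. F (grad (dila p q z s) x)) = (LINT x:S|lebesgue. k x)" if "S \<in> sets lebesgue" "S \<subseteq> B" for S
    using that by (intro set_lebesgue_integral_cong) (auto simp: k_def)
  have "(\<lambda>x. indicat_real B x *\<^sub>R F (grad (dila p q z s) x)) = (\<lambda>x. indicat_real B x *\<^sub>R k x)"
    by (auto simp: k_def indicator_def)
  then show "set_integrable lebesgue B (\<lambda>x. F (grad (dila p q z s) x))"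
    using ik[of B] by (simp add: set_integrable_def)
  have split3: "(LINT x:B|lebesgue. f x) = (LINT x:?E1|lebesgue. f x) + (LINT x:?E2|lebesgue. f x) + (LINT x:W|lebesgue. f x)"
    if "\<And>S. S \<in> sets lebesgue \<Longrightarrow> S \<subseteq> B \<Longrightarrow> set_integrable lebesgue S f" for f :: "'a \<Rightarrow> real"
  proof -
    have "(LINT x:(?E1 \<union> ?E2) \<union> W|lebesgue. f x) = (LINT x:?E1 \<union> ?E2|lebesgue. f x) + (LINT x:W|lebesgue. f x)"
      by (rule set_integral_Un) (use E EB W that in \<open>auto simp: W_def\<close>)
    moreover have "(LINT x:?E1 \<union> ?E2|lebesgue. f x) = (LINT x:?E1|lebesgue. f x) + (LINT x:?E2|lebesgue. f x)"
      by (rule set_integral_Un[OF E_disjoint]) (use E EB that in auto)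
    moreover have "(?E1 \<union> ?E2) \<union> W = B" using EB by (auto simp: W_def)
    ultimately show ?thesis by simp
  qed
  have cm: "cen r s \<in> lebesgue \<rightarrow>\<^sub>M lebesgue" for r
  proof -
    have "(\<lambda>x. (s / (1 + s)) *\<^sub>R r + (\<Sum>j\<in>Basis. (1 / (1 + s) * (x \<bullet> j)) *\<^sub>R j)) = cen r s"
      by (simp only: cen_def[abs_def] scaleR_scaleR[symmetric] scaleR_sum_right[symmetric] euclidean_representation)
    then show ?thesis
      using lebesgue_affine_measurable[of "\<lambda>_. 1 / (1 + s)" "(s / (1 + s)) *\<^sub>R r"] s by simp
  qed
  note pm = measurable_compose[OF cm \<phi>m]
  have A: "cen p s ` ?E1 \<in> sets lebesgue" "cen q s ` ?E2 \<in> sets lebesgue"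
    using cen_image_borel[OF s] E_sets[OF s pK] by auto
  have AB: "cen p s ` ?E1 \<subseteq> B" "cen q s ` ?E2 \<subseteq> B"
  proof -
    have "Dset r z \<subseteq> B" for r by (auto simp: Dset_def)
    then show "cen p s ` ?E1 \<subseteq> B" "cen q s ` ?E2 \<subseteq> B"
      using A1_char(1)[OF s p, of _ z] A2_char(1)[OF s p, of _ z] by blast+
  qed
  have "(LINT x:?E1|lebesgue. k x) = (LINT x:?E1|lebesgue. \<phi> (cen p s x))"
    by (rule set_lebesgue_integral_cong_AE[OF E(1) km pm])
      (use AEk in \<open>eventually_elim, use EB in auto\<close>)
  also have "\<dots> = (1 + s) ^ DIM('a) * (LINT y:cen p s ` ?E1|lebesgue. \<phi> y)"
    by (rule integral_dil[OF s \<phi>m A(1)])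
  finally have 1: "(LINT x:?E1|lebesgue. k x) = (1 + s) ^ DIM('a) * (LINT y:cen p s ` ?E1|lebesgue. \<phi> y)" .
  have "(LINT x:?E2|lebesgue. k x) = (LINT x:?E2|lebesgue. \<phi> (cen q s x))"
    by (rule set_lebesgue_integral_cong_AE[OF E(2) km pm])
      (use AEk in \<open>eventually_elim, use EB E_disjoint[of p q z s] in auto\<close>)
  also have "\<dots> = (1 + s) ^ DIM('a) * (LINT y:cen q s ` ?E2|lebesgue. \<phi> y)"
    by (rule integral_dil[OF s \<phi>m A(2)])
  finally have 2: "(LINT x:?E2|lebesgue. k x) = (1 + s) ^ DIM('a) * (LINT y:cen q s ` ?E2|lebesgue. \<phi> y)" .
  have 3: "(LINT x:W|lebesgue. k x) = (LINT x:W|lebesgue. \<phi> x)"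
    by (rule set_lebesgue_integral_cong_AE[OF W(1) km \<phi>m])
      (use AEk in \<open>eventually_elim, auto simp: W_def\<close>)
  have 4: "(LINT x:cen p s ` ?E1 \<union> cen q s ` ?E2|lebesgue. \<phi> x) = (LINT y:cen p s ` ?E1|lebesgue. \<phi> y) + (LINT y:cen q s ` ?E2|lebesgue. \<phi> y)"
    by (rule set_integral_Un[OF A_disjoint[OF s p]]) (use A AB i\<phi> in auto)
  have 5: "(LINT x:Ds p z s \<union> Ds q z s|lebesgue. \<phi> x) = (LINT x:?E1|lebesgue. \<phi> x) + (LINT x:?E2|lebesgue. \<phi> x)"
    unfolding E_union[symmetric] by (rule set_integral_Un[OF E_disjoint]) (use E EB i\<phi> in auto)
  show "(LINT x:B|lebesgue. F (grad (dila p q z s) x)) - (LINT x:B|lebesgue. F (gu x)) =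
    (1 + s) ^ DIM('a) * (LINT x:cen p s ` ?E1 \<union> cen q s ` ?E2|lebesgue. F (gu x))
      - (LINT x:Ds p z s \<union> Ds q z s|lebesgue. F (gu x))"
    using split3[OF ik] split3[OF i\<phi>] 1 2 3 4 5 keq[of B]
    by (simp add: \<phi>_def[symmetric] algebra_simps)
qed

end

subsection \<open>Comparison of the two competitors\<close>

lemma set_integral_cong_off:
  fixes f :: "'a \<Rightarrow> real"
  assumes "\<And>x. x \<in> S - S' \<Longrightarrow> f x = 0" "\<And>x. x \<in> S' - S \<Longrightarrow> f x = 0"
  shows "(LINT x:S|M. f x) = (LINT x:S'|M. f x)"
proof -
  have "(\<lambda>x. indicator S x *\<^sub>R f x) = (\<lambda>x. indicator S' x *\<^sub>R f x)"
    using assms by (auto simp: indicator_def fun_eq_iff)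
  then show ?thesis by (simp add: set_lebesgue_integral_def)
qed

lemma set_integral_ge_AE:
  fixes f :: "'a::euclidean_space \<Rightarrow> real"
  assumes f: "set_integrable lebesgue S f" and S: "S \<in> lmeasurable"
    and ae: "AE x in lebesgue. x \<in> S \<longrightarrow> c \<le> f x"
  shows "c * measure lebesgue S \<le> (LINT x:S|lebesgue. f x)"
proof -
  have "c * measure lebesgue S = (LINT x|lebesgue. c * indicator S x)" by simp
  also have "\<dots> \<le> (LINT x|lebesgue. indicator S x *\<^sub>R f x)"
  proof (rule integral_mono_AE)
    show "integrable lebesgue (\<lambda>x. c * indicator S x)"
      using S by (intro integrable_mult_right) (simp add: lmeasurable_iff_integrable)
    show "integrable lebesgue (\<lambda>x. indicator S x *\<^sub>R f x)" using f by (simp add: set_integrable_def)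
    show "AE x in lebesgue. c * indicator S x \<le> indicator S x *\<^sub>R f x"
      using ae by eventually_elim (auto simp: indicator_def)
  qed
  finally show ?thesis by (simp add: set_lebesgue_integral_def)
qed

lemma negligible_convex_hull_pair:
  fixes p q :: "'a::euclidean_space"
  assumes "DIM('a) = 2"
  shows "negligible (convex hull {p, q})"
proof -
  have "card {p, q} \<le> DIM('a)" using assms by (simp add: card_insert_if)
  then have "interior (convex hull {p, q}) = {}" by (intro empty_interior_convex_hull) auto
  then show ?thesis using negligible_convex_interior[OF convex_convex_hull] by blast
qed

context C1_ball
begin

text \<open>
  To first order in \<open>s\<close>, the two dilations change the energy by twice the difference between the energies
  of \<open>u\<close> and of \<open>nose {p, q} z\<close>, as far as gradients with \<open>\<xi> \<bullet> (q - p) \<noteq> 0\<close> are concerned. For gradients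
  nearly perpendicular to \<open>q - p\<close> the gap between the dilated pieces counts: it contains the discrete minima
  of \<open>u\<close> in the direction \<open>q - p\<close>, where the integrand is at least \<open>\<kappa>\<close>, and so has measure of order \<open>s\<close>.
\<close>

lemma two_nose:
  fixes F :: "'a \<Rightarrow> real"
  assumes dim: "DIM('a) = 2"
    and pq: "p \<in> B" "q \<in> B" "p \<noteq> q"
    and R': "R' < R" and offp: "\<And>x. x \<in> K - ball b R' \<Longrightarrow> T x p < z" and offq: "\<And>x. x \<in> K - ball b R' \<Longrightarrow> T x q < z"
    and F: "continuous_on UNIV F"
    and H1: "\<And>y. y \<in> K \<Longrightarrow> G y \<bullet> (q - p) = 0 \<Longrightarrow> z \<le> T y p \<Longrightarrow> 0 \<le> F (G y)"
    and H2: "\<And>y. y \<in> K \<Longrightarrow> G y \<bullet> (q - p) = 0 \<Longrightarrow> T y p = z \<Longrightarrow> F (G y) = 0"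
    and sub: "\<And>y. y \<in> K \<Longrightarrow> u y < l \<Longrightarrow> y \<in> ball b R' \<and> z < T y p \<and> \<kappa> \<le> F (G y)"
    and x0: "x0 \<in> B" "u x0 < l" and \<kappa>: "\<kappa> > 0"
    and E: "(LINT x:B|lebesgue. F (gu x)) \<le> (LINT x:B|lebesgue. F (gn {p, q} z x))"
  shows "\<exists>s0>0. \<forall>s. 0 < s \<and> s < s0 \<longrightarrow>
    (LINT x:B|lebesgue. F (grad (dila p q z s) x)) < (LINT x:B|lebesgue. F (gu x))"
proof -
  have pK: "p \<in> K" "q \<in> K" using pq by auto
  define d where "d = q - p"
  have d0: "norm d > 0" using pq by (simp add: d_def)
  have dR: "norm d \<le> 2 * R" using dist_K[OF pK(2,1)] by (simp add: d_def dist_norm)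
  have Tq: "T y q = T y p + G y \<bullet> d" for y by (simp add: T_def d_def inner_simps)
  have neg: "negligible (convex hull {p, q})" by (rule negligible_convex_hull_pair[OF dim])
  define mB where "mB = measure lebesgue B"
  have mB: "mB \<ge> 0" by (simp add: mB_def)
  define Q where "Q = {y\<in>B. u y < l}"
  have Qo: "open Q" unfolding Q_def by (rule open_less_on_ball[OF u_cont continuous_on_const])
  have Q0: "Q \<noteq> {}" using x0 by (auto simp: Q_def)
  have Qlm: "Q \<in> lmeasurable"
    using Qo by (intro bounded_set_imp_lmeasurable bounded_subset[OF bounded_ball[of b R]]) (auto simp: Q_def)
  define \<mu> where "\<mu> = measure lebesgue Q"
  have \<mu>: "\<mu> > 0"
    unfolding \<mu>_def using Qo Q0 Qlm open_not_negligible negligible_iff_measure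
    by (metis zero_less_measure_iff)
  \<comment> \<open>Gain per unit of \<open>s\<close>: \<open>discrete_minima_measure\<close> with
    \<open>norm w \<ge> s * norm d / 2\<close> and \<open>s * norm d \<le> 2 * R\<close> bounds
    \<mu> by \<open>12 * R / (s * norm d)\<close> times the measure of the minima.\<close>
  define \<kappa>1 where "\<kappa>1 = \<kappa> * (\<mu> * norm d / (12 * R))"
  have \<kappa>1: "\<kappa>1 > 0" using \<kappa> \<mu> d0 R by (simp add: \<kappa>1_def)
  \<comment> \<open>The errors will be \<open>2 e0 s\<close> from the two tips and
    \<open>6 e0 mB s + 2 e0 mB s\<close> from nearly perpendicular gradients; this choice lets them
    use up half of the gain.\<close>
  define e0 where "e0 = \<kappa>1 / (2 * (2 + 8 * mB))"
  have den: "2 * (2 + 8 * mB) > 0" using mB by simp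
  have e0: "e0 > 0" using \<kappa>1 den by (simp add: e0_def)
  have e0eq: "e0 * (2 + 8 * mB) = \<kappa>1 / 2" using den by (simp add: e0_def field_simps)
  have cFG: "continuous_on K (\<lambda>y. F (G y))" by (intro continuous_on_compose2[OF F Gc]) auto
  have cGd: "continuous_on K (\<lambda>y. G y \<bullet> d)" by (intro continuous_intros Gc)
  have cm: "continuous_on K (\<lambda>y. max (T y p) (T y q) - z)" by (intro continuous_intros T_cont)
  have cm': "continuous_on K (\<lambda>y. - \<bar>max (T y p) (T y q) - z\<bar>)" by (intro continuous_intros T_cont)
  have cFG': "continuous_on K (\<lambda>y. - \<bar>F (G y)\<bar>)" by (intro continuous_intros cFG)
  \<comment> \<open>Since \<open>T y q = T y p + G y \<bullet> d\<close>, both tips count alike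
    where \<open>G y \<bullet> d = 0\<close>. Here and in the next step \<open>H1\<close> and
    \<open>H2\<close> acquire a margin.\<close>
  have "\<exists>\<eta>>0. \<forall>y\<in>K. - \<eta> \<le> max (T y p) (T y q) - z \<and> \<bar>G y \<bullet> d\<bar> \<le> \<eta> \<longrightarrow> - e0 \<le> F (G y)"
    by (rule compact_margin[OF cm cGd cFG e0]) (use H1 in \<open>auto simp: Tq d_def\<close>)
  then obtain \<eta>1 where \<eta>1: "\<eta>1 > 0" "\<And>y. y \<in> K \<Longrightarrow> - \<eta>1 \<le> max (T y p) (T y q) - z \<Longrightarrow> \<bar>G y \<bullet> d\<bar> \<le> \<eta>1 \<Longrightarrow> - e0 \<le> F (G y)"
    by blast
  have "\<exists>\<eta>>0. \<forall>y\<in>K. - \<eta> \<le> - \<bar>max (T y p) (T y q) - z\<bar> \<and> \<bar>G y \<bullet> d\<bar> \<le> \<eta> \<longrightarrow> - e0 \<le> - \<bar>F (G y)\<bar>"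
    by (rule compact_margin[OF cm' cGd cFG' e0]) (use H2 in \<open>auto simp: Tq d_def\<close>)
  then obtain \<eta>2 where \<eta>2: "\<eta>2 > 0" "\<And>y. y \<in> K \<Longrightarrow> - \<eta>2 \<le> - \<bar>max (T y p) (T y q) - z\<bar> \<Longrightarrow> \<bar>G y \<bullet> d\<bar> \<le> \<eta>2 \<Longrightarrow> - e0 \<le> - \<bar>F (G y)\<bar>"
    by blast
  define \<eta> where "\<eta> = min \<eta>1 \<eta>2 / 2"
  have \<eta>: "\<eta> > 0" "2 * \<eta> \<le> \<eta>1" "2 * \<eta> \<le> \<eta>2" using \<eta>1 \<eta>2 by (auto simp: \<eta>_def)
  \<comment> \<open>A cut-off in the slope along \<open>d\<close>: it is 1 up to
    \<open>- 2 \<eta>\<close> and 0 from \<open>- \<eta>\<close> on. It splits \<open>F\<close> into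
    \<open>F1\<close>, which sees only the tip \<open>p\<close>, \<open>F2\<close>, which sees only
    \<open>q\<close>, and \<open>F0\<close>, which lives on nearly perpendicular gradients.\<close>
  define \<zeta> :: "real \<Rightarrow> real" where "\<zeta> r = min 1 (max 0 (- r / \<eta> - 1))" for r
  have \<zeta>01: "0 \<le> \<zeta> r" "\<zeta> r \<le> 1" for r by (auto simp: \<zeta>_def)
  have \<zeta>0: "\<zeta> r = 0" if "- \<eta> \<le> r" for r using that \<eta> by (simp add: \<zeta>_def field_simps)
  have \<zeta>1: "\<zeta> r = 1" if "r \<le> - (2 * \<eta>)" for r using that \<eta> by (simp add: \<zeta>_def field_simps)
  have \<zeta>c: "continuous_on UNIV \<zeta>" unfolding \<zeta>_def using \<eta> by (intro continuous_intros) auto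
  define F1 where "F1 \<xi> = F \<xi> * \<zeta> (\<xi> \<bullet> d)" for \<xi>
  define F2 where "F2 \<xi> = F \<xi> * \<zeta> (- (\<xi> \<bullet> d))" for \<xi>
  define F0 where "F0 \<xi> = F \<xi> * (1 - \<zeta> (\<xi> \<bullet> d) - \<zeta> (- (\<xi> \<bullet> d)))" for \<xi>
  have Fsum: "F \<xi> = F1 \<xi> + F2 \<xi> + F0 \<xi>" for \<xi> by (simp add: F1_def F2_def F0_def algebra_simps)
  have c\<zeta>: "continuous_on UNIV (\<lambda>\<xi>. \<zeta> (\<xi> \<bullet> d))" "continuous_on UNIV (\<lambda>\<xi>. \<zeta> (- (\<xi> \<bullet> d)))"
    by (intro continuous_on_compose2[OF \<zeta>c] continuous_intros; simp)+
  have Fc: "continuous_on UNIV F1" "continuous_on UNIV F2" "continuous_on UNIV F0"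
    unfolding F1_def[abs_def] F2_def[abs_def] F0_def[abs_def] by (intro continuous_intros F c\<zeta>)+
  have F1s: "F1 \<xi> = 0" if "- \<eta> \<le> \<xi> \<bullet> (q - p)" for \<xi> using \<zeta>0 that by (simp add: F1_def d_def)
  have F2s: "F2 \<xi> = 0" if "- \<eta> \<le> \<xi> \<bullet> (p - q)" for \<xi>
  proof -
    have "- (\<xi> \<bullet> d) = \<xi> \<bullet> (p - q)" by (simp add: d_def inner_simps)
    then show ?thesis using \<zeta>0 that by (simp add: F2_def)
  qed
  have X01: "0 \<le> 1 - \<zeta> r - \<zeta> (- r)" "1 - \<zeta> r - \<zeta> (- r) \<le> 1" for r
  proof -
    have "\<zeta> r = 0 \<or> \<zeta> (- r) = 0" using \<zeta>0[of r] \<zeta>0[of "- r"] \<eta> by linarith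
    then show "0 \<le> 1 - \<zeta> r - \<zeta> (- r)" "1 - \<zeta> r - \<zeta> (- r) \<le> 1" using \<zeta>01[of r] \<zeta>01[of "- r"] by auto
  qed
  have F0_low: "- e0 \<le> F0 \<xi>" if "\<bar>\<xi> \<bullet> d\<bar> \<le> 2 * \<eta> \<Longrightarrow> - e0 \<le> F \<xi>" for \<xi>
  proof (cases "\<bar>\<xi> \<bullet> d\<bar> \<le> 2 * \<eta>")
    case True
    define c where "c = 1 - \<zeta> (\<xi> \<bullet> d) - \<zeta> (- (\<xi> \<bullet> d))"
    have c: "0 \<le> c" "c \<le> 1" using X01[of "\<xi> \<bullet> d"] by (auto simp: c_def)
    have "c * e0 \<le> 1 * e0" using c e0 by (intro mult_right_mono) auto
    then have "- e0 \<le> c * (- e0)" by simp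
    also have "c * (- e0) \<le> c * F \<xi>" using that[OF True] c by (intro mult_left_mono) auto
    finally show ?thesis by (simp add: F0_def c_def mult.commute)
  next
    case False
    then consider "\<xi> \<bullet> d \<le> - (2 * \<eta>)" | "- (\<xi> \<bullet> d) \<le> - (2 * \<eta>)" by linarith
    then have "1 - \<zeta> (\<xi> \<bullet> d) - \<zeta> (- (\<xi> \<bullet> d)) = 0"
    proof cases
      case 1 then show ?thesis using \<zeta>1[OF 1] \<zeta>0[of "- (\<xi> \<bullet> d)"] \<eta> by simp
    next
      case 2 then show ?thesis using \<zeta>1[OF 2] \<zeta>0[of "\<xi> \<bullet> d"] \<eta> by simp
    qed
    then show ?thesis using e0 by (simp add: F0_def)
  qed
  have F0_up: "F0 \<xi> \<le> e0" if "\<bar>\<xi> \<bullet> d\<bar> \<le> 2 * \<eta> \<Longrightarrow> \<bar>F \<xi>\<bar> \<le> e0" for \<xi>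
  proof (cases "\<bar>\<xi> \<bullet> d\<bar> \<le> 2 * \<eta>")
    case True
    define c where "c = 1 - \<zeta> (\<xi> \<bullet> d) - \<zeta> (- (\<xi> \<bullet> d))"
    have c: "0 \<le> c" "c \<le> 1" using X01[of "\<xi> \<bullet> d"] by (auto simp: c_def)
    have "c * F \<xi> \<le> c * e0" using that[OF True] c by (intro mult_left_mono) auto
    also have "\<dots> \<le> 1 * e0" using c e0 by (intro mult_right_mono) auto
    finally show ?thesis by (simp add: F0_def c_def mult.commute)
  next
    case False
    then consider "\<xi> \<bullet> d \<le> - (2 * \<eta>)" | "- (\<xi> \<bullet> d) \<le> - (2 * \<eta>)" by linarith
    then have "1 - \<zeta> (\<xi> \<bullet> d) - \<zeta> (- (\<xi> \<bullet> d)) = 0"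
    proof cases
      case 1 then show ?thesis using \<zeta>1[OF 1] \<zeta>0[of "- (\<xi> \<bullet> d)"] \<eta> by simp
    next
      case 2 then show ?thesis using \<zeta>1[OF 2] \<zeta>0[of "\<xi> \<bullet> d"] \<eta> by simp
    qed
    then show ?thesis using e0 by (simp add: F0_def)
  qed
  have F0_eq: "F0 \<xi> = F \<xi>" if "\<bar>\<xi> \<bullet> d\<bar> \<le> \<eta>" for \<xi>
    using \<zeta>0[of "\<xi> \<bullet> d"] \<zeta>0[of "- (\<xi> \<bullet> d)"] that by (simp add: F0_def)
  have rpq: "AE x in lebesgue. x \<in> B \<longrightarrow> gn {p, q} z x \<in> G ` B"
    by (rule AE_gn_range) (use pq offp offq R' neg in auto)
  obtain t1 where t1: "t1 > 0" "\<And>x y. x \<in> K \<Longrightarrow> y \<in> K \<Longrightarrow> dist x y < t1 \<Longrightarrow> dist (G x \<bullet> d) (G y \<bullet> d) \<le> \<eta> / 2"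
    using uniform_modulus[OF cGd, of "\<eta> / 2"] \<eta> by auto
  obtain t2 where t2: "t2 > 0" "\<And>x y. x \<in> K \<Longrightarrow> y \<in> K \<Longrightarrow> dist x y < t2 \<Longrightarrow> dist (T x p) (T y p) \<le> \<eta>1"
    using uniform_modulus[OF T_cont \<eta>1(1)] by blast
  obtain t3 where t3: "t3 > 0" "\<And>x y. x \<in> K \<Longrightarrow> y \<in> K \<Longrightarrow> dist x y < t3 \<Longrightarrow> dist (T x q) (T y q) \<le> \<eta>1"
    using uniform_modulus[OF T_cont \<eta>1(1)] by blast
  obtain s1 where s1: "s1 > 0" "\<And>s. 0 < s \<and> s < s1 \<Longrightarrow>
    \<bar>(1 + s) ^ DIM('a) * (LINT x:cen p s ` Ds p z s|lebesgue. F1 (gu x)) - (LINT x:Ds p z s|lebesgue. F1 (gu x))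
      - ((1 + s) ^ DIM('a) - 1) * (LINT x:B|lebesgue. F1 (gu x) - F1 (gn {p, q} z x))\<bar> \<le> e0 * s"
    using homothety_one_side[OF pq(1,2) R' offp offq Fc(1) \<eta>(1) F1s e0 neg] by blast
  have neg': "negligible (convex hull {q, p})" using neg by (simp add: insert_commute)
  obtain s2 where s2: "s2 > 0" "\<And>s. 0 < s \<and> s < s2 \<Longrightarrow>
    \<bar>(1 + s) ^ DIM('a) * (LINT x:cen q s ` Ds q z s|lebesgue. F2 (gu x)) - (LINT x:Ds q z s|lebesgue. F2 (gu x))
      - ((1 + s) ^ DIM('a) - 1) * (LINT x:B|lebesgue. F2 (gu x) - F2 (gn {q, p} z x))\<bar> \<le> e0 * s"
    using homothety_one_side[OF pq(2,1) R' offq offp Fc(2) \<eta>(1) F2s e0 neg'] by blast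
  define t where "t = min (min t1 t2) (min t3 (R - R'))"
  have t: "t > 0" "t \<le> t1" "t \<le> t2" "t \<le> t3" "t \<le> R - R'" using t1 t2 t3 R' by (auto simp: t_def)
  define s0 where "s0 = min (min s1 s2) (min 1 (t / (2 * R)))"
  have s0: "s0 > 0" using s1 s2 t R by (simp add: s0_def)
  define I where "I f = (LINT x:B|lebesgue. f (gu x) - f (gn {p, q} z x))" for f :: "'a \<Rightarrow> real"
  have ifn: "set_integrable lebesgue S (\<lambda>x. f (gu x))" "set_integrable lebesgue S (\<lambda>x. f (gn {p, q} z x))"
    if "continuous_on UNIV f" "S \<in> sets lebesgue" "S \<subseteq> B" for f :: "'a \<Rightarrow> real" and S
    using F_gu(2)[OF that] F_gn(2)[OF that(1) rpq that(2,3)] by auto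
  have Isum: "I F = I F1 + I F2 + I F0"
  proof -
    have "I F = (LINT x:B|lebesgue. ((F1 (gu x) - F1 (gn {p, q} z x)) + (F2 (gu x) - F2 (gn {p, q} z x))) + (F0 (gu x) - F0 (gn {p, q} z x)))"
      unfolding I_def by (intro set_lebesgue_integral_cong) (auto simp: Fsum)
    also have "\<dots> = I F1 + I F2 + I F0"
      unfolding I_def using Fc ifn[OF _ _ order_refl] by (simp add: set_integral_add set_integral_diff)
    finally show ?thesis .
  qed
  have IF: "I F \<le> 0"
    unfolding I_def using E ifn[OF F _ order_refl] by (simp add: set_integral_diff)
  show ?thesis
  proof (intro exI[of _ s0] conjI allI impI)
    fix s assume "0 < s \<and> s < s0"
    then have s: "0 < s" "s < s1" "s < s2" "s < 1" "2 * R * s < t" using R by (auto simp: s0_def field_simps)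
    define c where "c = (1 + s) ^ DIM('a)"
    have c_eq: "c = 1 + 2 * s + s * s" by (simp add: c_def dim power2_eq_square algebra_simps)
    have ss: "s * s \<le> s" "0 \<le> s * s" using s by (auto simp: mult_left_le)
    have c: "0 \<le> c - 1" "c - 1 \<le> 3 * s" "1 \<le> c" using s ss by (auto simp: c_eq)
    define w where "w = (s / (1 + s)) *\<^sub>R d"
    have ws: "(s / (1 + s)) *\<^sub>R (q - p) = w" by (simp add: w_def d_def)
    have rat: "s / 2 \<le> s / (1 + s)" "s / (1 + s) \<le> s" "0 < s / (1 + s)" using s by (auto simp: field_simps)
    have nw: "norm w = s / (1 + s) * norm d" using s by (simp add: w_def)
    have nw_up: "norm w \<le> 2 * R * s"
    proof -
      have "norm w \<le> s * (2 * R)" unfolding nw using rat dR s by (intro mult_mono) auto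
      then show ?thesis by (simp add: mult_ac)
    qed
    have nwt: "norm w < t" using nw_up s by linarith
    have nw_low: "s * norm d / 2 \<le> norm w"
      unfolding nw using mult_right_mono[OF rat(1), of "norm d"] by simp
    have w0: "w \<noteq> 0" using rat d0 by (auto simp: w_def)
    have Gw: "0 < G x \<bullet> w \<longleftrightarrow> 0 < G x \<bullet> d" "G x \<bullet> w \<le> 0 \<longleftrightarrow> G x \<bullet> d \<le> 0" "G x \<bullet> w < 0 \<longleftrightarrow> G x \<bullet> d < 0" for x
    proof -
      define \<epsilon> where "\<epsilon> = s / (1 + s)"
      have "\<epsilon> > 0" "G x \<bullet> w = \<epsilon> * (G x \<bullet> d)" using rat(3) by (simp_all add: \<epsilon>_def w_def)
      then show "0 < G x \<bullet> w \<longleftrightarrow> 0 < G x \<bullet> d" "G x \<bullet> w \<le> 0 \<longleftrightarrow> G x \<bullet> d \<le> 0" "G x \<bullet> w < 0 \<longleftrightarrow> G x \<bullet> d < 0"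
        by (simp_all add: zero_less_mult_iff mult_le_0_iff mult_less_0_iff)
    qed
    have close: "dist (G x \<bullet> d) (G y \<bullet> d) \<le> \<eta> / 2" if "x \<in> K" "y \<in> K" "dist x y \<le> 2 * R * s \<or> dist x y < t" for x y
      using t1(2)[OF that(1,2)] that(3) s t by linarith
    have cenK: "cen p s x \<in> K" "cen q s x \<in> K" if "x \<in> K" for x
      using cen_in[OF s(1) convex_cball pK(1) that] cen_in[OF s(1) convex_cball pK(2) that] .
    have cenB: "cen p s x \<in> B" "cen q s x \<in> B" if "x \<in> B" for x
      using cen_in[OF s(1) convex_ball pq(1) that] cen_in[OF s(1) convex_ball pq(2) that] .
    have cqp: "cen q s x = cen p s x + w" for x using cen_shift[of q s x p] ws by simp
    define Ep Eq where "Ep = Ds p z s" and "Eq = Ds q z s"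
    define A1 A2 where "A1 = cen p s ` E1 p q z s" and "A2 = cen q s ` E2 p q z s"
    define A where "A = A1 \<union> A2"
    define Ed where "Ed = Ep \<union> Eq"
    define D where "D = Dset p z \<union> Dset q z"
    note ch1 = A1_char[OF s(1) pq(1,2), of _ z, folded A1_def, unfolded ws]
    note ch2 = A2_char[OF s(1) pq(1,2), of _ z, folded A2_def, unfolded ws]
    have DB: "D \<subseteq> B" and EB: "Ed \<subseteq> B" and EpB: "Ep \<subseteq> B" "Eq \<subseteq> B"
      by (auto simp: D_def Dset_def Ed_def Ep_def Eq_def Ds_def)
    have AD: "A \<subseteq> D" unfolding A_def D_def using ch1(1) ch2(1) by blast
    have DE: "D \<subseteq> Ed"
      unfolding D_def Ed_def Ep_def Eq_def using Dset_sub_Ds[OF s(1) pK(1)] Dset_sub_Ds[OF s(1) pK(2)] by blast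
    have AB: "A \<subseteq> B" "A1 \<subseteq> B" "A2 \<subseteq> B" using AD DB by (auto simp: A_def)
    have Es: "E1 p q z s \<in> sets borel" "E2 p q z s \<in> sets borel" using E_sets[OF s(1) pK] by auto
    have As: "A1 \<in> sets borel" "A2 \<in> sets borel" "A \<in> sets borel"
      unfolding A_def A1_def A2_def using cen_image_borel[OF s(1)] Es by auto
    have Ds: "D \<in> sets borel" and Eds: "Ed \<in> sets borel"
      unfolding D_def Ed_def Ep_def Eq_def using Dset_open Ds_open[OF s(1)] pK by auto
    have lms: "S \<in> lmeasurable" if "S \<in> sets borel" "S \<subseteq> B" for S
      using that by (intro bounded_set_imp_lmeasurable bounded_subset[OF bounded_ball that(2)]) auto
    have shift_less: "u (x + w) < u x" if "x \<in> K" "x + w \<in> K" "G x \<bullet> d < - \<eta>" for x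
    proof -
      have "dist (G (x + w) \<bullet> d) (G x \<bullet> d) \<le> \<eta> / 2" using that nwt by (intro close) (auto simp: dist_norm)
      then have "G (x + w) \<bullet> d < 0" using that(3) \<eta>(1) unfolding dist_real_def by linarith
      then have "G (x + w) \<bullet> w < 0" using Gw by simp
      moreover have "T (x + w) x \<le> u x" using T_le that by blast
      ultimately show ?thesis by (simp add: T_def)
    qed
    have shift_less': "u (x - w) < u x" if "x \<in> K" "x - w \<in> K" "G x \<bullet> d > \<eta>" for x
    proof -
      have "dist (G (x - w) \<bullet> d) (G x \<bullet> d) \<le> \<eta> / 2" using that nwt by (intro close) (auto simp: dist_norm)
      then have "G (x - w) \<bullet> d > 0" using that(3) \<eta>(1) unfolding dist_real_def by linarith
      then have "G (x - w) \<bullet> w > 0" using Gw by simp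
      moreover have "T (x - w) x \<le> u x" using T_le that by blast
      ultimately show ?thesis by (simp add: T_def)
    qed
    have F1z: "F1 (gu x) = 0" if "x \<in> B" "- \<eta> \<le> G x \<bullet> d" for x
      using F1s[of "G x"] that by (simp add: gu_def d_def)
    have F2z: "F2 (gu x) = 0" if "x \<in> B" "G x \<bullet> d \<le> \<eta>" for x
      using F2s[of "G x"] that by (simp add: gu_def d_def inner_simps)
    \<comment> \<open>Where \<open>F1\<close> does not vanish, the slope along \<open>d\<close> is
      below \<open>- \<eta>\<close>. There a step by \<open>w\<close> decreases \<open>u\<close>, so
      the dilation about \<open>p\<close> is the higher one and the two domains agree.\<close>
    have "(LINT x:A|lebesgue. F1 (gu x)) = (LINT x:cen p s ` Ep|lebesgue. F1 (gu x))"
    proof (rule set_integral_cong_off)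
      fix x assume x: "x \<in> A - cen p s ` Ep"
      then have "x \<in> A2" using E_sub(1)[of p q z s] by (auto simp: A_def A1_def Ep_def)
      then show "F1 (gu x) = 0" using ch2(4) x AB \<eta>(1) by (intro F1z) (auto simp: d_def dest!: ch2(4))
    next
      fix x assume x: "x \<in> cen p s ` Ep - A"
      then obtain y where y: "y \<in> Ep" "x = cen p s y" by blast
      have yB: "y \<in> B" using y EpB by blast
      have xB: "x \<in> B" using cenB yB y by blast
      show "F1 (gu x) = 0"
      proof (rule F1z[OF xB], rule ccontr)
        assume "\<not> - \<eta> \<le> G x \<bullet> d"
        moreover have "x + w \<in> K" using cenK(2)[of y] yB y cqp[of y] by simp
        ultimately have "u (x + w) < u x" using shift_less[of x] xB by simp
        then have "hom q z s y \<le> hom p z s y" using s y(2) cqp[of y] by (simp add: hom_def)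
        then have "y \<in> E1 p q z s" using y(1) by (simp add: E1_def Ep_def Ds_def)
        then show False using x y(2) by (auto simp: A_def A1_def)
      qed
    qed
    \<comment> \<open>A point cut off only about \<open>q\<close> has its \<open>q\<close>-preimage
      on a rising stretch; by uniform continuity the slope at the point itself is then at least
      \<open>- \<eta>\<close>.\<close>
    moreover have "(LINT x:Ed|lebesgue. F1 (gu x)) = (LINT x:Ep|lebesgue. F1 (gu x))"
    proof (rule set_integral_cong_off)
      fix x assume x: "x \<in> Ed - Ep"
      then have xB: "x \<in> B" using EB by blast
      then have xK: "x \<in> K" by simp
      have "hom p z s x < hom q z s x" using x xB by (auto simp: Ed_def Ep_def Eq_def Ds_def)
      then have "u (cen p s x) < u (cen p s x + w)" using s by (simp add: hom_def cqp)
      then have "0 < G (cen p s x + w) \<bullet> w"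
        using cenK[OF xK] by (intro increase_imp_gradient_pos) (auto simp: cqp)
      then have "0 < G (cen q s x) \<bullet> d" using Gw by (simp add: cqp)
      moreover have "dist (G (cen q s x) \<bullet> d) (G x \<bullet> d) \<le> \<eta> / 2"
        using dist_cen[OF s(1) xK pK(2)] cenK[OF xK] xK by (intro close) auto
      ultimately have "- \<eta> \<le> G x \<bullet> d" using \<eta>(1) unfolding dist_real_def by linarith
      then show "F1 (gu x) = 0" by (rule F1z[OF xB])
    qed (auto simp: Ed_def)
    ultimately have L1: "\<bar>c * (LINT x:A|lebesgue. F1 (gu x)) - (LINT x:Ed|lebesgue. F1 (gu x)) - (c - 1) * I F1\<bar> \<le> e0 * s"
      using s1(2)[of s] s by (simp add: c_def Ep_def I_def)
    have "(LINT x:A|lebesgue. F2 (gu x)) = (LINT x:cen q s ` Eq|lebesgue. F2 (gu x))"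
    proof (rule set_integral_cong_off)
      fix x assume x: "x \<in> A - cen q s ` Eq"
      then have "x \<in> A1" using E_sub(2)[of p q z s] by (auto simp: A_def A2_def Eq_def)
      then show "F2 (gu x) = 0" using x AB \<eta>(1) by (intro F2z) (auto simp: d_def dest!: ch1(4))
    next
      fix x assume x: "x \<in> cen q s ` Eq - A"
      then obtain y where y: "y \<in> Eq" "x = cen q s y" by blast
      have yB: "y \<in> B" using y EpB by blast
      have xB: "x \<in> B" using cenB yB y by blast
      have e: "cen p s y = x - w" using cqp[of y] y(2) by simp
      show "F2 (gu x) = 0"
      proof (rule F2z[OF xB], rule ccontr)
        assume "\<not> G x \<bullet> d \<le> \<eta>"
        moreover have "x - w \<in> K" using cenK(1)[of y] yB e by simp
        ultimately have "u (x - w) < u x" using shift_less'[of x] xB by simp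
        then have "hom p z s y < hom q z s y" using s y(2) e by (simp add: hom_def)
        then have "y \<in> E2 p q z s" using y(1) by (simp add: E2_def Eq_def Ds_def)
        then show False using x y(2) by (auto simp: A_def A2_def)
      qed
    qed
    moreover have "(LINT x:Ed|lebesgue. F2 (gu x)) = (LINT x:Eq|lebesgue. F2 (gu x))"
    proof (rule set_integral_cong_off)
      fix x assume x: "x \<in> Ed - Eq"
      then have xB: "x \<in> B" using EB by blast
      then have xK: "x \<in> K" by simp
      have "hom q z s x < hom p z s x" using x xB by (auto simp: Ed_def Ep_def Eq_def Ds_def)
      then have "u (cen p s x + w) < u (cen p s x + w + - w)" using s by (simp add: hom_def cqp)
      then have "0 < G (cen p s x + w + - w) \<bullet> (- w)"
        using cenK[OF xK] by (intro increase_imp_gradient_pos) (auto simp: cqp)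
      then have "G (cen p s x) \<bullet> d < 0" using Gw by simp
      moreover have "dist (G (cen p s x) \<bullet> d) (G x \<bullet> d) \<le> \<eta> / 2"
        using dist_cen[OF s(1) xK pK(1)] cenK[OF xK] xK by (intro close) auto
      ultimately have "G x \<bullet> d \<le> \<eta>" using \<eta>(1) unfolding dist_real_def by linarith
      then show "F2 (gu x) = 0" by (rule F2z[OF xB])
    qed (auto simp: Ed_def)
    ultimately have L2: "\<bar>c * (LINT x:A|lebesgue. F2 (gu x)) - (LINT x:Ed|lebesgue. F2 (gu x)) - (c - 1) * I F2\<bar> \<le> e0 * s"
      using s2(2)[of s] s by (simp add: c_def Eq_def I_def insert_commute)
    have split: "(LINT x:S|lebesgue. f x) = (LINT x:S'|lebesgue. f x) + (LINT x:S-S'|lebesgue. f x)"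
      if "S' \<subseteq> S" "S \<in> sets borel" "S' \<in> sets borel" "S \<subseteq> B"
        "\<And>S. S \<in> sets lebesgue \<Longrightarrow> S \<subseteq> B \<Longrightarrow> set_integrable lebesgue S f" for S S' and f :: "'a \<Rightarrow> real"
    proof -
      have "(LINT x:S' \<union> (S - S')|lebesgue. f x) = (LINT x:S'|lebesgue. f x) + (LINT x:S-S'|lebesgue. f x)"
        using that by (intro set_integral_Un that(5)) auto
      moreover have "S' \<union> (S - S') = S" using that by auto
      ultimately show ?thesis by simp
    qed
    \<comment> \<open>The gap: points of the region cut off whose gradient is not carried over to
      the new graph.\<close>
    define L where "L = Ed - A"
    have Ls: "L \<in> sets borel" "L \<subseteq> B" using Eds As EB by (auto simp: L_def)
    have ml: "measure lebesgue S \<le> mB" if "S \<in> sets borel" "S \<subseteq> B" for S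
      unfolding mB_def using that by (intro measure_mono_fmeasurable) auto
    have mL: "measure lebesgue L \<le> mB * 2 * s"
    proof -
      have img: "measure lebesgue (cen r s ` S) = measure lebesgue S / c" for r S
      proof -
        have "cen r s ` S = (\<lambda>x. (1 / (1 + s)) *\<^sub>R x + (s / (1 + s)) *\<^sub>R r) ` S"
          by (simp add: cen_def[abs_def] add.commute)
        then show ?thesis
          using measure_lebesgue_affine[of "1 / (1 + s)" "(s / (1 + s)) *\<^sub>R r" S] s
          by (simp add: c_def power_divide)
      qed
      have "measure lebesgue A = measure lebesgue A1 + measure lebesgue A2"
        unfolding A_def using A_disjoint[OF s(1) pq(1,2), of z] lms[OF As(1) AB(2)] lms[OF As(2) AB(3)]
        by (intro measure_Un2[THEN trans]) (auto simp: A1_def A2_def Diff_triv Int_commute)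
      also have "\<dots> = (measure lebesgue (E1 p q z s) + measure lebesgue (E2 p q z s)) / c"
        by (simp add: A1_def A2_def img add_divide_distrib)
      also have "measure lebesgue (E1 p q z s) + measure lebesgue (E2 p q z s) = measure lebesgue Ed"
      proof -
        have "E1 p q z s \<subseteq> B" "E2 p q z s \<subseteq> B" by (auto simp: E1_def E2_def)
        then have "measure lebesgue (E1 p q z s \<union> E2 p q z s) = measure lebesgue (E1 p q z s) + measure lebesgue (E2 p q z s)"
          using E_disjoint[of p q z s] lms[OF Es(1)] lms[OF Es(2)]
          by (intro measure_Un2[THEN trans]) (auto simp: Diff_triv Int_commute)
        then show ?thesis by (simp add: E_union Ed_def Ep_def Eq_def)
      qed
      finally have mA: "measure lebesgue A = measure lebesgue Ed / c" .
      have "measure lebesgue L = measure lebesgue Ed - measure lebesgue A"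
        unfolding L_def using lms[OF Eds EB] lms[OF As(3) AB(1)] AD DE As(3)
        by (intro measurable_measure_Diff) auto
      also have "\<dots> = measure lebesgue Ed * (1 - 1 / c)" by (simp add: mA algebra_simps)
      also have "\<dots> \<le> mB * (2 * s)"
      proof (rule mult_mono)
        show "measure lebesgue Ed \<le> mB" using ml[OF Eds EB] .
        show "1 - 1 / c \<le> 2 * s" using inverse_power_bernoulli[OF s(1), of 2] by (simp add: c_def dim)
        show "0 \<le> 1 - 1 / c" using c by simp
      qed (fact mB)
      finally show ?thesis by simp
    qed
    \<comment> \<open>A cut-off point is close to a visible one, so its tangent plane passes at most
      \<open>\<eta>1\<close> below one of the tips and the margin of \<open>H1\<close>
      applies.\<close>
    have low: "- e0 \<le> F0 (gu x)" if "x \<in> Ed" for x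
    proof -
      have xB: "x \<in> B" using that EB by blast
      then have xK: "x \<in> K" by simp
      have "- \<eta>1 \<le> max (T x p) (T x q) - z"
      proof (cases "x \<in> Ep")
        case True
        then have "z < T (cen p s x) p" using cen_Ds[OF s(1) pq(1), of x z] by (simp add: Ep_def Dset_def)
        moreover have "dist (T (cen p s x) p) (T x p) \<le> \<eta>1"
          using dist_cen[OF s(1) xK pK(1)] s t cenK[OF xK] xK by (intro t2(2)) auto
        ultimately show ?thesis unfolding dist_real_def by linarith
      next
        case False
        then have "x \<in> Eq" using that by (simp add: Ed_def)
        then have "z < T (cen q s x) q" using cen_Ds[OF s(1) pq(2), of x z] by (simp add: Eq_def Dset_def)
        moreover have "dist (T (cen q s x) q) (T x q) \<le> \<eta>1"
          using dist_cen[OF s(1) xK pK(2)] s t cenK[OF xK] xK by (intro t3(2)) auto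
        ultimately show ?thesis unfolding dist_real_def by linarith
      qed
      then show ?thesis using \<eta>1(2)[OF xK] \<eta>(2) xB by (intro F0_low) (simp add: gu_def)
    qed
    have up: "AE x in lebesgue. x \<in> D \<longrightarrow> F0 (gn {p, q} z x) \<le> e0"
    proof -
      have "AE x in lebesgue. x \<notin> convex hull {p, q}"
        unfolding eventually_ae_filter_negligible using neg by (intro exI[of _ "convex hull {p, q}"]) auto
      with AE_gn[of "{p, q}" z] show ?thesis
      proof eventually_elim
        case (elim x)
        show ?case
        proof
          assume x: "x \<in> D"
          then have xB: "x \<in> B" using DB by blast
          have Dr: "GDERIV (nose {p, q} z) x :> gn {p, q} z x" using elim(1) xB by blast
          have X: "{p, q} \<subseteq> B" "{p, q} \<subseteq> K" using pq by auto
          have less: "nose {p, q} z x < u x"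
            using nose_less_u[OF X(2) xB Dr, of p] nose_less_u[OF X(2) xB Dr, of q] x by (auto simp: D_def Dset_def)
          have off: "T y r < z" if "y \<in> sphere b R" "r \<in> {p, q}" for y r
            using that offp[of y] offq[of y] R' by auto
          obtain y where y: "y \<in> B" "gn {p, q} z x = G y" "\<forall>r\<in>{p, q}. T y r \<le> z" "\<exists>r\<in>{p, q}. T y r = z"
            using nose_gradient_tangent[OF X(1) _ off xB elim(2) Dr less] by blast
          \<comment> \<open>The supporting plane of the nose is a tangent plane of \<open>u\<close>
            through the higher-placed of its two tip values; the margin of \<open>H2\<close> then
            bounds \<open>F\<close> if the gradient is nearly perpendicular to
            \<open>d\<close>.\<close>
          have "max (T y p) (T y q) = z" using y(3,4) by (auto simp: max_def)
          then have "- e0 \<le> - \<bar>F (G y)\<bar>" if "\<bar>G y \<bullet> d\<bar> \<le> 2 * \<eta>"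
            using that \<eta>2 \<eta>(3) y(1) by (intro \<eta>2(2)) auto
          then show "F0 (gn {p, q} z x) \<le> e0" unfolding y(2) by (intro F0_up) simp
        qed
      qed
    qed
    have I0: "(LINT x:A|lebesgue. F0 (gu x)) \<le> I F0 + 2 * e0 * mB"
    proof -
      have "I F0 = (LINT x:D|lebesgue. F0 (gu x) - F0 (gn {p, q} z x))"
        unfolding I_def set_lebesgue_integral_def
      proof (rule integral_cong_AE)
        show "AE x in lebesgue. indicat_real B x *\<^sub>R (F0 (gu x) - F0 (gn {p, q} z x)) = indicat_real D x *\<^sub>R (F0 (gu x) - F0 (gn {p, q} z x))"
          using AE_gn[of "{p, q}" z]
        proof eventually_elim
          case (elim x)
          have "gn {p, q} z x = gu x" if "x \<in> B" "x \<notin> D"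
            using gn_eq_gu_off[of "{p, q}" z x] elim that pq by (auto simp: D_def)
          then show ?case using DB by (auto simp: indicator_def)
        qed
        show "(\<lambda>x. indicat_real B x *\<^sub>R (F0 (gu x) - F0 (gn {p, q} z x))) \<in> borel_measurable lebesgue"
          by (intro borel_measurable_scaleR borel_measurable_indicator borel_measurable_diff F_gu(1) F_gn(1) Fc rpq) simp
        show "(\<lambda>x. indicat_real D x *\<^sub>R (F0 (gu x) - F0 (gn {p, q} z x))) \<in> borel_measurable lebesgue"
          using Ds by (intro borel_measurable_scaleR borel_measurable_indicator borel_measurable_diff F_gu(1) F_gn(1) Fc rpq) simp
      qed
      also have "\<dots> = (LINT x:D|lebesgue. F0 (gu x)) - (LINT x:D|lebesgue. F0 (gn {p, q} z x))"
        using ifn[OF Fc(3) _ DB] Ds by (intro set_integral_diff) auto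
      finally have 1: "(LINT x:D|lebesgue. F0 (gu x)) = I F0 + (LINT x:D|lebesgue. F0 (gn {p, q} z x))" by simp
      have "(- e0) * measure lebesgue D \<le> (LINT x:D|lebesgue. - F0 (gn {p, q} z x))"
        using ifn(2)[OF Fc(3) _ DB] Ds up lms[OF Ds DB]
        by (intro set_integral_ge_AE) (auto simp: set_integrable_def)
      then have "(LINT x:D|lebesgue. F0 (gn {p, q} z x)) \<le> e0 * measure lebesgue D"
        by (simp add: set_lebesgue_integral_def)
      also have "\<dots> \<le> e0 * mB" using ml[OF Ds DB] e0 by (intro mult_left_mono) auto
      finally have 2: "(LINT x:D|lebesgue. F0 (gn {p, q} z x)) \<le> e0 * mB" .
      have DA: "D - A \<in> sets borel" "D - A \<subseteq> B" using Ds As DB by auto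
      have "(- e0) * mB \<le> (- e0) * measure lebesgue (D - A)" using ml[OF DA] e0 by (intro mult_left_mono_neg) auto
      also have "\<dots> \<le> (LINT x:D-A|lebesgue. F0 (gu x))"
        using ifn(1)[OF Fc(3) _ DA(2)] DA low DE lms[OF DA]
        by (intro set_integral_ge_AE AE_I2) auto
      finally have 3: "(- e0) * mB \<le> (LINT x:D-A|lebesgue. F0 (gu x))" .
      have "(LINT x:D|lebesgue. F0 (gu x)) = (LINT x:A|lebesgue. F0 (gu x)) + (LINT x:D-A|lebesgue. F0 (gu x))"
        by (rule split[OF AD Ds As(3) DB ifn(1)[OF Fc(3)]])
      then show ?thesis using 1 2 3 by simp
    qed
    define M where "M = {y\<in>B. u y < l \<and> u y < u (y + w) \<and> u y \<le> u (y - w)}"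
    have "norm w < R - R'" using nwt t by linarith
    note dm = discrete_minima_measure[OF w0 this, of l, folded M_def Q_def]
    have Ml: "M \<in> sets lebesgue" and M\<mu>: "\<mu> \<le> (4 * R / norm w + 1) * measure lebesgue M"
      using dm sub unfolding \<mu>_def by blast+
    have Mlow: "\<kappa>1 * s \<le> \<kappa> * measure lebesgue M"
    proof -
      have sd: "0 < s * norm d" "s * norm d \<le> 2 * R"
        using s d0 dR mult_mono[of s 1 "norm d" "2 * R"] by auto
      define v where "v = R / (s * norm d)"
      have "4 * R / norm w \<le> 4 * R / (s * norm d / 2)"
        using nw_low sd R by (intro divide_left_mono mult_pos_pos) auto
      then have v8: "4 * R / norm w \<le> 8 * v" by (simp add: v_def)
      have v4: "1 \<le> 4 * v" using sd R by (simp add: v_def pos_le_divide_eq)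
      have "4 * R / norm w + 1 \<le> 8 * v + 4 * v" by (rule add_mono[OF v8 v4])
      also have "\<dots> = 12 * R / (s * norm d)" by (simp add: v_def)
      finally have "4 * R / norm w + 1 \<le> 12 * R / (s * norm d)" .
      then have "\<mu> \<le> 12 * R / (s * norm d) * measure lebesgue M"
        using M\<mu> by (meson measure_nonneg mult_right_mono order_trans)
      then have "\<mu> * (s * norm d) \<le> 12 * R * measure lebesgue M"
        using sd by (simp add: pos_le_divide_eq)
      then have "\<mu> * norm d / (12 * R) * s \<le> measure lebesgue M"
        using R by (simp add: pos_divide_le_eq mult_ac)
      then have "\<kappa> * (\<mu> * norm d / (12 * R) * s) \<le> \<kappa> * measure lebesgue M" using \<kappa> by (intro mult_left_mono) auto
      then show ?thesis by (simp add: \<kappa>1_def mult.assoc)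
    qed
    have MB: "M \<subseteq> B" by (auto simp: M_def)
    have MK: "y \<in> K" "y + w \<in> K" "y - w \<in> K" "u y < l" if "y \<in> M" for y
    proof -
      show yK: "y \<in> K" and "u y < l" using that by (auto simp: M_def)
      then have "y \<in> ball b R'" using sub by blast
      then show "y + w \<in> K" "y - w \<in> K"
        using \<open>norm w < R - R'\<close> dist_triangle[of b "y + w" y] dist_triangle[of b "y - w" y] by (auto simp: dist_norm)
    qed
    \<comment> \<open>A discrete minimum violates what \<open>A1_char\<close> and
      \<open>A2_char\<close> say of points carried over, and it is visible because \<open>u\<close>
      is below \<open>l\<close> there.\<close>
    have M_sub_L: "M \<subseteq> L"
    proof
      fix y assume y: "y \<in> M"
      have "y \<in> Dset p z" using sub[OF MK(1,4)[OF y]] y MB by (auto simp: Dset_def)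
      then have "y \<in> Ed" using DE by (auto simp: D_def)
      moreover have "y \<notin> A1" using ch1(3)[of y] y by (auto simp: M_def)
      moreover have "y \<notin> A2" using ch2(3)[of y] y by (auto simp: M_def)
      ultimately show "y \<in> L" by (simp add: L_def A_def)
    qed
    \<comment> \<open>At a discrete minimum the slope along \<open>d\<close> changes sign between
      \<open>y - w\<close> and \<open>y + w\<close>, so it is small at \<open>y\<close>, where
      \<open>F0\<close> agrees with \<open>F\<close>.\<close>
    have MF: "\<kappa> \<le> F0 (gu y)" if y: "y \<in> M" for y
    proof -
      have uy: "u y < u (y + w)" "u (y - w + w) \<le> u (y - w)" using y by (auto simp: M_def)
      have "0 < G (y + w) \<bullet> d"
        using increase_imp_gradient_pos[OF MK(1,2)[OF y] uy(1)] Gw by simp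
      moreover have "G (y - w) \<bullet> d \<le> 0"
        using decrease_imp_gradient_nonpos[OF MK(3)[OF y] _ uy(2)] MK(1)[OF y] Gw by simp
      moreover have "dist (G (y + w) \<bullet> d) (G y \<bullet> d) \<le> \<eta> / 2" "dist (G (y - w) \<bullet> d) (G y \<bullet> d) \<le> \<eta> / 2"
        using close[OF MK(2,1)[OF y]] close[OF MK(3,1)[OF y]] nwt by (auto simp: dist_norm)
      ultimately have "\<bar>G y \<bullet> d\<bar> \<le> \<eta>" using \<eta>(1) unfolding dist_real_def by linarith
      then have "F0 (G y) = F (G y)" by (rule F0_eq)
      then show ?thesis using sub[OF MK(1,4)[OF y]] y MB by (auto simp: gu_def)
    qed
    have LL: "\<kappa>1 * s - e0 * (mB * 2 * s) \<le> (LINT x:L|lebesgue. F0 (gu x))"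
    proof -
      have LM: "L - M \<in> sets lebesgue" "L - M \<subseteq> B" using Ls Ml by auto
      have lmLM: "L - M \<in> lmeasurable" and lmM: "M \<in> lmeasurable"
        using LM Ml MB by (auto intro!: bounded_set_imp_lmeasurable bounded_subset[OF bounded_ball[of b R]])
      have "(LINT x:M \<union> (L - M)|lebesgue. F0 (gu x)) = (LINT x:M|lebesgue. F0 (gu x)) + (LINT x:L-M|lebesgue. F0 (gu x))"
        using ifn(1)[OF Fc(3) Ml MB] ifn(1)[OF Fc(3) LM] by (intro set_integral_Un) auto
      moreover have "M \<union> (L - M) = L" using M_sub_L by blast
      moreover have "\<kappa> * measure lebesgue M \<le> (LINT x:M|lebesgue. F0 (gu x))"
        using ifn(1)[OF Fc(3) Ml MB] lmM MF by (intro set_integral_ge_AE AE_I2) auto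
      moreover have "(- e0) * measure lebesgue (L - M) \<le> (LINT x:L-M|lebesgue. F0 (gu x))"
        using ifn(1)[OF Fc(3) LM] lmLM low by (intro set_integral_ge_AE AE_I2) (auto simp: L_def)
      moreover have "measure lebesgue (L - M) \<le> mB * 2 * s"
      proof -
        have "measure lebesgue (L - M) \<le> measure lebesgue L"
          by (rule measure_mono_fmeasurable[OF _ LM(1) lms[OF Ls]]) auto
        then show ?thesis using mL by linarith
      qed
      then have "(- e0) * (mB * 2 * s) \<le> (- e0) * measure lebesgue (L - M)" using e0 by (intro mult_left_mono_neg) auto
      ultimately show ?thesis using Mlow by simp
    qed
    have lin: "(LINT x:S|lebesgue. F (gu x)) = (LINT x:S|lebesgue. F1 (gu x)) + (LINT x:S|lebesgue. F2 (gu x)) + (LINT x:S|lebesgue. F0 (gu x))"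
      if "S \<in> sets borel" "S \<subseteq> B" for S
    proof -
      have Sl: "S \<in> sets lebesgue" using that by simp
      have "(LINT x:S|lebesgue. F (gu x)) = (LINT x:S|lebesgue. F1 (gu x) + F2 (gu x) + F0 (gu x))"
        using Sl by (intro set_lebesgue_integral_cong) (auto simp: Fsum)
      then show ?thesis using ifn(1)[OF Fc(1) Sl that(2)] ifn(1)[OF Fc(2) Sl that(2)] ifn(1)[OF Fc(3) Sl that(2)]
        by (simp add: set_integral_add)
    qed
    have L0: "(LINT x:Ed|lebesgue. F0 (gu x)) = (LINT x:A|lebesgue. F0 (gu x)) + (LINT x:L|lebesgue. F0 (gu x))"
      unfolding L_def using AD DE by (intro split[OF _ Eds As(3) EB ifn(1)[OF Fc(3)]]) auto
    have "(LINT x:B|lebesgue. F (grad (dila p q z s) x)) - (LINT x:B|lebesgue. F (gu x)) =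
      c * (LINT x:A|lebesgue. F (gu x)) - (LINT x:Ed|lebesgue. F (gu x))"
      using dila_energy(1)[OF s(1) pq(1,2) F] by (simp add: c_def A_def A1_def A2_def Ed_def Ep_def Eq_def)
    \<comment> \<open>For \<open>F0\<close> the integral over \<open>Ed\<close> is split into
      \<open>A\<close> and the gap, which leaves only the small factor \<open>c - 1\<close> before
      the integral over \<open>A\<close>.\<close>
    also have "\<dots> = (c * (LINT x:A|lebesgue. F1 (gu x)) - (LINT x:Ed|lebesgue. F1 (gu x)))
      + (c * (LINT x:A|lebesgue. F2 (gu x)) - (LINT x:Ed|lebesgue. F2 (gu x)))
      + ((c - 1) * (LINT x:A|lebesgue. F0 (gu x)) - (LINT x:L|lebesgue. F0 (gu x)))"
      unfolding lin[OF As(3) AB(1)] lin[OF Eds EB] L0 by (simp add: algebra_simps)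
    also have "\<dots> \<le> ((c - 1) * I F1 + e0 * s) + ((c - 1) * I F2 + e0 * s)
      + ((c - 1) * (I F0 + 2 * e0 * mB) - (\<kappa>1 * s - e0 * (mB * 2 * s)))"
    proof -
      have "(c - 1) * (LINT x:A|lebesgue. F0 (gu x)) \<le> (c - 1) * (I F0 + 2 * e0 * mB)"
        using I0 c by (intro mult_left_mono) auto
      then show ?thesis using L1 L2 LL by linarith
    qed
    also have "\<dots> = (c - 1) * I F + (2 * e0 * s + (c - 1) * (2 * e0 * mB) + e0 * (mB * 2 * s)) - \<kappa>1 * s"
      by (simp add: Isum algebra_simps)
    also have "\<dots> \<le> 0 + (2 * e0 * s + (3 * s) * (2 * e0 * mB) + e0 * (mB * 2 * s)) - \<kappa>1 * s"
      using IF c e0 mB by (intro diff_right_mono add_mono order_refl mult_right_mono) (auto simp: mult_nonneg_nonpos)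
    also have "\<dots> = (e0 * (2 + 8 * mB)) * s - \<kappa>1 * s" by (simp add: algebra_simps)
    also have "\<dots> < 0" unfolding e0eq using \<kappa>1 s by simp
    finally show "(LINT x:B|lebesgue. F (grad (dila p q z s) x)) < (LINT x:B|lebesgue. F (gu x))" by simp
  qed (fact s0)
qed

subsection \<open>Reduction to normalized data\<close>

text \<open>
  By \<open>integral_grad_difference_zero\<close>, adding an affine function to the integrand changes the
  energies of \<open>u\<close> and of the competitor by the same amount.
\<close>

lemma affine_invariance:
  fixes F f :: "'a \<Rightarrow> real"
  assumes k: "convex_on B k" and r: "r < R" and off: "\<And>x. x \<in> B - cball b r \<Longrightarrow> k x = u x"
    and M: "\<And>x. x \<in> B \<Longrightarrow> \<bar>k x - u x\<bar> \<le> M"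
    and F: "continuous_on UNIV F" and f: "\<And>\<xi>. f \<xi> = F \<xi> + (a + h \<bullet> \<xi>)"
    and i: "set_integrable lebesgue B (\<lambda>x. F (grad k x))"
    and less: "(LINT x:B|lebesgue. F (grad k x)) < (LINT x:B|lebesgue. F (gu x))"
  shows "set_integrable lebesgue B (\<lambda>x. f (grad k x))"
    and "(LINT x:B|lebesgue. f (grad k x)) < (LINT x:B|lebesgue. f (gu x))"
proof -
  obtain C where C: "\<And>x. x \<in> K \<Longrightarrow> \<bar>u x\<bar> \<le> C" using u_bounded by blast
  have cvB: "convex_on B u" using cv by (rule convex_on_subset) auto
  have bd: "\<bar>u x\<bar> \<le> \<bar>C\<bar> + \<bar>M\<bar>" "\<bar>k x\<bar> \<le> \<bar>C\<bar> + \<bar>M\<bar>" if "x \<in> B" for x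
    using C[of x] M[of x] that by auto
  have Z: "(LINT x:B|lebesgue. h \<bullet> (grad k x - grad u x)) = 0"
    "set_integrable lebesgue B (\<lambda>x. h \<bullet> (grad k x - grad u x))"
    using integral_grad_difference_zero[OF cvB k r off bd] by blast+
  have gr: "grad u x = gu x" if "x \<in> B" for x using that by (auto simp: gu_def intro!: grad_eqI G)
  have Z2: "set_integrable lebesgue B (\<lambda>x. h \<bullet> (grad k x - gu x))"
    using Z(2) by (rule set_integrable_cong[THEN iffD1, rotated -1]) (auto simp: gr)
  have Z1: "(LINT x:B|lebesgue. h \<bullet> (grad k x - gu x)) = 0"
    using Z(1) gr by (subst (asm) set_lebesgue_integral_cong[where g="\<lambda>x. h \<bullet> (grad k x - gu x)"]) auto
  have ca: "continuous_on UNIV (\<lambda>\<xi>. a + h \<bullet> \<xi>)" by (intro continuous_intros)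
  have ia: "set_integrable lebesgue B (\<lambda>x. a + h \<bullet> gu x)" by (rule F_gu(2)[OF ca]) auto
  have iF: "set_integrable lebesgue B (\<lambda>x. F (gu x))" by (rule F_gu(2)[OF F]) auto
  have eq: "(\<lambda>x. f (grad k x)) = (\<lambda>x. F (grad k x) + (a + h \<bullet> gu x) + h \<bullet> (grad k x - gu x))"
    by (simp add: f inner_simps)
  have i2: "set_integrable lebesgue B (\<lambda>x. F (grad k x) + (a + h \<bullet> gu x))"
    by (rule set_integral_add(1)[OF i ia])
  show "set_integrable lebesgue B (\<lambda>x. f (grad k x))"
    unfolding eq by (rule set_integral_add(1)[OF i2 Z2])
  have "(LINT x:B|lebesgue. f (grad k x)) = (LINT x:B|lebesgue. F (grad k x)) + (LINT x:B|lebesgue. a + h \<bullet> gu x)"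
    unfolding eq by (simp only: set_integral_add(2)[OF i2 Z2] set_integral_add(2)[OF i ia] Z1)
  also have "\<dots> < (LINT x:B|lebesgue. F (gu x)) + (LINT x:B|lebesgue. a + h \<bullet> gu x)" using less by simp
  also have "\<dots> = (LINT x:B|lebesgue. f (gu x))" by (simp add: f set_integral_add(2)[OF iF ia])
  finally show "(LINT x:B|lebesgue. f (grad k x)) < (LINT x:B|lebesgue. f (gu x))" .
qed

lemma compact_positive_lower_bound:
  fixes g :: "'a \<Rightarrow> real"
  assumes g: "continuous_on K g" and W: "closed W" and pos: "\<And>x. x \<in> K \<Longrightarrow> x \<in> W \<Longrightarrow> 0 < g x"
  obtains l where "l > 0" "\<And>x. x \<in> K \<Longrightarrow> x \<in> W \<Longrightarrow> l < g x"
proof (cases "K \<inter> W = {}")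
  case True show ?thesis 
  proof (rule that)
    show "(1::real) > 0" by simp
    show "1 < g x" if "x \<in> K" "x \<in> W" for x using that True by blast
  qed
next
  case False
  have "compact (K \<inter> W)" using W by (intro compact_Int_closed) auto
  then obtain x where x: "x \<in> K \<inter> W" "\<And>y. y \<in> K \<inter> W \<Longrightarrow> g x \<le> g y"
    using continuous_attains_inf[of "K \<inter> W" g] False continuous_on_subset[OF g] by blast
  show ?thesis
    by (rule that[of "g x / 2"]) (use pos[of x] x(1) x(2) in force)+
qed

text \<open>\<open>r\<close> is the largest slope for which the plane through \<open>(p, z)\<close>
  rising in direction \<open>e\<close> stays below \<open>u\<close>. It is finite because
  \<open>p\<close> is interior, and by compactness it could be increased if the plane did not
  touch.\<close>

lemma minimum_touching_slope:
  assumes p: "p \<in> B" and z: "\<And>x. x \<in> K \<Longrightarrow> z < u x" and e: "norm e = 1"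
  obtains r y where "r > 0" "y \<in> K" "\<And>x. x \<in> K \<Longrightarrow> z + r * (e \<bullet> (x - p)) \<le> u x"
    "z + r * (e \<bullet> (y - p)) = u y"
proof -
  have pK: "p \<in> K" using p by simp
  define S where "S = {r. \<forall>x\<in>K. z + r * (e \<bullet> (x - p)) \<le> u x}"
  define \<rho> where "\<rho> = R - dist b p"
  have \<rho>: "\<rho> > 0" using p by (simp add: \<rho>_def)
  have pe: "p + \<rho> *\<^sub>R e \<in> K"
    using dist_triangle[of b "p + \<rho> *\<^sub>R e" p] e \<rho> by (simp add: dist_norm \<rho>_def)
  have ee: "e \<bullet> e = 1" using e by (simp add: dot_square_norm)
  have up: "r \<le> (u (p + \<rho> *\<^sub>R e) - z) / \<rho>" if "r \<in> S" for r
  proof -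
    have "z + r * (e \<bullet> (p + \<rho> *\<^sub>R e - p)) \<le> u (p + \<rho> *\<^sub>R e)" using that pe unfolding S_def by blast
    then show ?thesis using \<rho> ee by (simp add: pos_le_divide_eq)
  qed
  then have bdd: "bdd_above S" by (rule bdd_aboveI)
  have cl: "closed S"
  proof -
    have "S = (\<Inter>x\<in>K. {r. z + r * (e \<bullet> (x - p)) \<le> u x})" by (auto simp: S_def)
    then show ?thesis by (auto intro!: closed_Collect_le continuous_intros)
  qed
  have S0: "0 \<in> S" using z by (auto simp: S_def less_imp_le)
  define r where "r = Sup S"
  have rS: "r \<in> S" unfolding r_def using S0 bdd cl by (intro closed_contains_Sup) auto
  have extend: "\<exists>r'\<in>S. r' > r1" if r1: "\<And>x. x \<in> K \<Longrightarrow> z + r1 * (e \<bullet> (x - p)) < u x" for r1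
  proof -
    obtain m where m: "m \<in> K" "\<And>x. x \<in> K \<Longrightarrow> u m - (z + r1 * (e \<bullet> (m - p))) \<le> u x - (z + r1 * (e \<bullet> (x - p)))"
    proof -
      have "continuous_on K (\<lambda>x. u x - (z + r1 * (e \<bullet> (x - p))))" by (intro continuous_intros u_cont)
      from continuous_attains_inf[OF compact_cball _ this] pK that show ?thesis by blast
    qed
    define c where "c = u m - (z + r1 * (e \<bullet> (m - p)))"
    have c: "c > 0" using r1[OF m(1)] by (simp add: c_def)
    \<comment> \<open>\<open>e \<bullet> (x - p)\<close> is at most the diameter, so this increment
      of the slope uses up no more than the gap \<open>c\<close>.\<close>
    define h where "h = c / (2 * R)"
    have h: "h > 0" "h * (2 * R) = c" using c R by (auto simp: h_def)
    have "r1 + h \<in> S"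
      unfolding S_def
    proof (intro CollectI ballI)
      fix x assume x: "x \<in> K"
      have "e \<bullet> (x - p) \<le> norm e * norm (x - p)" by (rule norm_cauchy_schwarz)
      also have "\<dots> \<le> 2 * R" using dist_K[OF x pK] e by (simp add: dist_norm)
      finally have "h * (e \<bullet> (x - p)) \<le> h * (2 * R)" using h by (intro mult_left_mono) auto
      then have "h * (e \<bullet> (x - p)) \<le> c" using h by simp
      then show "z + (r1 + h) * (e \<bullet> (x - p)) \<le> u x" using m(2)[OF x] by (simp add: c_def algebra_simps)
    qed
    then show ?thesis using h by (intro bexI[of _ "r1 + h"]) auto
  qed
  have "r > 0"
  proof -
    obtain r' where "r' \<in> S" "r' > 0" using extend[of 0] z by auto
    then show ?thesis using cSup_upper[OF _ bdd, of r'] by (simp add: r_def)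
  qed
  moreover have "\<exists>y\<in>K. z + r * (e \<bullet> (y - p)) = u y"
  proof (rule ccontr)
    assume n: "\<not> ?thesis"
    have "z + r * (e \<bullet> (x - p)) < u x" if "x \<in> K" for x
      using rS that n unfolding S_def by (metis (no_types, lifting) less_eq_real_def mem_Collect_eq)
    then obtain r' where "r' \<in> S" "r' > r" using extend by blast
    then show False using cSup_upper[OF _ bdd, of r'] by (simp add: r_def)
  qed
  ultimately show ?thesis using that rS unfolding S_def by blast
qed

end

section \<open>The two cases for normalized data\<close>

locale normalized_ball = C1_ball b R u G
  for b :: "'a::euclidean_space" and R u G +
  fixes m :: 'a
  assumes m: "m \<in> ball b R" "u m = 0" and u_nonneg: "\<And>x. x \<in> cball b R \<Longrightarrow> 0 \<le> u x"
    and u_sphere: "\<And>x. x \<in> sphere b R \<Longrightarrow> 0 < u x"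
begin

lemma mK: "m \<in> K" using m by simp

lemma G_zero: "x \<in> K \<Longrightarrow> u x = 0 \<Longrightarrow> G x = 0"
proof -
  assume x: "x \<in> K" "u x = 0"
  then have "x \<in> B" using u_sphere[of x] by (cases "dist b x = R") auto
  then show "G x = 0" using minorant_touch[of x 0 0] x u_nonneg by simp
qed

lemma zero_G: "x \<in> K \<Longrightarrow> G x = 0 \<Longrightarrow> u x = 0"
  using T_le[of x m] mK m(2) u_nonneg[of x] by (simp add: T_def)

text \<open>Otherwise the tangent plane at \<open>x\<close> would be a minorant touching at
  \<open>m\<close>, hence horizontal, and \<open>x\<close> would be a minimum too. Near the sphere
  this leaves room for a tip slightly below \<open>(m, 0)\<close> that no tangent plane passes
  above.\<close>

lemma T_m_neg:
  assumes "x \<in> K" "u x > 0"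
  shows "T x m < 0"
proof (rule ccontr)
  assume "\<not> ?thesis"
  then have T0: "T x m = 0" using T_le[OF assms(1) mK] m(2) by simp
  have "G x = G m"
  proof (rule minorant_touch[OF m(1), of 0])
    fix y assume y: "y \<in> K"
    have "0 + G x \<bullet> (y - m) = T x y - T x m" by (simp add: T_def inner_simps)
    then show "0 + G x \<bullet> (y - m) \<le> u y" using T_le[OF assms(1) y] T0 by simp
  qed (simp add: m)
  then show False using G_zero[OF mK m(2)] zero_G assms by auto
qed

lemma inner_radius:
  obtains R' where "0 < R'" "R' < R" "m \<in> ball b R'" "\<And>x. x \<in> K - ball b R' \<Longrightarrow> 0 < u x"
proof -
  define Z where "Z = {x\<in>K. u x \<le> 0}"
  have "compact Z"
  proof -
    have "closed (K \<inter> u -` {..0})" by (rule continuous_closed_preimage[OF u_cont]) auto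
    moreover have "K \<inter> u -` {..0} = Z" by (auto simp: Z_def)
    ultimately show ?thesis using bounded_subset[OF bounded_cball[of b R]] by (auto simp: compact_eq_bounded_closed Z_def)
  qed
  moreover have mZ: "m \<in> Z" using m by (simp add: Z_def)
  ultimately obtain x where x: "x \<in> Z" "\<And>y. y \<in> Z \<Longrightarrow> dist b y \<le> dist b x"
    using continuous_attains_sup[of Z "dist b"] continuous_on_dist[OF continuous_on_const continuous_on_id] by blast
  have "dist b x < R" using x(1) u_sphere[of x] unfolding Z_def by (cases "dist b x = R") auto
  then have d: "dist b x < (R + dist b x) / 2" "(R + dist b x) / 2 < R" by auto
  show ?thesis
  proof (rule that[of "(R + dist b x) / 2"])
    show "0 < (R + dist b x) / 2" using R by (simp add: add_pos_nonneg)
    show "m \<in> ball b ((R + dist b x) / 2)" using x(2)[OF mZ] d by simp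
    fix y assume y: "y \<in> K - ball b ((R + dist b x) / 2)"
    then have "y \<notin> Z" using x(2)[of y] d by auto
    then show "0 < u y" using y by (auto simp: Z_def)
  qed (use d in auto)
qed

text \<open>The competitor \<open>max u c\<close> replaces the gradients on a low sublevel set by 0,
  where \<open>F\<close> is minimal among the gradients in question. Strictness requires a nonempty
  open set with \<open>0 < u < c\<close>, which the intermediate value theorem provides.\<close>

lemma positive_case:
  fixes f :: "'a \<Rightarrow> real"
  assumes F: "continuous_on UNIV F" and f: "\<And>\<xi>. f \<xi> = F \<xi> + (a + h \<bullet> \<xi>)"
    and F0: "F 0 = 0" and Fpos: "\<And>x. x \<in> K \<Longrightarrow> G x \<noteq> 0 \<Longrightarrow> 0 < F (G x)" and \<epsilon>: "\<epsilon> > 0"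
  shows "\<exists>k r. r < R \<and> convex_on B k \<and> (\<forall>x\<in>B - cball b r. k x = u x) \<and> (\<forall>x\<in>B. \<bar>k x - u x\<bar> < \<epsilon>) \<and>
    set_integrable lebesgue B (\<lambda>x. f (grad k x)) \<and>
    (LINT x:B|lebesgue. f (grad k x)) < (LINT x:B|lebesgue. f (gu x))"
proof -
  obtain R' where R': "0 < R'" "R' < R" "m \<in> ball b R'" "\<And>x. x \<in> K - ball b R' \<Longrightarrow> 0 < u x"
    using inner_radius by blast
  obtain l where l: "l > 0" "\<And>x. x \<in> K \<Longrightarrow> x \<in> - ball b R' \<Longrightarrow> l < u x"
    by (rule compact_positive_lower_bound[OF u_cont, of "- ball b R'"]) (use R'(4) in auto)
  define c where "c = min l (\<epsilon> / 2)"
  have c: "0 < c" "c \<le> l" "c < \<epsilon>" using l \<epsilon> by (auto simp: c_def)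
  define k where "k x = max (u x) c" for x
  have cvB: "convex_on B u" using cv by (rule convex_on_subset) auto
  have kc: "convex_on B k"
  proof (rule convex_onI)
    fix t x y assume t: "0 < (t::real)" "t < 1" and xy: "x \<in> B" "y \<in> B"
    have "u ((1 - t) *\<^sub>R x + t *\<^sub>R y) \<le> (1 - t) * u x + t * u y"
      using convex_onD[OF cvB, of t x y] t xy by simp
    also have "\<dots> \<le> (1 - t) * k x + t * k y" using t by (intro add_mono mult_left_mono) (auto simp: k_def)
    finally have "u ((1 - t) *\<^sub>R x + t *\<^sub>R y) \<le> (1 - t) * k x + t * k y" .
    moreover have "(1 - t) * c + t * c \<le> (1 - t) * k x + t * k y"
      using t by (intro add_mono mult_left_mono) (auto simp: k_def)
    then have "c \<le> (1 - t) * k x + t * k y" by (simp add: algebra_simps)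
    ultimately show "k ((1 - t) *\<^sub>R x + t *\<^sub>R y) \<le> (1 - t) * k x + t * k y"
      unfolding k_def[of "(1 - t) *\<^sub>R x + t *\<^sub>R y"] by (rule max.boundedI)
  qed simp
  have koff: "k x = u x" if "x \<in> B - cball b R'" for x
  proof -
    have "l < u x" using that by (intro l(2)) auto
    then show ?thesis using c by (simp add: k_def)
  qed
  have kd: "\<bar>k x - u x\<bar> \<le> c" if "x \<in> B" for x using u_nonneg[of x] that c by (auto simp: k_def)
  have F0': "0 \<le> F (G x)" if "x \<in> K" for x using Fpos[OF that] F0 by (cases "G x = 0") auto
  have ae: "AE x in lebesgue. x \<in> B \<longrightarrow> u x \<noteq> c \<and> grad k x = (if u x < c then 0 else gu x)"
    using AE_differentiable_convex[OF kc open_ball bounded_ball]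
  proof eventually_elim
    case (elim x)
    show ?case
    proof
      assume x: "x \<in> B"
      then have D: "GDERIV k x :> grad k x" using elim by (intro GDERIV_grad) auto
      have xK: "x \<in> K" using x by simp
      have low: "grad k x = 0" if "u x \<le> c"
      proof -
        show ?thesis by (rule GDERIV_touching[OF D GDERIV_const[of c] open_UNIV]) (use that in \<open>auto simp: k_def\<close>)
      qed
      have high: "grad k x = G x" if "u x \<ge> c"
        by (rule GDERIV_touching[OF D G[OF xK] open_UNIV]) (use that in \<open>auto simp: k_def\<close>)
      \<comment> \<open>On this level set both \<open>u\<close> and the constant touch
        \<open>k\<close>, so differentiability of \<open>k\<close> would force
        \<open>G x = 0\<close>; the level set is therefore null.\<close>
      have "u x \<noteq> c"
      proof
        assume e: "u x = c"
        then have "G x = 0" using low high by simp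
        then show False using zero_G[OF xK] e c by simp
      qed
      moreover have "gu x = G x" using x by (simp add: gu_def)
      ultimately show "u x \<noteq> c \<and> grad k x = (if u x < c then 0 else gu x)"
        using low high by simp
    qed
  qed
  define \<phi> where "\<phi> x = (if x \<in> {x\<in>B. u x < c} then 0 else F (gu x))" for x
  have Uo: "open {x\<in>B. u x < c}" by (rule open_less_on_ball[OF u_cont continuous_on_const])
  have i\<phi>: "set_integrable lebesgue B \<phi>"
  proof -
    have "set_integrable lebesgue (B - {x\<in>B. u x < c}) (\<lambda>x. F (gu x))"
      using Uo by (intro F_gu(2)[OF F]) auto
    moreover have "(\<lambda>x. indicator (B - {x\<in>B. u x < c}) x *\<^sub>R F (gu x)) = (\<lambda>x. indicator B x *\<^sub>R \<phi> x)"
      by (auto simp: \<phi>_def indicator_def fun_eq_iff)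
    ultimately show ?thesis by (simp add: set_integrable_def)
  qed
  have ae2: "AE x in lebesgue. indicator B x *\<^sub>R F (grad k x) = indicator B x *\<^sub>R \<phi> x"
    using ae by eventually_elim (auto simp: \<phi>_def indicator_def F0)
  define w where "w x = (if x \<in> B then grad k x else 0)" for x
  have wm: "w \<in> borel_measurable lebesgue" unfolding w_def[abs_def] by (rule borel_measurable_grad[OF kc]) auto
  have Fb: "F \<in> borel_measurable borel" using F by (rule borel_measurable_continuous_onI)
  have km: "(\<lambda>x. indicator B x *\<^sub>R F (grad k x)) \<in> borel_measurable lebesgue"
  proof -
    have "(\<lambda>x. indicator B x *\<^sub>R F (w x)) \<in> borel_measurable lebesgue"
      using measurable_compose[OF wm Fb] by (intro borel_measurable_scaleR borel_measurable_indicator) auto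
    moreover have "(\<lambda>x. indicator B x *\<^sub>R F (w x)) = (\<lambda>x. indicator B x *\<^sub>R F (grad k x))"
      by (auto simp: w_def indicator_def fun_eq_iff)
    ultimately show ?thesis by simp
  qed
  have \<phi>m: "(\<lambda>x. indicator B x *\<^sub>R \<phi> x) \<in> borel_measurable lebesgue"
    using i\<phi> unfolding set_integrable_def by (rule borel_measurable_integrable)
  have i: "set_integrable lebesgue B (\<lambda>x. F (grad k x))"
    unfolding set_integrable_def
    by (rule integrable_cong_AE[THEN iffD2, OF km \<phi>m ae2]) (use i\<phi> in \<open>simp add: set_integrable_def\<close>)
  have eq: "(LINT x:B|lebesgue. F (grad k x)) = (LINT x:B|lebesgue. \<phi> x)"
    unfolding set_lebesgue_integral_def by (rule integral_cong_AE[OF km \<phi>m ae2])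
  have iF: "set_integrable lebesgue B (\<lambda>x. F (gu x))" by (rule F_gu(2)[OF F]) auto
  define V where "V = {x\<in>B. u x < c \<and> 0 < u x}"
  have Vo: "open V"
  proof -
    have "V = {x\<in>B. u x < c} \<inter> {x\<in>B. 0 < u x}" by (auto simp: V_def)
    then show ?thesis using Uo open_less_on_ball[OF continuous_on_const u_cont, of 0] by auto
  qed
  have V0: "V \<noteq> {}"
  proof -
    obtain i :: 'a where i: "i \<in> Basis" using nonempty_Basis by blast
    define y where "y = b + R *\<^sub>R i"
    have y: "y \<in> sphere b R" using i R by (simp add: y_def dist_norm)
    then have yK: "y \<in> K" by auto
    have uy: "c < u y" using l(2)[of y] yK y R' c by auto
    have "connected (u ` K)" by (intro connected_continuous_image u_cont) (simp add: convex_connected)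
    then have "{u m..u y} \<subseteq> u ` K" using mK yK by (intro connected_contains_Icc) auto
    moreover have "c / 2 \<in> {u m..u y}" using m uy c by auto
    ultimately obtain x where x: "x \<in> K" "u x = c / 2" by (metis (no_types, lifting) imageE subsetD)
    have "x \<in> ball b R'" using l(2)[of x] x c by force
    then have "x \<in> V" using x c R' by (simp add: V_def)
    then show ?thesis by blast
  qed
  have "(LINT x:B|lebesgue. \<phi> x) < (LINT x:B|lebesgue. F (gu x))"
  proof -
    have nn: "0 \<le> indicator B x *\<^sub>R (F (gu x) - \<phi> x)" for x
      using F0' by (auto simp: \<phi>_def indicator_def gu_def)
    have ii: "set_integrable lebesgue B (\<lambda>x. F (gu x) - \<phi> x)" by (rule set_integral_diff(1)[OF iF i\<phi>])
    have "0 \<le> (LINT x:B|lebesgue. F (gu x) - \<phi> x)"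
      unfolding set_lebesgue_integral_def using nn by (intro integral_nonneg_AE AE_I2) auto
    moreover have "(LINT x:B|lebesgue. F (gu x) - \<phi> x) \<noteq> 0"
    proof
      assume "(LINT x:B|lebesgue. F (gu x) - \<phi> x) = 0"
      then have "AE x in lebesgue. indicator B x *\<^sub>R (F (gu x) - \<phi> x) = 0"
        using ii nn by (subst (asm) set_lebesgue_integral_def, subst (asm) integral_nonneg_eq_0_iff_AE)
          (auto simp: set_integrable_def)
      then have "AE x in lebesgue. x \<notin> V"
      proof eventually_elim
        case (elim x)
        have "F (G x) > 0" if "x \<in> V"
          using that G_zero[of x] Fpos[of x] zero_G[of x] by (auto simp: V_def)
        then show ?case using elim by (auto simp: V_def \<phi>_def indicator_def gu_def)
      qed
      then have "negligible V"
        unfolding eventually_ae_filter_negligible by (auto elim: negligible_subset)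
      then show False using open_not_negligible[OF Vo V0] by blast
    qed
    ultimately show ?thesis using set_integral_diff(2)[OF iF i\<phi>] by simp
  qed
  then have "(LINT x:B|lebesgue. F (grad k x)) < (LINT x:B|lebesgue. F (gu x))" by (simp add: eq)
  note AI = affine_invariance[OF kc R'(2) koff kd F f i this]
  have "\<bar>k x - u x\<bar> < \<epsilon>" if "x \<in> B" for x using kd[OF that] c by simp
  then show ?thesis using AI kc koff R'(2) by blast
qed

text \<open>The tips sit at \<open>m\<close> and at a nearby point in direction \<open>d\<close>.
  Planes with gradient parallel to \<open>e\<close> have equal heights at the two, so what concerns
  them is checked at \<open>m\<close> alone. Along \<open>e\<close> the integrand is strictly
  concave, hence positive between \<open>- r' e\<close> and \<open>r e\<close> once its chord is
  subtracted.\<close>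

lemma negative_case:
  fixes f :: "'a \<Rightarrow> real"
  assumes dim: "DIM('a) = 2" and f: "continuous_on UNIV f"
    and e: "norm e = 1" and d: "norm d = 1" and perp: "\<And>\<xi>. \<xi> \<bullet> d = 0 \<Longrightarrow> \<xi> = (\<xi> \<bullet> e) *\<^sub>R e"
    and concave: "\<And>a b t. \<lbrakk>\<bar>a\<bar> \<le> r0; \<bar>b\<bar> \<le> r0; a \<noteq> b; 0 < t; t < 1\<rbrakk> \<Longrightarrow>
      (1 - t) * f (a *\<^sub>R e) + t * f (b *\<^sub>R e) < f (((1 - t) * a + t * b) *\<^sub>R e)"
    and Gr: "\<And>x. x \<in> K \<Longrightarrow> \<bar>G x \<bullet> e\<bar> \<le> r0" and \<epsilon>: "\<epsilon> > 0"
  shows "\<exists>k r. r < R \<and> convex_on B k \<and> (\<forall>x\<in>B - cball b r. k x = u x) \<and> (\<forall>x\<in>B. \<bar>k x - u x\<bar> < \<epsilon>) \<and>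
    set_integrable lebesgue B (\<lambda>x. f (grad k x)) \<and>
    (LINT x:B|lebesgue. f (grad k x)) < (LINT x:B|lebesgue. f (gu x))"
proof -
  have ee: "e \<bullet> e = 1" using e by (simp add: dot_square_norm)
  obtain R' where R': "0 < R'" "R' < R" "m \<in> ball b R'" "\<And>x. x \<in> K - ball b R' \<Longrightarrow> 0 < u x"
    using inner_radius by blast
  have cTm: "continuous_on K (\<lambda>x. - T x m)" by (intro continuous_intros T_cont)
  obtain \<tau> where \<tau>: "\<tau> > 0" "\<And>x. x \<in> K \<Longrightarrow> x \<in> - ball b R' \<Longrightarrow> \<tau> < - T x m"
    by (rule compact_positive_lower_bound[OF cTm, of "- ball b R'"]) (use R'(4) T_m_neg in auto)
  obtain M where M: "M > 0" "\<And>x. x \<in> K \<Longrightarrow> norm (G x) \<le> M" using G_bounded by blast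
  obtain \<rho> where \<rho>: "\<rho> > 0" "\<And>x y. x \<in> K \<Longrightarrow> y \<in> K \<Longrightarrow> dist x y < \<rho> \<Longrightarrow> dist (u x) (u y) \<le> \<epsilon> / 4"
    using uniform_modulus[OF u_cont, of "\<epsilon> / 4"] \<epsilon> by auto
  \<comment> \<open>The depth is at most half the margin \<tau> near the sphere, the other half
    being reserved for the shift from \<open>m\<close> to \<open>q\<close> through the choice of
    \<delta>, and at most \<open>\<epsilon> / 4\<close> for closeness.\<close>
  define z where "z = - min (\<tau> / 2) (\<epsilon> / 4)"
  have z: "z < 0" "- \<tau> / 2 \<le> z" "- \<epsilon> / 4 \<le> z" using \<tau> \<epsilon> by (auto simp: z_def)
  define \<delta> where "\<delta> = min (min (\<rho> / 2) ((R - R') / 2)) (\<tau> / (2 * M))"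
  have "\<delta> \<le> \<rho> / 2" "\<delta> \<le> (R - R') / 2" unfolding \<delta>_def by linarith+
  moreover have "\<delta> > 0" using \<rho> R' \<tau> M by (simp add: \<delta>_def)
  ultimately have \<delta>: "\<delta> > 0" "\<delta> < \<rho>" "\<delta> < R - R'" by auto
  have \<delta>M: "\<delta> * M \<le> \<tau> / 2"
  proof -
    have "\<delta> * M \<le> \<tau> / (2 * M) * M" using M by (intro mult_right_mono) (auto simp: \<delta>_def)
    then show ?thesis using M by simp
  qed
  define q where "q = m + \<delta> *\<^sub>R d"
  have mq: "dist m q = \<delta>" using \<delta> d by (simp add: q_def dist_norm)
  have qB: "q \<in> B" using dist_triangle[of b q m] mq R'(3) \<delta> by simp
  then have qK: "q \<in> K" by simp
  have qm: "q \<noteq> m" using mq \<delta> by auto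
  have neg: "negligible (convex hull {m, q})" by (rule negligible_convex_hull_pair[OF dim])
  have Tq: "T x q = T x m + \<delta> * (G x \<bullet> d)" for x by (simp add: T_def q_def inner_simps)
  have offm: "T x m < z" if "x \<in> K - ball b R'" for x
    using \<tau>(2)[of x] that z \<tau>(1) by auto
  have offq: "T x q < z" if "x \<in> K - ball b R'" for x
  proof -
    have xK: "x \<in> K" using that by blast
    have "G x \<bullet> d \<le> norm (G x) * norm d" by (rule norm_cauchy_schwarz)
    then have "G x \<bullet> d \<le> M" using M(2)[OF xK] d by simp
    then have "\<delta> * (G x \<bullet> d) \<le> \<delta> * M" using \<delta> by (intro mult_left_mono) auto
    then show ?thesis using Tq[of x] \<delta>M \<tau>(2)[of x] that z by auto
  qed
  have touching: "G y = D" if y: "y \<in> K" "\<And>w. w \<in> K \<Longrightarrow> z + D \<bullet> (w - m) \<le> u w" "z + D \<bullet> (y - m) = u y" for y D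
  proof -
    have e: "u y + D \<bullet> (w - y) = z + D \<bullet> (w - m)" for w using y(3) by (simp add: inner_simps)
    have le: "u y + D \<bullet> (w - y) \<le> u w" if "w \<in> K" for w using e y(2)[OF that] by simp
    have "z \<le> T y m" using minorant_le_tangent[OF y(1) mK le] e[of m] by simp
    then have "y \<in> ball b R'" using offm[of y] y(1) by fastforce
    then have "y \<in> B" using R' by simp
    then show ?thesis using minorant_touch[OF _ le refl] by simp
  qed
  have zu: "z < u x" if "x \<in> K" for x using z u_nonneg[OF that] by simp
  obtain r y1 where r: "r > 0" "y1 \<in> K" "\<And>x. x \<in> K \<Longrightarrow> z + r * (e \<bullet> (x - m)) \<le> u x" "z + r * (e \<bullet> (y1 - m)) = u y1"
    using minimum_touching_slope[OF m(1) zu e] by blast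
  have e': "norm (- e) = 1" using e by simp
  obtain r' y2 where r': "r' > 0" "y2 \<in> K" "\<And>x. x \<in> K \<Longrightarrow> z + r' * ((- e) \<bullet> (x - m)) \<le> u x" "z + r' * ((- e) \<bullet> (y2 - m)) = u y2"
    using minimum_touching_slope[OF m(1) zu e'] by blast
  have Gy1: "G y1 = r *\<^sub>R e" by (rule touching[OF r(2)]) (use r(3,4) in auto)
  have Gy2: "G y2 = (- r') *\<^sub>R e" by (rule touching[OF r'(2)]) (use r'(3,4) in auto)
  have r0: "r \<le> r0" "r' \<le> r0" using Gr[OF r(2)] Gr[OF r'(2)] r(1) r'(1) by (simp_all add: Gy1 Gy2 ee)
  \<comment> \<open>Slope of the chord of \<open>f\<close> between the gradients
    \<open>- r' e\<close> and \<open>r e\<close>; subtracting the chord makes \<open>F\<close>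
    vanish at both ends.\<close>
  define c where "c = (f (r *\<^sub>R e) - f ((- r') *\<^sub>R e)) / (r + r')"
  have rr: "r + r' > 0" using r(1) r'(1) by simp
  have c: "c * (r + r') = f (r *\<^sub>R e) - f ((- r') *\<^sub>R e)" using rr by (simp add: c_def)
  define F where "F \<xi> = f \<xi> - (f (r *\<^sub>R e) - c * r + (c *\<^sub>R e) \<bullet> \<xi>)" for \<xi>
  have fF: "f \<xi> = F \<xi> + ((f (r *\<^sub>R e) - c * r) + (c *\<^sub>R e) \<bullet> \<xi>)" for \<xi> by (simp add: F_def)
  have cF: "continuous_on UNIV F" unfolding F_def by (intro continuous_intros f)
  have Fe: "F (a *\<^sub>R e) = f (a *\<^sub>R e) - f (r *\<^sub>R e) + c * (r - a)" for a
    by (simp add: F_def ee algebra_simps)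
  have Fr: "F (r *\<^sub>R e) = 0" by (simp add: Fe)
  have Fr': "F ((- r') *\<^sub>R e) = 0" using c by (simp only: Fe diff_minus_eq_add)
  have Fpos: "0 < F (a *\<^sub>R e)" if a: "- r' < a" "a < r" for a
  proof -
    define t where "t = (a + r') / (r + r')"
    have t: "0 < t" "t < 1" using a rr by (auto simp: t_def)
    have tr: "t * (r + r') = a + r'" using rr by (simp add: t_def)
    have ta: "(1 - t) * (- r') + t * r = a" using tr by (simp add: algebra_simps)
    have "(1 - t) * f ((- r') *\<^sub>R e) + t * f (r *\<^sub>R e) < f (a *\<^sub>R e)"
      using concave[of "- r'" r t] r0 r(1) r'(1) t unfolding ta by simp
    moreover have "c * (r - a) = (1 - t) * (f (r *\<^sub>R e) - f ((- r') *\<^sub>R e))"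
    proof -
      have "r - a = (1 - t) * (r + r')" using tr by (simp add: algebra_simps)
      then have "c * (r - a) = (1 - t) * (c * (r + r'))" by simp
      then show ?thesis by (simp only: c)
    qed
    ultimately show ?thesis by (simp add: Fe algebra_simps)
  qed
  have s1: "e \<bullet> (y1 - m) > 0"
  proof (rule ccontr)
    assume "\<not> ?thesis"
    then have "r * (e \<bullet> (y1 - m)) \<le> 0" using r(1) by (simp add: mult_nonneg_nonpos)
    then show False using r(4) u_nonneg[OF r(2)] z by linarith
  qed
  have s2: "(- e) \<bullet> (y2 - m) > 0"
  proof (rule ccontr)
    assume "\<not> ?thesis"
    then have "r' * ((- e) \<bullet> (y2 - m)) \<le> 0" using r'(1) by (intro mult_nonneg_nonpos) auto
    then show False using r'(4) u_nonneg[OF r'(2)] z by linarith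
  qed
  \<comment> \<open>Comparison at the contact points \<open>y1\<close> and \<open>y2\<close> bounds
    the slope of a tangent plane not passing below \<open>(m, z)\<close>. If it passes through that
    point, the two extreme planes, lying below \<open>u\<close> at its foot \<open>y\<close>, leave
    only the end values.\<close>
  have range: "G y = (G y \<bullet> e) *\<^sub>R e \<and> - r' \<le> G y \<bullet> e \<and> G y \<bullet> e \<le> r \<and> (T y m = z \<longrightarrow> G y \<bullet> e = r \<or> G y \<bullet> e = - r')"
    if y: "y \<in> K" "G y \<bullet> d = 0" "z \<le> T y m" for y
  proof -
    define a where "a = G y \<bullet> e"
    have Gy: "G y = a *\<^sub>R e" unfolding a_def by (rule perp[OF y(2)])
    have Ty: "T y w = T y m + a * (e \<bullet> (w - m))" for w
      by (simp add: T_def Gy inner_simps algebra_simps)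
    have "a * (e \<bullet> (y1 - m)) \<le> r * (e \<bullet> (y1 - m))"
      using T_le[OF y(1) r(2)] r(4) y(3) unfolding Ty[of y1] by linarith
    then have ar: "a \<le> r" using s1 by simp
    have "(- a) * ((- e) \<bullet> (y2 - m)) \<le> r' * ((- e) \<bullet> (y2 - m))"
      using T_le[OF y(1) r'(2)] r'(4) y(3) unfolding Ty[of y2] by simp
    then have "- a \<le> r'" using s2 mult_le_cancel_right_pos[of "(- e) \<bullet> (y2 - m)"] by blast
    moreover have "a = r \<or> a = - r'" if Tz: "T y m = z"
    proof -
      have uy: "u y = z + a * (e \<bullet> (y - m))" using Ty[of y] Tz by simp
      consider "e \<bullet> (y - m) > 0" | "e \<bullet> (y - m) < 0" | "e \<bullet> (y - m) = 0" by linarith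
      then show ?thesis
      proof cases
        case 1
        have "r * (e \<bullet> (y - m)) \<le> a * (e \<bullet> (y - m))" using r(3)[OF y(1)] uy by simp
        then have "r \<le> a" using 1 by simp
        then show ?thesis using ar by simp
      next
        case 2
        have "r' * ((- e) \<bullet> (y - m)) \<le> (- a) * ((- e) \<bullet> (y - m))" using r'(3)[OF y(1)] uy by simp
        moreover have "(- e) \<bullet> (y - m) > 0" using 2 by simp
        ultimately have "r' \<le> - a" using mult_le_cancel_right_pos[of "(- e) \<bullet> (y - m)"] by blast
        then show ?thesis using \<open>- a \<le> r'\<close> by simp
      next
        case 3
        then show ?thesis using uy zu[OF y(1)] by simp
      qed
    qed
    ultimately show ?thesis using Gy ar unfolding a_def[symmetric] by auto
  qed
  have qmd: "G y \<bullet> d = 0" if "G y \<bullet> (q - m) = 0" for y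
    using that \<delta>(1) by (simp add: q_def)
  have H1: "0 \<le> F (G y)" if y: "y \<in> K" "G y \<bullet> (q - m) = 0" "z \<le> T y m" for y
  proof -
    define a where "a = G y \<bullet> e"
    have a: "G y = a *\<^sub>R e" "- r' \<le> a" "a \<le> r" using range[OF y(1) qmd[OF y(2)] y(3)] by (auto simp: a_def)
    show ?thesis unfolding a(1) using a(2,3) Fpos[of a] Fr Fr' by (cases "a = r"; cases "a = - r'") auto
  qed
  have H2: "F (G y) = 0" if y: "y \<in> K" "G y \<bullet> (q - m) = 0" "T y m = z" for y
  proof -
    define a where "a = G y \<bullet> e"
    have a: "G y = a *\<^sub>R e" "a = r \<or> a = - r'" using range[OF y(1) qmd[OF y(2)]] y(3) by (auto simp: a_def)
    show ?thesis unfolding a(1) using a(2) Fr Fr' by auto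
  qed
  \<comment> \<open>At \<open>m\<close> the gradient is 0 and \<open>F 0 = 2 \<kappa>\<close>, so
    \<kappa> remains a lower bound on a low sublevel set.\<close>
  define \<kappa> where "\<kappa> = F 0 / 2"
  have \<kappa>: "\<kappa> > 0" using Fpos[of 0] r(1) r'(1) by (simp add: \<kappa>_def)
  have F0: "F 0 = 2 * \<kappa>" by (simp add: \<kappa>_def)
  have cFG: "continuous_on K (\<lambda>y. F (G y))" by (intro continuous_on_compose2[OF cF Gc]) auto
  obtain l1 where l1: "l1 > 0" "\<And>x. x \<in> K \<Longrightarrow> x \<in> - ball b R' \<Longrightarrow> l1 < u x"
    by (rule compact_positive_lower_bound[OF u_cont, of "- ball b R'"]) (use R'(4) in auto)
  have upos: "0 < u y" if "y \<in> K" "T y m \<le> z \<or> F (G y) \<le> \<kappa>" for y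
  proof (rule ccontr)
    assume "\<not> 0 < u y"
    then have "u y = 0" using u_nonneg[OF that(1)] by simp
    moreover from this have "G y = 0" by (rule G_zero[OF that(1)])
    ultimately show False using that(2) z(1) F0 \<kappa> by (simp add: T_def)
  qed
  have W2: "closed (K \<inter> (\<lambda>x. T x m) -` {..z})" by (rule continuous_closed_preimage[OF T_cont]) auto
  obtain l2 where l2: "l2 > 0" "\<And>x. x \<in> K \<Longrightarrow> x \<in> K \<inter> (\<lambda>x. T x m) -` {..z} \<Longrightarrow> l2 < u x"
    by (rule compact_positive_lower_bound[OF u_cont W2]) (use upos in auto)
  have W3: "closed (K \<inter> (\<lambda>x. F (G x)) -` {..\<kappa>})" by (rule continuous_closed_preimage[OF cFG]) auto
  obtain l3 where l3: "l3 > 0" "\<And>x. x \<in> K \<Longrightarrow> x \<in> K \<inter> (\<lambda>x. F (G x)) -` {..\<kappa>} \<Longrightarrow> l3 < u x"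
    by (rule compact_positive_lower_bound[OF u_cont W3]) (use upos in auto)
  \<comment> \<open>Each of the three requirements in \<open>sub\<close> fails only on a compact set
    where \<open>u\<close> is positive; \<open>l1\<close>, \<open>l2\<close>, \<open>l3\<close> are
    lower bounds of \<open>u\<close> on these sets.\<close>
  define l where "l = min l1 (min l2 l3)"
  have sub: "y \<in> ball b R' \<and> z < T y m \<and> \<kappa> \<le> F (G y)" if y: "y \<in> K" "u y < l" for y
  proof -
    have "y \<in> ball b R'" using l1(2)[OF y(1)] y(2) by (force simp: l_def)
    moreover have "z < T y m" using l2(2)[OF y(1)] y by (force simp: l_def)
    moreover have "\<kappa> \<le> F (G y)" using l3(2)[OF y(1)] y by (force simp: l_def)
    ultimately show ?thesis by blast
  qed
  have ml: "u m < l" using m(2) l1(1) l2(1) l3(1) by (simp add: l_def)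
  have conclude: ?thesis
    if k: "convex_on B k" and rk: "rk < R" and off: "\<And>x. x \<in> B - cball b rk \<Longrightarrow> k x = u x"
      and close: "\<And>x. x \<in> B \<Longrightarrow> \<bar>k x - u x\<bar> \<le> \<epsilon> * (3 / 4)" and i: "set_integrable lebesgue B (\<lambda>x. F (grad k x))"
      and less: "(LINT x:B|lebesgue. F (grad k x)) < (LINT x:B|lebesgue. F (gu x))" for k rk
  proof -
    note AI = affine_invariance[OF k rk off close cF fF i less]
    have "\<bar>k x - u x\<bar> < \<epsilon>" if "x \<in> B" for x using close[OF that] \<epsilon> by linarith
    then show ?thesis using AI k off rk by blast
  qed
  have umq: "u q \<le> \<epsilon> / 4" using \<rho>(2)[OF mK qK] mq \<delta> m(2) by (simp add: dist_real_def)
  show ?thesis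
  proof (cases "(LINT x:B|lebesgue. F (gn {m, q} z x)) < (LINT x:B|lebesgue. F (gu x))")
    case True
    show ?thesis
    proof (rule conclude)
      show "convex_on B (nose {m, q} z)" by (rule convex_on_subset[OF nose_convex]) auto
      show "R' < R" by fact
      show "nose {m, q} z x = u x" if "x \<in> B - cball b R'" for x
        by (rule nose_eq_u) (use that offm[of x] offq[of x] in auto)
      show "\<bar>nose {m, q} z x - u x\<bar> \<le> \<epsilon> * (3 / 4)" if x: "x \<in> B" for x
      proof -
        have xK: "x \<in> K" using x by simp
        have "u x - \<epsilon> / 2 \<le> nose {m, q} z x"
          by (rule nose_lower[OF xK]) (use T_le[OF xK mK] T_le[OF xK qK] m(2) umq z(3) \<epsilon> in auto)
        then show ?thesis using nose_le_u[OF xK, of "{m, q}" z] \<epsilon> by simp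
      qed
      have "AE x in lebesgue. x \<in> B \<longrightarrow> gn {m, q} z x \<in> G ` B"
        by (rule AE_gn_range) (use m(1) qB offm offq R' neg in auto)
      then have "set_integrable lebesgue B (\<lambda>x. F (gn {m, q} z x))" by (intro F_gn(2)[OF cF]) auto
      then show "set_integrable lebesgue B (\<lambda>x. F (grad (nose {m, q} z) x))"
        by (rule set_integrable_cong[THEN iffD1, rotated -1]) (auto simp: gn_def)
      show "(LINT x:B|lebesgue. F (grad (nose {m, q} z) x)) < (LINT x:B|lebesgue. F (gu x))"
        using True by (simp only: set_integral_grad_in_B(1))
    qed
  next
    case False
    have "\<exists>s0>0. \<forall>s. 0 < s \<and> s < s0 \<longrightarrow>
      (LINT x:B|lebesgue. F (grad (dila m q z s) x)) < (LINT x:B|lebesgue. F (gu x))"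
      by (rule two_nose[OF dim m(1) qB qm[symmetric] R'(2) offm offq cF H1 H2 sub m(1) ml \<kappa>]) (use False in auto)
    then obtain s0 where s0: "s0 > 0" "\<And>s. 0 < s \<and> s < s0 \<Longrightarrow>
      (LINT x:B|lebesgue. F (grad (dila m q z s) x)) < (LINT x:B|lebesgue. F (gu x))" by blast
    obtain C where C: "C > 0" "\<And>x. x \<in> K \<Longrightarrow> \<bar>u x\<bar> \<le> C" using u_bounded by blast
    \<comment> \<open>The bounds keep \<open>s\<close> in the range given by
      \<open>two_nose\<close>, the displacement \<open>2 R s\<close> below \<rho> and
      \<open>R - R'\<close>, and the height \<open>s (C + \<bar>z\<bar>)\<close> within
      \<open>\<epsilon> / 4\<close>.\<close>
    define t where "t = min (min s0 (min \<rho> (R - R') / (2 * R))) (\<epsilon> / (4 * (C + \<bar>z\<bar>)))"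
    have Cz: "C + \<bar>z\<bar> > 0" using C by simp
    have t: "t > 0" using s0 \<rho> R' R Cz \<epsilon> by (simp add: t_def)
    define s where "s = t / 2"
    have "t \<le> s0" unfolding t_def by linarith
    then have s: "s > 0" "s < s0" using t by (auto simp: s_def)
    have "t \<le> min \<rho> (R - R') / (2 * R)" "t \<le> \<epsilon> / (4 * (C + \<bar>z\<bar>))" unfolding t_def by linarith+
    then have st: "s < min \<rho> (R - R') / (2 * R)" "s \<le> \<epsilon> / (4 * (C + \<bar>z\<bar>))" using t unfolding s_def by linarith+
    have sR: "2 * R * s < \<rho>" "2 * R * s < R - R'" using st(1) R by (auto simp: pos_less_divide_eq mult_ac)
    have sC: "s * (C + \<bar>z\<bar>) \<le> \<epsilon> / 4"
    proof -
      have "s * (C + \<bar>z\<bar>) \<le> \<epsilon> / (4 * (C + \<bar>z\<bar>)) * (C + \<bar>z\<bar>)" using st(2) Cz by (intro mult_right_mono) auto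
      also have "\<dots> = \<epsilon> / 4" using Cz by (simp add: field_simps)
      finally show ?thesis .
    qed
    \<comment> \<open>A cut-off point is at distance at most \<open>2 R s\<close> from a visible
      one, which lies in the ball of radius \<open>R'\<close>.\<close>
    define rk where "rk = R' + 2 * R * s"
    have homoff: "hom p z s x \<le> u x" if p: "p \<in> B" "\<And>x. x \<in> K - ball b R' \<Longrightarrow> T x p < z" and x: "x \<in> B - cball b rk" for p x
    proof (rule ccontr)
      assume "\<not> ?thesis"
      then have "x \<in> Ds p z s" using x by (simp add: Ds_def)
      then have c: "cen p s x \<in> Dset p z" using cen_Ds[OF s(1) p(1)] by blast
      then have "cen p s x \<in> K" by (auto simp: Dset_def)
      then have "dist b (cen p s x) < R'" using p(2)[of "cen p s x"] c by (force simp: Dset_def)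
      moreover have "dist (cen p s x) x \<le> 2 * R * s" using x p(1) by (intro dist_cen[OF s(1)]) auto
      ultimately show False using x dist_triangle[of b x "cen p s x"] by (simp add: rk_def)
    qed
    have homclose: "hom p z s x \<le> u x + \<epsilon> * (3 / 4)" if p: "p \<in> K" and x: "x \<in> K" for p x
    proof -
      have cK: "cen p s x \<in> K" using cen_in[OF s(1) convex_cball p x] .
      have "dist (cen p s x) x < \<rho>" using dist_cen[OF s(1) x p] sR by linarith
      then have "u (cen p s x) \<le> u x + \<epsilon> / 4" using \<rho>(2)[OF cK x] unfolding dist_real_def by linarith
      moreover have "s * u (cen p s x) - s * z \<le> \<epsilon> / 4"
      proof -
        have "u (cen p s x) - z \<le> C + \<bar>z\<bar>" using C(2)[OF cK] by simp
        then have "s * (u (cen p s x) - z) \<le> s * (C + \<bar>z\<bar>)" using s by (intro mult_left_mono) auto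
        then show ?thesis using sC by (simp add: algebra_simps)
      qed
      ultimately show ?thesis using \<epsilon> by (simp add: hom_def algebra_simps)
    qed
    show ?thesis
    proof (rule conclude)
      show "convex_on B (dila m q z s)" by (rule convex_on_subset[OF dila_convex[OF s(1) mK qK]]) auto
      show "rk < R" using sR by (simp add: rk_def)
      show "dila m q z s x = u x" if "x \<in> B - cball b rk" for x
        using homoff[OF m(1) offm that] homoff[OF qB offq that] by (simp add: dila_def)
      show "\<bar>dila m q z s x - u x\<bar> \<le> \<epsilon> * (3 / 4)" if "x \<in> B" for x
        using homclose[OF mK, of x] homclose[OF qK, of x] that \<epsilon> by (simp add: dila_def)
      show "set_integrable lebesgue B (\<lambda>x. F (grad (dila m q z s) x))" by (rule dila_energy(2)[OF s(1) m(1) qB cF])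
      show "(LINT x:B|lebesgue. F (grad (dila m q z s) x)) < (LINT x:B|lebesgue. F (gu x))" using s0(2) s by blast
    qed
  qed
qed

end

subsection \<open>Hessians\<close>

lemma C2_line_derivatives:
  assumes f: "C2 f"
  shows "((\<lambda>s. f (a + s *\<^sub>R v)) has_real_derivative grad f (a + t *\<^sub>R v) \<bullet> v) (at t)"
    and "((\<lambda>s. grad f (a + s *\<^sub>R v) \<bullet> w) has_real_derivative w \<bullet> (hessian f (a + t *\<^sub>R v) *v v)) (at t)"
proof -
  have l: "((\<lambda>s. a + s *\<^sub>R v) has_derivative (\<lambda>h. h *\<^sub>R v)) (at t)"
    by (auto intro!: derivative_eq_intros)
  have "(f has_derivative (\<lambda>h. h \<bullet> grad f (a + t *\<^sub>R v))) (at (a + t *\<^sub>R v))"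
    using f GDERIV_grad unfolding C2_def gderiv_def by blast
  from has_derivative_compose[OF l this]
  show "((\<lambda>s. f (a + s *\<^sub>R v)) has_real_derivative grad f (a + t *\<^sub>R v) \<bullet> v) (at t)"
    by (simp add: has_field_derivative_def inner_commute mult.commute[of _ "v \<bullet> _"])
  have "(grad f has_derivative (\<lambda>h. hessian f (a + t *\<^sub>R v) *v h)) (at (a + t *\<^sub>R v))"
    using f unfolding C2_def hessian_def jacobian_works by blast
  from has_derivative_inner_left[OF has_derivative_compose[OF l this], of w]
  show "((\<lambda>s. grad f (a + s *\<^sub>R v) \<bullet> w) has_real_derivative w \<bullet> (hessian f (a + t *\<^sub>R v) *v v)) (at t)"
    by (simp add: has_field_derivative_def inner_commute matrix_vector_mult_scaleR mult.commute[of _ "w \<bullet> _"])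
qed

text \<open>Joint continuity in base point and both vectors, packed as nested pairs so that
  arguments can be fixed or identified by composition.\<close>

lemma hessian_form_continuous:
  assumes "C2 f"
  shows "continuous_on UNIV (\<lambda>p. fst (snd p) \<bullet> (hessian f (fst p) *v snd (snd p)))"
proof -
  have c: "continuous_on UNIV (\<lambda>p::_ \<times> (_ \<times> _). hessian f (fst p))"
    using assms unfolding C2_def
    by (intro continuous_on_compose2[OF _ continuous_on_fst[OF continuous_on_id], of UNIV "hessian f"]) auto
  show ?thesis
    unfolding matrix_mult_dot inner_vec_def by (simp, intro continuous_intros c)
qed

text \<open>The mean value theorem twice, along \<open>v\<close> and then along
  \<open>w\<close>.\<close>

lemma second_difference:
  assumes f: "C2 f" and s: "s > 0"
  shows "\<exists>p\<in>cball a (s * (norm v + norm w)).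
    f (a + s *\<^sub>R v + s *\<^sub>R w) - f (a + s *\<^sub>R v) - f (a + s *\<^sub>R w) + f a = s\<^sup>2 * (v \<bullet> (hessian f p *v w))"
proof -
  have "\<exists>x>0. x < s \<and> (f (a + s *\<^sub>R w + s *\<^sub>R v) - f (a + s *\<^sub>R v)) - (f (a + s *\<^sub>R w + 0 *\<^sub>R v) - f (a + 0 *\<^sub>R v))
    = (s - 0) * (grad f (a + s *\<^sub>R w + x *\<^sub>R v) \<bullet> v - grad f (a + x *\<^sub>R v) \<bullet> v)"
    using s C2_line_derivatives(1)[OF f] by (intro MVT2) (auto intro!: derivative_eq_intros)
  then obtain x where x: "0 < x" "x < s" and X:
    "f (a + s *\<^sub>R w + s *\<^sub>R v) - f (a + s *\<^sub>R v) - f (a + s *\<^sub>R w) + f a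
      = s * (grad f (a + s *\<^sub>R w + x *\<^sub>R v) \<bullet> v - grad f (a + x *\<^sub>R v) \<bullet> v)" by (auto simp: algebra_simps)
  have "\<exists>y>0. y < s \<and> grad f (a + x *\<^sub>R v + s *\<^sub>R w) \<bullet> v - grad f (a + x *\<^sub>R v + 0 *\<^sub>R w) \<bullet> v
    = (s - 0) * (v \<bullet> (hessian f (a + x *\<^sub>R v + y *\<^sub>R w) *v w))"
    using s C2_line_derivatives(2)[OF f] by (intro MVT2) auto
  then obtain y where y: "0 < y" "y < s" and Y: "grad f (a + s *\<^sub>R w + x *\<^sub>R v) \<bullet> v - grad f (a + x *\<^sub>R v) \<bullet> v
    = s * (v \<bullet> (hessian f (a + x *\<^sub>R v + y *\<^sub>R w) *v w))" by (auto simp: algebra_simps)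
  have "norm (x *\<^sub>R v + y *\<^sub>R w) \<le> x * norm v + y * norm w"
    using norm_triangle_ineq[of "x *\<^sub>R v" "y *\<^sub>R w"] x y by simp
  also have "\<dots> \<le> s * norm v + s * norm w" using x y by (intro add_mono mult_right_mono) auto
  also have "norm (x *\<^sub>R v + y *\<^sub>R w) = dist a (a + x *\<^sub>R v + y *\<^sub>R w)"
  proof -
    have "a - (a + x *\<^sub>R v + y *\<^sub>R w) = - (x *\<^sub>R v + y *\<^sub>R w)" by simp
    then show ?thesis by (simp only: dist_norm norm_minus_cancel)
  qed
  finally have "a + x *\<^sub>R v + y *\<^sub>R w \<in> cball a (s * (norm v + norm w))"
    by (simp add: distrib_left)
  moreover have "f (a + s *\<^sub>R v + s *\<^sub>R w) = f (a + s *\<^sub>R w + s *\<^sub>R v)" by (simp add: algebra_simps)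
  ultimately show ?thesis using X unfolding Y by (auto simp: power2_eq_square)
qed

text \<open>The second difference is symmetric in \<open>v\<close> and \<open>w\<close>. Evaluating
  it in both orders with steps tending to 0 gives the claim by continuity; symmetry is not built
  into \<open>hessian\<close>, the Jacobian of the gradient.\<close>

lemma hessian_symmetric:
  assumes f: "C2 f"
  shows "v \<bullet> (hessian f a *v w) = w \<bullet> (hessian f a *v v)"
proof -
  define s where "s n = 1 / real (Suc n)" for n
  have s: "s n > 0" for n by (simp add: s_def)
  have slim: "(\<lambda>n. s n * (norm v + norm w)) \<longlonglongrightarrow> 0"
    unfolding s_def using tendsto_mult_left_zero[OF LIMSEQ_inverse_real_of_nat, of "norm v + norm w"]
    by (simp add: inverse_eq_divide)
  have "\<forall>n. \<exists>p\<in>cball a (s n * (norm v + norm w)). \<exists>p'\<in>cball a (s n * (norm w + norm v)).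
    v \<bullet> (hessian f p *v w) = w \<bullet> (hessian f p' *v v)"
  proof
    fix n
    obtain p where p: "p \<in> cball a (s n * (norm v + norm w))"
      "f (a + s n *\<^sub>R v + s n *\<^sub>R w) - f (a + s n *\<^sub>R v) - f (a + s n *\<^sub>R w) + f a = (s n)\<^sup>2 * (v \<bullet> (hessian f p *v w))"
      using second_difference[OF f s] by blast
    obtain p' where p': "p' \<in> cball a (s n * (norm w + norm v))"
      "f (a + s n *\<^sub>R w + s n *\<^sub>R v) - f (a + s n *\<^sub>R w) - f (a + s n *\<^sub>R v) + f a = (s n)\<^sup>2 * (w \<bullet> (hessian f p' *v v))"
      using second_difference[OF f s] by blast
    have "f (a + s n *\<^sub>R v + s n *\<^sub>R w) = f (a + s n *\<^sub>R w + s n *\<^sub>R v)" by (simp add: add_ac)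
    then have "(s n)\<^sup>2 * (v \<bullet> (hessian f p *v w)) = (s n)\<^sup>2 * (w \<bullet> (hessian f p' *v v))"
      using p(2) p'(2) by linarith
    moreover have "(s n)\<^sup>2 \<noteq> 0" using s[of n] by simp
    ultimately have "v \<bullet> (hessian f p *v w) = w \<bullet> (hessian f p' *v v)" by (rule mult_left_cancel[THEN iffD1, rotated])
    then show "\<exists>p\<in>cball a (s n * (norm v + norm w)). \<exists>p'\<in>cball a (s n * (norm w + norm v)).
      v \<bullet> (hessian f p *v w) = w \<bullet> (hessian f p' *v v)" using p(1) p'(1) by blast
  qed
  then obtain p p' where p: "\<And>n. dist a (p n) \<le> s n * (norm v + norm w)" "\<And>n. dist a (p' n) \<le> s n * (norm w + norm v)"
    and eq: "\<And>n. v \<bullet> (hessian f (p n) *v w) = w \<bullet> (hessian f (p' n) *v v)"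
    unfolding Bex_def mem_cball by metis
  have lim: "(\<lambda>n. x \<bullet> (hessian f (q n) *v y)) \<longlonglongrightarrow> x \<bullet> (hessian f a *v y)"
    if "\<And>n. dist a (q n) \<le> s n * (norm v + norm w)" for q x y
  proof -
    have "(\<lambda>n. dist (q n) a) \<longlonglongrightarrow> 0"
      by (rule tendsto_sandwich[OF _ _ tendsto_const slim]) (use that in \<open>auto simp: dist_commute\<close>)
    then have "q \<longlonglongrightarrow> a" by (rule tendsto_dist_iff[THEN iffD2])
    then have "(\<lambda>n. (q n, x, y)) \<longlonglongrightarrow> (a, x, y)" by (intro tendsto_intros)
    from continuous_on_tendsto_compose[OF hessian_form_continuous[OF f] this]
    show ?thesis by simp
  qed
  have "(\<lambda>n. v \<bullet> (hessian f (p n) *v w)) \<longlonglongrightarrow> v \<bullet> (hessian f a *v w)" by (rule lim[OF p(1)])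
  moreover have "(\<lambda>n. v \<bullet> (hessian f (p n) *v w)) \<longlonglongrightarrow> w \<bullet> (hessian f a *v v)"
    unfolding eq by (rule lim) (use p(2) in \<open>simp add: add.commute\<close>)
  ultimately show ?thesis by (rule LIMSEQ_unique)
qed

text \<open>Eigenvectors for distinct eigenvalues are orthogonal. Finiteness is what gives
  \<open>Min\<close> in \<open>smallest_eigenvalue\<close> its meaning.\<close>

lemma finite_eigenvalues_symmetric:
  fixes A :: "real^'n^'n"
  assumes sym: "\<And>v w. v \<bullet> (A *v w) = w \<bullet> (A *v v)"
  shows "finite (eigenvalues A)"
proof -
  define g where "g k = (SOME v. v \<noteq> 0 \<and> A *v v = k *\<^sub>R v)" for k
  have g: "g k \<noteq> 0" "A *v g k = k *\<^sub>R g k" if "k \<in> eigenvalues A" for k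
    using someI_ex[of "\<lambda>v. v \<noteq> 0 \<and> A *v v = k *\<^sub>R v"] that unfolding g_def eigenvalues_def by auto
  have orth: "g k \<bullet> g l = 0" if "k \<in> eigenvalues A" "l \<in> eigenvalues A" "k \<noteq> l" for k l
    using sym[of "g k" "g l"] that by (simp add: g inner_commute)
  then have "pairwise orthogonal (g ` eigenvalues A)" by (auto simp: pairwise_def orthogonal_def)
  then have "finite (g ` eigenvalues A)" by (rule pairwise_orthogonal_imp_finite)
  moreover have "inj_on g (eigenvalues A)"
  proof (rule inj_onI, rule ccontr)
    fix k l assume "k \<in> eigenvalues A" "l \<in> eigenvalues A" "g k = g l" "k \<noteq> l"
    then show False using orth[of k l] g(1)[of k] by simp
  qed
  ultimately show ?thesis using finite_imageD by blast
qed

text \<open>A nonnegative symmetric form that vanishes at some \<open>v \<noteq> 0\<close> has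
  \<open>v\<close> in its kernel, so that 0 would be the smallest eigenvalue.\<close>

lemma negative_or_positive_definite:
  fixes A :: "real^'n^'n"
  assumes sym: "\<And>v w. v \<bullet> (A *v w) = w \<bullet> (A *v v)" and ne: "smallest_eigenvalue A \<noteq> 0"
  shows "(\<exists>e. norm e = 1 \<and> e \<bullet> (A *v e) < 0) \<or> (\<forall>v. v \<noteq> 0 \<longrightarrow> 0 < v \<bullet> (A *v v))"
proof (rule ccontr)
  assume n: "\<not> ?thesis"
  have nonneg: "0 \<le> v \<bullet> (A *v v)" for v
  proof (cases "v = 0")
    case False
    have "0 \<le> (v /\<^sub>R norm v) \<bullet> (A *v (v /\<^sub>R norm v))"
    proof (rule ccontr)
      assume "\<not> ?thesis"
      moreover have "norm (v /\<^sub>R norm v) = 1" using False by simp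
      ultimately show False using n not_le by blast
    qed
    then show ?thesis using False by (simp add: matrix_vector_mult_scaleR zero_le_mult_iff)
  qed simp
  obtain v where v: "v \<noteq> 0" "v \<bullet> (A *v v) \<le> 0" using n by force
  then have v0: "v \<bullet> (A *v v) = 0" using nonneg[of v] by simp
  have "A *v v = 0"
  proof (rule ccontr)
    assume nz: "A *v v \<noteq> 0"
    define w where "w = A *v v"
    define c where "c = w \<bullet> (A *v w)"
    have c: "c \<ge> 0" unfolding c_def by (rule nonneg)
    have ww: "w \<bullet> w > 0" using nz by (simp add: w_def)
    \<comment> \<open>Nearly the minimiser of the quadratic polynomial in \<open>t\<close> below;
      the \<open>+ 1\<close> keeps the denominator positive.\<close>
    define t where "t = (w \<bullet> w) / (c + 1)"
    have t: "t > 0" "t * (c + 1) = w \<bullet> w" using c ww by (auto simp: t_def)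
    have "0 \<le> (v - t *\<^sub>R w) \<bullet> (A *v (v - t *\<^sub>R w))" by (rule nonneg)
    also have "\<dots> = v \<bullet> (A *v v) - t * (w \<bullet> (A *v v)) - t * (v \<bullet> (A *v w)) + t * t * (w \<bullet> (A *v w))"
      by (simp add: matrix_vector_mult_diff_distrib matrix_vector_mult_scaleR inner_simps algebra_simps)
    also have "\<dots> = t * (t * c - 2 * (w \<bullet> w))"
      using v0 sym[of v w] by (simp add: c_def w_def algebra_simps)
    finally have "0 \<le> t * c - 2 * (w \<bullet> w)" using t(1) by (simp add: zero_le_mult_iff)
    moreover have "t * c = w \<bullet> w - t" using t(2) by (simp add: algebra_simps)
    ultimately show False using t(1) ww by simp
  qed
  then have "0 \<in> eigenvalues A" using v(1) by (auto simp: eigenvalues_def)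
  moreover have "0 \<le> k" if k: "k \<in> eigenvalues A" for k
  proof -
    obtain w where w: "w \<noteq> 0" "A *v w = k *\<^sub>R w" using k unfolding eigenvalues_def by blast
    then have "0 \<le> k * (w \<bullet> w)" using nonneg[of w] by simp
    moreover have "w \<bullet> w > 0" using w by simp
    ultimately show ?thesis by (simp add: zero_le_mult_iff)
  qed
  ultimately have "Min (eigenvalues A) = 0"
    using finite_eigenvalues_symmetric[OF sym] by (intro Min_eqI) auto
  then show False using ne by (simp add: smallest_eigenvalue_def)
qed

text \<open>Unit vectors suffice by homogeneity. The pairs of a base point within distance 1 of
  \<open>a\<close> and a unit vector at which the form is not positive make up a compact set, so
  their base points keep a positive distance from \<open>a\<close>.\<close>

lemma positive_definite_near:
  fixes f :: "real^'n \<Rightarrow> real"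
  assumes f: "C2 f" and pd: "\<And>v. v \<noteq> 0 \<Longrightarrow> 0 < v \<bullet> (hessian f a *v v)"
  obtains \<eta> where "\<eta> > 0" "\<And>x v. x \<in> cball a \<eta> \<Longrightarrow> v \<noteq> 0 \<Longrightarrow> 0 < v \<bullet> (hessian f x *v v)"
proof -
  define Q :: "(real^'n) \<times> (real^'n) \<Rightarrow> real" where "Q p = snd p \<bullet> (hessian f (fst p) *v snd p)" for p
  have "continuous_on UNIV (\<lambda>p::(real^'n) \<times> (real^'n). (fst p, snd p, snd p))" by (intro continuous_intros)
  from continuous_on_compose2[OF hessian_form_continuous[OF f] this]
  have Qc: "continuous_on UNIV Q" by (simp add: Q_def[abs_def])
  define S where "S = (cball a 1 \<times> sphere 0 1) \<inter> Q -` {..0}"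
  have S: "compact S"
    unfolding S_def by (intro compact_Int_closed compact_Times closed_vimage) (use Qc in \<open>auto simp: continuous_on_eq_continuous_at\<close>)
  have scale: "0 < v \<bullet> (hessian f x *v v)" if "v \<noteq> 0" "0 < Q (x, v /\<^sub>R norm v)" for x v
    using that by (simp add: Q_def matrix_vector_mult_scaleR zero_less_mult_iff)
  have outS: "0 < Q p" if "p \<in> cball a 1 \<times> sphere 0 1" "p \<notin> S" for p
  proof (rule ccontr)
    assume "\<not> ?thesis"
    then have "p \<in> Q -` {..0}" by simp
    then show False using that unfolding S_def by blast
  qed
  show ?thesis
  proof (cases "S = {}")
    case True
    show ?thesis
    proof (rule that)
      show "(1::real) > 0" by simp
      fix x v assume xv: "x \<in> cball a 1" "v \<noteq> (0::real^'n)"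
      then have "(x, v /\<^sub>R norm v) \<in> cball a 1 \<times> sphere 0 1" by simp
      then have "0 < Q (x, v /\<^sub>R norm v)" using True by (intro outS) auto
      then show "0 < v \<bullet> (hessian f x *v v)" by (rule scale[OF xv(2)])
    qed
  next
    case False
    have "continuous_on S (\<lambda>p. dist a (fst p))" by (intro continuous_intros)
    from continuous_attains_inf[OF S False this]
    obtain p where p: "p \<in> S" "\<And>p'. p' \<in> S \<Longrightarrow> dist a (fst p) \<le> dist a (fst p')" by blast
    have "fst p \<noteq> a"
    proof
      assume "fst p = a"
      moreover have "snd p \<noteq> 0" "Q p \<le> 0" using p(1) by (auto simp: S_def)
      ultimately show False using pd[of "snd p"] by (simp add: Q_def)
    qed
    show ?thesis
    proof (rule that)
      show "min 1 (dist a (fst p) / 2) > 0" using \<open>fst p \<noteq> a\<close> by simp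
      fix x v assume x: "x \<in> cball a (min 1 (dist a (fst p) / 2))" and v: "v \<noteq> (0::real^'n)"
      have "dist a x < dist a (fst p)" 
      proof -
        have "dist a x \<le> dist a (fst p) / 2" using x by simp
        moreover have "dist a (fst p) > 0" using \<open>fst p \<noteq> a\<close> by simp
        ultimately show ?thesis by linarith
      qed
      then have "(x, v /\<^sub>R norm v) \<notin> S" using p(2)[of "(x, v /\<^sub>R norm v)"] by auto
      moreover have "(x, v /\<^sub>R norm v) \<in> cball a 1 \<times> sphere 0 1" using x v by simp
      ultimately have "0 < Q (x, v /\<^sub>R norm v)" by (intro outS)
      then show "0 < v \<bullet> (hessian f x *v v)" by (rule scale[OF v])
    qed
  qed
qed

lemma negative_near:
  assumes f: "C2 f" and neg: "e \<bullet> (hessian f a *v e) < 0"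
  obtains \<eta> where "\<eta> > 0" "\<And>x. x \<in> cball a \<eta> \<Longrightarrow> e \<bullet> (hessian f x *v e) < 0"
proof -
  have "continuous_on UNIV (\<lambda>x. (x, e, e))" by (intro continuous_intros)
  from continuous_on_compose2[OF hessian_form_continuous[OF f] this]
  have "continuous_on UNIV (\<lambda>x. e \<bullet> (hessian f x *v e))" by simp
  then have "open {x. e \<bullet> (hessian f x *v e) < 0}" by (rule open_Collect_less[OF _ continuous_on_const])
  then obtain \<eta> where "\<eta> > 0" "cball a \<eta> \<subseteq> {x. e \<bullet> (hessian f x *v e) < 0}"
    using neg unfolding open_contains_cball by blast
  then show ?thesis using that by blast
qed

lemma strictly_above_tangent:
  assumes f: "C2 f" and pd: "\<And>x v. x \<in> cball a \<eta> \<Longrightarrow> v \<noteq> 0 \<Longrightarrow> 0 < v \<bullet> (hessian f x *v v)"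
    and x: "x \<in> cball a \<eta>" "y \<in> cball a \<eta>" "x \<noteq> y"
  shows "f x + grad f x \<bullet> (y - x) < f y"
proof -
  define v where "v = y - x"
  have v: "v \<noteq> 0" using x by (simp add: v_def)
  have "\<exists>s>0. s < 1 \<and> f (x + 1 *\<^sub>R v) - f (x + 0 *\<^sub>R v) = (1 - 0) * (grad f (x + s *\<^sub>R v) \<bullet> v)"
    using C2_line_derivatives(1)[OF f] by (intro MVT2) auto
  then obtain s where s: "0 < s" "s < 1" "f y - f x = grad f (x + s *\<^sub>R v) \<bullet> v" by (auto simp: v_def)
  have "\<exists>t>0. t < s \<and> grad f (x + s *\<^sub>R v) \<bullet> v - grad f (x + 0 *\<^sub>R v) \<bullet> v = (s - 0) * (v \<bullet> (hessian f (x + t *\<^sub>R v) *v v))"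
    using C2_line_derivatives(2)[OF f] s by (intro MVT2) auto
  then obtain t where t: "0 < t" "t < s"
    "grad f (x + s *\<^sub>R v) \<bullet> v - grad f x \<bullet> v = s * (v \<bullet> (hessian f (x + t *\<^sub>R v) *v v))" by auto
  have "x + t *\<^sub>R v = (1 - t) *\<^sub>R x + t *\<^sub>R y" by (simp add: v_def algebra_simps)
  also have "\<dots> \<in> cball a \<eta>" using x s t by (intro convexD) auto
  finally have "0 < s * (v \<bullet> (hessian f (x + t *\<^sub>R v) *v v))" using pd v s by simp
  then show ?thesis using s(3) t(3) by (simp add: v_def)
qed

lemma strictly_concave_along:
  assumes f: "C2 f" and neg: "\<And>s. \<bar>s\<bar> \<le> r0 \<Longrightarrow> e \<bullet> (hessian f (x + s *\<^sub>R e) *v e) < 0"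
    and ab: "\<bar>a\<bar> \<le> r0" "\<bar>b\<bar> \<le> r0" "a < b" and t: "0 < t" "t < 1"
  shows "(1 - t) * f (x + a *\<^sub>R e) + t * f (x + b *\<^sub>R e) < f (x + ((1 - t) * a + t * b) *\<^sub>R e)"
proof -
  define c where "c = (1 - t) * a + t * b"
  have ca: "c - a = t * (b - a)" and bc: "b - c = (1 - t) * (b - a)" by (simp_all add: c_def algebra_simps)
  have c: "a < c" "c < b" 
  proof -
    have "0 < c - a" "0 < b - c" unfolding ca bc using t ab(3) by simp_all
    then show "a < c" "c < b" by simp_all
  qed
  define \<phi> where "\<phi> s = f (x + s *\<^sub>R e)" for s
  define \<phi>' where "\<phi>' s = grad f (x + s *\<^sub>R e) \<bullet> e" for s
  have D: "(\<phi> has_real_derivative \<phi>' s) (at s)" "(\<phi>' has_real_derivative e \<bullet> (hessian f (x + s *\<^sub>R e) *v e)) (at s)" for s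
    using C2_line_derivatives[OF f] unfolding \<phi>_def[abs_def] \<phi>'_def[abs_def] by blast+
  obtain x1 where x1: "a < x1" "x1 < c" "\<phi> c - \<phi> a = (c - a) * \<phi>' x1"
    using MVT2[OF c(1), of \<phi> \<phi>'] D(1) by blast
  obtain x2 where x2: "c < x2" "x2 < b" "\<phi> b - \<phi> c = (b - c) * \<phi>' x2"
    using MVT2[OF c(2), of \<phi> \<phi>'] D(1) by blast
  obtain x3 where x3: "x1 < x3" "x3 < x2" "\<phi>' x2 - \<phi>' x1 = (x2 - x1) * (e \<bullet> (hessian f (x + x3 *\<^sub>R e) *v e))"
    using MVT2[of x1 x2 \<phi>' "\<lambda>s. e \<bullet> (hessian f (x + s *\<^sub>R e) *v e)"] D(2) x1 x2 by force
  have "\<bar>x3\<bar> \<le> r0" using x1 x2 x3 ab by auto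
  then have "(x2 - x1) * (e \<bullet> (hessian f (x + x3 *\<^sub>R e) *v e)) < 0"
    using neg x1 x2 by (intro mult_pos_neg) auto
  then have "\<phi>' x2 < \<phi>' x1" using x3(3) by simp
  then have "t * (1 - t) * (b - a) * \<phi>' x2 < t * (1 - t) * (b - a) * \<phi>' x1"
    using t ab by (intro mult_strict_left_mono) auto
  moreover have "(1 - t) * (\<phi> c - \<phi> a) = t * (1 - t) * (b - a) * \<phi>' x1"
    "t * (\<phi> b - \<phi> c) = t * (1 - t) * (b - a) * \<phi>' x2" by (simp_all add: x1(3) x2(3) ca bc)
  ultimately have "t * (\<phi> b - \<phi> c) < (1 - t) * (\<phi> c - \<phi> a)" by (simp only:)
  then have "(1 - t) * \<phi> a + t * \<phi> b < \<phi> c" by (simp add: algebra_simps)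
  then show ?thesis by (simp add: \<phi>_def c_def)
qed

subsection \<open>The cap cut off at an extreme point\<close>

lemma grad_cong_open:
  assumes "open S" "x \<in> S" "\<And>y. y \<in> S \<Longrightarrow> v y = w y"
  shows "grad v x = grad w x"
proof -
  have "GDERIV v x :> D \<longleftrightarrow> GDERIV w x :> D" for D
    unfolding gderiv_def using assms
    by (auto intro: has_derivative_transform_within_open[of _ _ _ _ S])
  then show ?thesis by (simp add: grad_def)
qed

text \<open>The convex hull of the graph over the sphere is compact, and it misses the extreme point
  because the epigraph without an extreme point is still convex. A hyperplane separating the two is
  the graph of the affine function sought.\<close>

lemma extreme_point_section:
  fixes u :: "'a::euclidean_space \<Rightarrow> real"
  assumes u: "convex_on \<Omega> u" and K: "cball x0 R \<subseteq> \<Omega>" and R: "R > 0"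
    and c: "continuous_on (cball x0 R) u" and ext: "(x0, u x0) extreme_point_of (epigraph \<Omega> u)"
  obtains a h where "u x0 < a + h \<bullet> x0" "\<And>x. x \<in> sphere x0 R \<Longrightarrow> a + h \<bullet> x < u x"
proof -
  define H where "H = convex hull ((\<lambda>x. (x, u x)) ` sphere x0 R)"
  have "continuous_on (sphere x0 R) (\<lambda>x. (x, u x))"
    by (intro continuous_intros continuous_on_subset[OF c]) auto
  then have "compact ((\<lambda>x. (x, u x)) ` sphere x0 R)" by (intro compact_continuous_image) auto
  then have Hc: "closed H" unfolding H_def by (intro compact_imp_closed compact_convex_hull)
  have "convex (epigraph \<Omega> u - {(x0, u x0)})"
    using ext extreme_point_of_stillconvex[OF convex_epigraphI[OF u]] by blast
  moreover have "(\<lambda>x. (x, u x)) ` sphere x0 R \<subseteq> epigraph \<Omega> u - {(x0, u x0)}"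
    using K R by (auto simp: mem_epigraph)
  ultimately have HE: "H \<subseteq> epigraph \<Omega> u - {(x0, u x0)}" unfolding H_def by (rule hull_minimal[rotated])
  then have "(x0, u x0) \<notin> H" by blast
  moreover have "convex H" unfolding H_def by (rule convex_convex_hull)
  ultimately obtain n \<beta> where n: "n \<bullet> (x0, u x0) < \<beta>" "\<And>p. p \<in> H \<Longrightarrow> \<beta> < n \<bullet> p"
    using separating_hyperplane_closed_point[OF _ Hc] by blast
  \<comment> \<open>The midpoint over two antipodal points of the sphere is a point of the hull
    vertically above the extreme point; this makes the vertical component of the normal
    positive.\<close>
  obtain i :: 'a where i: "i \<in> Basis" using nonempty_Basis by blast
  have s: "x0 + R *\<^sub>R i \<in> sphere x0 R" "x0 - R *\<^sub>R i \<in> sphere x0 R" using i R by (auto simp: dist_norm)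
  define t where "t = (u (x0 + R *\<^sub>R i) + u (x0 - R *\<^sub>R i)) / 2"
  have "(1/2) *\<^sub>R (x0 + R *\<^sub>R i, u (x0 + R *\<^sub>R i)) + (1/2) *\<^sub>R (x0 - R *\<^sub>R i, u (x0 - R *\<^sub>R i)) \<in> H"
    unfolding H_def by (rule convexD[OF convex_convex_hull hull_inc hull_inc]) (use s in auto)
  moreover have "(1/2) *\<^sub>R (x0 + R *\<^sub>R i, u (x0 + R *\<^sub>R i)) + (1/2) *\<^sub>R (x0 - R *\<^sub>R i, u (x0 - R *\<^sub>R i)) = (x0, t)"
    by (simp add: t_def algebra_simps flip: scaleR_add_left)
  ultimately have xt: "(x0, t) \<in> H" by simp
  then have "u x0 \<le> t" using HE by (auto simp: mem_epigraph)
  moreover have "snd n * u x0 < snd n * t"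
    using n(1) n(2)[OF xt] by (cases n) simp
  ultimately have sn: "snd n > 0"
    by (metis linorder_not_le mult_left_mono_neg)
  show ?thesis
  proof (rule that[of "\<beta> / snd n" "(- 1 / snd n) *\<^sub>R fst n"])
    have "snd n * u x0 < \<beta> - fst n \<bullet> x0" using n(1) by (cases n) simp
    then show "u x0 < \<beta> / snd n + ((- 1 / snd n) *\<^sub>R fst n) \<bullet> x0" using sn by (simp add: field_simps)
    fix x assume x: "x \<in> sphere x0 R"
    have "\<beta> < n \<bullet> (x, u x)" by (rule n(2)) (use x in \<open>auto simp: H_def intro: hull_inc\<close>)
    then have "\<beta> - fst n \<bullet> x < snd n * u x" by (cases n) simp
    then show "\<beta> / snd n + ((- 1 / snd n) *\<^sub>R fst n) \<bullet> x < u x" using sn by (simp add: field_simps)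
  qed
qed

text \<open>The section is lowered until it touches the graph from below. The touching point
  \<open>m\<close> minimises \<open>u\<close> minus the section and is interior, the difference
  being positive on the sphere and negative at \<open>x0\<close>; so the slope of the section is the
  gradient at \<open>m\<close>.\<close>

lemma normalized_section:
  fixes u :: "'a::euclidean_space \<Rightarrow> real"
  assumes u: "convex_on \<Omega> u" and U: "open U" "U \<subseteq> \<Omega>" "x0 \<in> U" "C1_on U u"
    and ext: "(x0, u x0) extreme_point_of (epigraph \<Omega> u)" and \<eta>: "\<eta> > 0"
  obtains R c \<zeta> m where "cball x0 R \<subseteq> U" "\<And>x. x \<in> cball x0 R \<Longrightarrow> dist (grad u x0) (grad u x) \<le> \<eta>"
    "normalized_ball x0 R (\<lambda>x. u x - (c + \<zeta> \<bullet> x)) (\<lambda>x. grad u x - \<zeta>) m" "\<zeta> = grad u m"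
proof -
  have Gc: "continuous_on U (grad u)" and dU: "\<And>x. x \<in> U \<Longrightarrow> GDERIV u x :> grad u x"
    using U(4) GDERIV_grad unfolding C1_on_def by auto
  obtain r1 where r1: "r1 > 0" "cball x0 r1 \<subseteq> U" using U open_contains_cball by blast
  obtain r2 where r2: "r2 > 0" "\<And>x. x \<in> U \<Longrightarrow> dist x x0 < r2 \<Longrightarrow> dist (grad u x) (grad u x0) < \<eta>"
    using Gc U(3) \<eta> unfolding continuous_on_iff by blast
  define R where "R = min r1 (r2 / 2)"
  have R: "R > 0" using r1 r2 by (simp add: R_def)
  have KU: "cball x0 R \<subseteq> U" using r1(2) by (auto simp: R_def)
  have uc: "continuous_on (cball x0 R) u"
    using dU KU unfolding gderiv_def by (intro continuous_at_imp_continuous_on ballI) (blast intro: has_derivative_continuous)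
  have K\<Omega>: "cball x0 R \<subseteq> \<Omega>" using KU U(2) by blast
  obtain a h where ah: "u x0 < a + h \<bullet> x0" "\<And>x. x \<in> sphere x0 R \<Longrightarrow> a + h \<bullet> x < u x"
    using extreme_point_section[OF u K\<Omega> R uc ext] by blast
  have "continuous_on (cball x0 R) (\<lambda>x. u x - (a + h \<bullet> x))" by (intro continuous_intros uc)
  from continuous_attains_inf[OF compact_cball _ this] R
  obtain m where m: "m \<in> cball x0 R" "\<And>x. x \<in> cball x0 R \<Longrightarrow> u m - (a + h \<bullet> m) \<le> u x - (a + h \<bullet> x)"
    by auto
  define c where "c = a + (u m - (a + h \<bullet> m))"
  have um: "u m - (a + h \<bullet> m) < 0" using m(2)[of x0] ah(1) R by simp
  have mB: "m \<in> ball x0 R" using ah(2)[of m] um m(1) by (cases "dist x0 m = R") auto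
  have D: "GDERIV (\<lambda>x. u x - (c + h \<bullet> x)) x :> grad u x - h" if "x \<in> U" for x
    using dU[OF that] unfolding gderiv_def
    by (auto intro!: derivative_eq_intros simp: inner_commute inner_diff_right)
  have hm: "h = grad u m"
  proof -
    have mU: "m \<in> U" using m(1) KU by blast
    have "grad u m - h = 0"
    proof (rule GDERIV_touching[OF D[OF mU] GDERIV_const[of 0] open_ball mB])
      show "0 \<le> u y - (c + h \<bullet> y)" if "y \<in> ball x0 R" for y using m(2)[of y] that by (simp add: c_def)
    qed (simp add: c_def)
    then show ?thesis by simp
  qed
  have "normalized_ball x0 R (\<lambda>x. u x - (c + h \<bullet> x)) (\<lambda>x. grad u x - h) m"
  proof
    show "R > 0" by fact
    have 1: "convex_on (cball x0 R) u" by (rule convex_on_subset[OF u K\<Omega>]) simp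
    have 2: "convex_on (cball x0 R) (\<lambda>x. - (c + h \<bullet> x))"
      by (rule convex_onI) (auto simp: inner_simps algebra_simps)
    show "convex_on (cball x0 R) (\<lambda>x. u x - (c + h \<bullet> x))"
      using convex_on_add[OF 1 2] unfolding diff_conv_add_uminus .
    show "GDERIV (\<lambda>x. u x - (c + h \<bullet> x)) x :> grad u x - h" if "x \<in> cball x0 R" for x
      using D that KU by blast
    show "continuous_on (cball x0 R) (\<lambda>x. grad u x - h)"
      by (intro continuous_intros continuous_on_subset[OF Gc KU])
    show "m \<in> ball x0 R" by fact
    show "u m - (c + h \<bullet> m) = 0" by (simp add: c_def)
    show "0 \<le> u x - (c + h \<bullet> x)" if "x \<in> cball x0 R" for x using m(2)[OF that] by (simp add: c_def)
    show "0 < u x - (c + h \<bullet> x)" if "x \<in> sphere x0 R" for x using ah(2)[OF that] um by (simp add: c_def)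
  qed
  moreover have "dist (grad u x0) (grad u x) \<le> \<eta>" if "x \<in> cball x0 R" for x
    using r2(2)[of x] that KU R r2(1) by (force simp: R_def dist_commute)
  ultimately show ?thesis using that KU hm by blast
qed

section \<open>Return to the original function\<close>

lemma competitor_on_ball:
  fixes u :: "real^2 \<Rightarrow> real"
  assumes u: "convex_on \<Omega> u" and f: "energy_finite f \<Omega> u" and \<Omega>: "\<Omega> \<in> sets lebesgue" and B: "ball b R \<subseteq> U" "U \<subseteq> \<Omega>"
    and k: "convex_on (ball b R) k" and r: "r < R" and off: "\<And>x. x \<in> ball b R - cball b r \<Longrightarrow> k x = u x"
    and close: "\<And>x. x \<in> ball b R \<Longrightarrow> \<bar>k x - u x\<bar> < \<epsilon>" and \<epsilon>: "\<epsilon> > 0"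
    and i: "set_integrable lebesgue (ball b R) (\<lambda>x. f (grad k x))"
    and less: "(LINT x:ball b R|lebesgue. f (grad k x)) < (LINT x:ball b R|lebesgue. f (grad u x))"
  shows "\<exists>u1. convex_on \<Omega> u1 \<and> (\<forall>x\<in>\<Omega> - U. u1 x = u x) \<and> (\<forall>x\<in>\<Omega>. \<bar>u x - u1 x\<bar> < \<epsilon>) \<and>
    energy_finite f \<Omega> u1 \<and> energy f \<Omega> u1 < energy f \<Omega> u"
proof -
  let ?B = "ball b R"
  define v where "v x = (if x \<in> ?B then k x else u x)" for x
  have cv: "convex_on \<Omega> v" unfolding v_def[abs_def] by (rule convex_on_glue_ball[OF u k r off])
  have gB: "grad v x = grad k x" if "x \<in> ?B" for x
    by (rule grad_cong_open[of ?B]) (use that in \<open>auto simp: v_def\<close>)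
  \<comment> \<open>On the bounding sphere, too, \<open>v\<close> agrees with \<open>u\<close>
    nearby, namely off the smaller closed ball.\<close>
  have gout: "grad v x = grad u x" if "x \<notin> ?B" for x
    by (rule grad_cong_open[of "- cball b r"]) (use that r off in \<open>auto simp: v_def\<close>)
  have split: "\<Omega> = ?B \<union> (\<Omega> - ?B)" using B by blast
  have iu: "set_integrable lebesgue \<Omega> (\<lambda>x. f (grad u x))" using f by (simp add: energy_finite_def)
  have uB: "set_integrable lebesgue ?B (\<lambda>x. f (grad u x))"
    by (rule set_integrable_subset[OF iu]) (use B in auto)
  have uR: "set_integrable lebesgue (\<Omega> - ?B) (\<lambda>x. f (grad u x))"
    by (rule set_integrable_subset[OF iu]) (use \<Omega> in auto)
  have vB: "set_integrable lebesgue ?B (\<lambda>x. f (grad v x))"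
    using i by (rule set_integrable_cong[THEN iffD1, rotated -1]) (auto simp: gB)
  have vR: "set_integrable lebesgue (\<Omega> - ?B) (\<lambda>x. f (grad v x))"
    using uR by (rule set_integrable_cong[THEN iffD1, rotated -1]) (auto simp: gout)
  have iv: "set_integrable lebesgue \<Omega> (\<lambda>x. f (grad v x))"
    by (subst split, rule set_integrable_Un[OF vB vR]) (use \<Omega> in auto)
  have e: "energy f \<Omega> w = (LINT x:?B|lebesgue. f (grad w x)) + (LINT x:\<Omega>-?B|lebesgue. f (grad w x))"
    if "set_integrable lebesgue ?B (\<lambda>x. f (grad w x))" "set_integrable lebesgue (\<Omega> - ?B) (\<lambda>x. f (grad w x))" for w
    unfolding energy_def by (subst split, rule set_integral_Un) (use that in auto)
  have "(LINT x:?B|lebesgue. f (grad v x)) = (LINT x:?B|lebesgue. f (grad k x))"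
    by (rule set_lebesgue_integral_cong) (auto simp: gB)
  moreover have "(LINT x:\<Omega>-?B|lebesgue. f (grad v x)) = (LINT x:\<Omega>-?B|lebesgue. f (grad u x))"
    by (rule set_lebesgue_integral_cong) (use \<Omega> in \<open>auto simp: gout\<close>)
  ultimately have "energy f \<Omega> v < energy f \<Omega> u" using e[OF vB vR] e[OF uB uR] less by simp
  moreover have "\<forall>x\<in>\<Omega> - U. v x = u x" using B by (auto simp: v_def)
  moreover have "\<bar>u x - v x\<bar> < \<epsilon>" for x using close[of x] \<epsilon> by (auto simp: v_def abs_minus_commute)
  ultimately show ?thesis using cv iv unfolding energy_finite_def by blast
qed

text \<open>Adding back the affine function shifts all gradients by \<zeta>, which is why the
  normalized problem is posed for the integrand \<open>f (\<zeta> + \<xi>)\<close>.\<close>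

lemma competitor_from_normalized:
  fixes u :: "real^2 \<Rightarrow> real"
  assumes N: "normalized_ball b R (\<lambda>x. u x - (c + \<zeta> \<bullet> x)) (\<lambda>x. grad u x - \<zeta>) m"
    and u: "convex_on \<Omega> u" and f: "energy_finite f \<Omega> u" and \<Omega>: "\<Omega> \<in> sets lebesgue" and B: "cball b R \<subseteq> U" "U \<subseteq> \<Omega>"
    and \<epsilon>: "\<epsilon> > 0" and fc: "continuous_on UNIV f"
    and comp: "\<exists>k r. r < R \<and> convex_on (ball b R) k \<and> (\<forall>x\<in>ball b R - cball b r. k x = u x - (c + \<zeta> \<bullet> x)) \<and>
      (\<forall>x\<in>ball b R. \<bar>k x - (u x - (c + \<zeta> \<bullet> x))\<bar> < \<epsilon>) \<and>
      set_integrable lebesgue (ball b R) (\<lambda>x. f (\<zeta> + grad k x)) \<and>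
      (LINT x:ball b R|lebesgue. f (\<zeta> + grad k x)) <
      (LINT x:ball b R|lebesgue. f (\<zeta> + C1_ball.gu b R (\<lambda>x. grad u x - \<zeta>) x))"
  shows "\<exists>u1. convex_on \<Omega> u1 \<and> (\<forall>x\<in>\<Omega> - U. u1 x = u x) \<and> (\<forall>x\<in>\<Omega>. \<bar>u x - u1 x\<bar> < \<epsilon>) \<and>
    energy_finite f \<Omega> u1 \<and> energy f \<Omega> u1 < energy f \<Omega> u"
proof -
  interpret N: normalized_ball b R "\<lambda>x. u x - (c + \<zeta> \<bullet> x)" "\<lambda>x. grad u x - \<zeta>" m by fact
  obtain k r where k: "r < R" "convex_on (ball b R) k" "\<And>x. x \<in> ball b R - cball b r \<Longrightarrow> k x = u x - (c + \<zeta> \<bullet> x)"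
    "\<And>x. x \<in> ball b R \<Longrightarrow> \<bar>k x - (u x - (c + \<zeta> \<bullet> x))\<bar> < \<epsilon>"
    "set_integrable lebesgue (ball b R) (\<lambda>x. f (\<zeta> + grad k x))"
    "(LINT x:ball b R|lebesgue. f (\<zeta> + grad k x)) < (LINT x:ball b R|lebesgue. f (\<zeta> + N.gu x))"
    using comp by (elim exE conjE) (rule that, (assumption | (erule bspec, assumption))+)
  define k' where "k' x = k x + (c + \<zeta> \<bullet> x)" for x
  have ck': "convex_on (ball b R) k'"
  proof -
    have "convex_on (ball b R) (\<lambda>x. c + \<zeta> \<bullet> x)" by (rule convex_onI) (auto simp: inner_simps algebra_simps)
    then show ?thesis unfolding k'_def by (rule convex_on_add[OF k(2)])
  qed
  have km: "(\<lambda>x. if x \<in> ball b R then grad k' x else 0) \<in> borel_measurable lebesgue"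
    by (rule borel_measurable_grad[OF ck']) auto
  \<comment> \<open>Only almost everywhere: where \<open>k\<close> is not differentiable, the values
    of \<open>grad\<close> for \<open>k\<close> and \<open>k'\<close> need not be related.\<close>
  have ae: "AE x in lebesgue. x \<in> ball b R \<longrightarrow> \<zeta> + grad k x = grad k' x"
    using AE_differentiable_convex[OF k(2) open_ball bounded_ball]
  proof eventually_elim
    case (elim x)
    show ?case
    proof
      assume "x \<in> ball b R"
      then have "GDERIV k x :> grad k x" using elim GDERIV_grad by blast
      then have "GDERIV k' x :> \<zeta> + grad k x"
        unfolding gderiv_def k'_def[abs_def]
        by (auto intro!: derivative_eq_intros simp: inner_commute inner_add_right)
      then show "\<zeta> + grad k x = grad k' x" by (simp add: grad_eqI)
    qed
  qed
  have ae': "AE x in lebesgue. indicator (ball b R) x *\<^sub>R f (\<zeta> + grad k x) = indicator (ball b R) x *\<^sub>R f (grad k' x)"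
    using ae by eventually_elim (auto simp: indicator_def)
  have m1: "(\<lambda>x. indicator (ball b R) x *\<^sub>R f (\<zeta> + grad k x)) \<in> borel_measurable lebesgue"
    using k(5) unfolding set_integrable_def by (rule borel_measurable_integrable)
  have m2: "(\<lambda>x. indicator (ball b R) x *\<^sub>R f (grad k' x)) \<in> borel_measurable lebesgue"
  proof -
    have "(\<lambda>x. indicator (ball b R) x *\<^sub>R f (if x \<in> ball b R then grad k' x else 0)) \<in> borel_measurable lebesgue"
      using measurable_compose[OF km borel_measurable_continuous_onI[OF fc]]
      by (intro borel_measurable_scaleR borel_measurable_indicator) auto
    moreover have "(\<lambda>x. indicator (ball b R) x *\<^sub>R f (if x \<in> ball b R then grad k' x else 0)) =
      (\<lambda>x. indicator (ball b R) x *\<^sub>R f (grad k' x))" by (auto simp: indicator_def fun_eq_iff)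
    ultimately show ?thesis by simp
  qed
  have I: "(LINT x:ball b R|lebesgue. f (grad k' x)) = (LINT x:ball b R|lebesgue. f (\<zeta> + grad k x))"
    unfolding set_lebesgue_integral_def by (rule integral_cong_AE[OF m1 m2 ae', symmetric])
  have J: "(LINT x:ball b R|lebesgue. f (\<zeta> + N.gu x)) = (LINT x:ball b R|lebesgue. f (grad u x))"
    by (rule set_lebesgue_integral_cong) (auto simp: N.gu_def)
  show ?thesis
  proof (rule competitor_on_ball[OF u f \<Omega> _ B(2) ck' k(1) _ _ \<epsilon>])
    show "ball b R \<subseteq> U" using B(1) by (meson ball_subset_cball order_trans)
    show "k' x = u x" if "x \<in> ball b R - cball b r" for x using k(3)[OF that] by (simp add: k'_def)
    show "\<bar>k' x - u x\<bar> < \<epsilon>" if "x \<in> ball b R" for x using k(4)[OF that] by (simp add: k'_def algebra_simps)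
    show "set_integrable lebesgue (ball b R) (\<lambda>x. f (grad k' x))"
      unfolding set_integrable_def
      by (rule integrable_cong_AE[THEN iffD1, OF m1 m2 ae']) (use k(5) in \<open>simp add: set_integrable_def\<close>)
    show "(LINT x:ball b R|lebesgue. f (grad k' x)) < (LINT x:ball b R|lebesgue. f (grad u x))"
      using k(6) by (simp only: I J)
  qed
qed

subsection \<open>The theorem\<close>

text \<open>Finite energy of \<open>u\<close> is a hypothesis because slopes may be unbounded at the
  boundary of \<Omega>; finite energy of the competitor belongs to the conclusion, so that the
  strict inequality compares genuine integrals.\<close>

theorem theorem4:
  fixes \<Omega> U :: "(real^2) set"
    and f u :: "real^2 \<Rightarrow> real"
    and x0 :: "real^2"
    and \<epsilon> :: real
  assumes "compact \<Omega>" and "convex \<Omega>" and "interior \<Omega> \<noteq> {}"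
    and "C2 f"
    and "convex_on \<Omega> u"
    and "energy_finite f \<Omega> u"
    and "open U" and "U \<subseteq> \<Omega>" and "x0 \<in> U"
    and "C1_on U u"
    and "(x0, u x0) extreme_point_of (epigraph \<Omega> u)"
    and "smallest_eigenvalue (hessian f (grad u x0)) \<noteq> 0"
    and "\<epsilon> > 0"
  shows "\<exists>u1. convex_on \<Omega> u1 \<and>
    (\<forall>x\<in>\<Omega> - U. u1 x = u x) \<and>
    (\<forall>x\<in>\<Omega>. \<bar>u x - u1 x\<bar> < \<epsilon>) \<and>
    energy_finite f \<Omega> u1 \<and> energy f \<Omega> u1 < energy f \<Omega> u"
proof -
  define \<zeta>0 where "\<zeta>0 = grad u x0"
  have fc: "continuous_on UNIV f"
    using assms(4) differentiable_imp_continuous_on unfolding C2_def differentiable_on_def by blast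
  have \<Omega>: "\<Omega> \<in> sets lebesgue" using compact_imp_closed[OF assms(1)] by simp
  have sym: "v \<bullet> (hessian f \<zeta>0 *v w) = w \<bullet> (hessian f \<zeta>0 *v v)" for v w by (rule hessian_symmetric[OF assms(4)])
  consider e where "norm e = 1" "e \<bullet> (hessian f \<zeta>0 *v e) < 0"
    | "\<And>v. v \<noteq> 0 \<Longrightarrow> 0 < v \<bullet> (hessian f \<zeta>0 *v v)"
    using negative_or_positive_definite[OF sym] assms(12) unfolding \<zeta>0_def by blast
  then show ?thesis
  proof cases
    case 1
    \<comment> \<open>\<open>e\<close> turned by a right angle: the direction from one tip to the
      other.\<close>
    define d :: "real^2" where "d = vector [- (e $ 2), e $ 1]"
    have e12: "e $ 1 * e $ 1 + e $ 2 * e $ 2 = 1"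
      using 1(1) by (simp add: norm_eq_1 inner_vec_def sum_2)
    have d: "norm d = 1" using e12 by (simp add: norm_eq_1 inner_vec_def sum_2 d_def vector_2)
    have perp: "\<xi> = (\<xi> \<bullet> e) *\<^sub>R e" if "\<xi> \<bullet> d = 0" for \<xi> :: "real^2"
    proof -
      have x: "\<xi> $ 1 * e $ 2 = \<xi> $ 2 * e $ 1" using that by (simp add: inner_vec_def sum_2 d_def vector_2)
      have "\<xi> $ 1 = \<xi> $ 1 * (e $ 1 * e $ 1 + e $ 2 * e $ 2)" "\<xi> $ 2 = \<xi> $ 2 * (e $ 1 * e $ 1 + e $ 2 * e $ 2)"
        by (simp_all add: e12)
      then have "\<xi> $ 1 = (\<xi> \<bullet> e) * e $ 1" "\<xi> $ 2 = (\<xi> \<bullet> e) * e $ 2"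
        using x by (simp_all add: inner_vec_def sum_2) (algebra+)
      then show ?thesis by (simp add: vec_eq_iff forall_2)
    qed
    obtain \<eta> where \<eta>: "\<eta> > 0" "\<And>x. x \<in> cball \<zeta>0 \<eta> \<Longrightarrow> e \<bullet> (hessian f x *v e) < 0"
      using negative_near[OF assms(4) 1(2)] by blast
    \<comment> \<open>The gradients on the ball and \<zeta> are within \<open>\<eta> / 3\<close> of
      \<open>\<zeta>0\<close>, so they differ by at most \<open>2 \<eta> / 3\<close>, and moving
      from \<zeta> along \<open>e\<close> by that much stays within \<eta> of
      \<open>\<zeta>0\<close>.\<close>
    have \<eta>3: "\<eta> / 3 > 0" using \<eta> by simp
    obtain R c \<zeta> m where R: "cball x0 R \<subseteq> U" "\<And>x. x \<in> cball x0 R \<Longrightarrow> dist \<zeta>0 (grad u x) \<le> \<eta> / 3"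
      "normalized_ball x0 R (\<lambda>x. u x - (c + \<zeta> \<bullet> x)) (\<lambda>x. grad u x - \<zeta>) m" "\<zeta> = grad u m"
      by (rule normalized_section[OF assms(5,7,8,9,10,11) \<eta>3, folded \<zeta>0_def]) (rule that)
    interpret N: normalized_ball x0 R "\<lambda>x. u x - (c + \<zeta> \<bullet> x)" "\<lambda>x. grad u x - \<zeta>" m by (rule R(3))
    have \<zeta>: "dist \<zeta>0 \<zeta> \<le> \<eta> / 3" using R(2)[OF N.mK] by (simp only: R(4))
    have neg: "e \<bullet> (hessian f (\<zeta> + s *\<^sub>R e) *v e) < 0" if "\<bar>s\<bar> \<le> 2 * \<eta> / 3" for s
    proof (rule \<eta>(2))
      have "dist \<zeta> (\<zeta> + s *\<^sub>R e) = \<bar>s\<bar>" by (simp add: dist_norm 1(1))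
      then show "\<zeta> + s *\<^sub>R e \<in> cball \<zeta>0 \<eta>" using dist_triangle[of \<zeta>0 "\<zeta> + s *\<^sub>R e" \<zeta>] \<zeta> that by simp
    qed
    have sc: "(1 - t) * f (\<zeta> + a *\<^sub>R e) + t * f (\<zeta> + b *\<^sub>R e) < f (\<zeta> + ((1 - t) * a + t * b) *\<^sub>R e)"
      if ab: "\<bar>a\<bar> \<le> 2 * \<eta> / 3" "\<bar>b\<bar> \<le> 2 * \<eta> / 3" "a < b" and t: "0 < t" "t < 1" for a b t
      by (rule strictly_concave_along[OF assms(4) _ ab t]) (rule neg)
    show ?thesis
    proof (rule competitor_from_normalized[OF R(3) assms(5,6) \<Omega> R(1) assms(8,13) fc], rule N.negative_case[OF _ _ 1(1) d perp])
      show "DIM(real^2) = 2" by simp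
      show "continuous_on UNIV (\<lambda>\<xi>. f (\<zeta> + \<xi>))"
        by (rule continuous_on_compose2[OF fc]) (auto intro: continuous_intros)
      show "(1 - t) * f (\<zeta> + a *\<^sub>R e) + t * f (\<zeta> + b *\<^sub>R e) < f (\<zeta> + ((1 - t) * a + t * b) *\<^sub>R e)"
        if "\<bar>a\<bar> \<le> 2 * \<eta> / 3" "\<bar>b\<bar> \<le> 2 * \<eta> / 3" "a \<noteq> b" "0 < t" "t < 1" for a b t
      proof (cases "a < b")
        case True then show ?thesis using sc that by blast
      next
        case False
        then have "b < a" using that by simp
        then show ?thesis using sc[of b a "1 - t"] that by (simp add: add.commute)
      qed
      show "\<bar>(grad u x - \<zeta>) \<bullet> e\<bar> \<le> 2 * \<eta> / 3" if "x \<in> cball x0 R" for x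
      proof -
        have "\<bar>(grad u x - \<zeta>) \<bullet> e\<bar> \<le> norm (grad u x - \<zeta>) * norm e" by (rule Cauchy_Schwarz_ineq2)
        also have "\<dots> = dist (grad u x) \<zeta>" by (simp add: 1(1) dist_norm)
        also have "\<dots> \<le> 2 * \<eta> / 3"
          using dist_triangle3[of "grad u x" \<zeta> \<zeta>0] \<zeta> R(2)[OF that] by simp
        finally show ?thesis .
      qed
      show "\<epsilon> > 0" by fact
    qed auto
  next
    case 2
    obtain \<eta> where \<eta>: "\<eta> > 0" "\<And>x v. x \<in> cball \<zeta>0 \<eta> \<Longrightarrow> v \<noteq> 0 \<Longrightarrow> 0 < v \<bullet> (hessian f x *v v)"
      using positive_definite_near[OF assms(4) 2] by blast
    obtain R c \<zeta> m where R: "cball x0 R \<subseteq> U" "\<And>x. x \<in> cball x0 R \<Longrightarrow> dist \<zeta>0 (grad u x) \<le> \<eta>"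
      "normalized_ball x0 R (\<lambda>x. u x - (c + \<zeta> \<bullet> x)) (\<lambda>x. grad u x - \<zeta>) m" "\<zeta> = grad u m"
      by (rule normalized_section[OF assms(5,7,8,9,10,11) \<eta>(1), folded \<zeta>0_def]) (rule that)
    interpret N: normalized_ball x0 R "\<lambda>x. u x - (c + \<zeta> \<bullet> x)" "\<lambda>x. grad u x - \<zeta>" m by (rule R(3))
    have \<zeta>: "\<zeta> \<in> cball \<zeta>0 \<eta>" using R(2)[OF N.mK] by (simp add: R(4))
    \<comment> \<open>The affine function subtracted here is the one that
      \<open>affine_invariance\<close> allows to restore at the end.\<close>
    define F where "F \<xi> = f (\<zeta> + \<xi>) - (f \<zeta> + grad f \<zeta> \<bullet> \<xi>)" for \<xi>
    show ?thesis
    proof (rule competitor_from_normalized[OF R(3) assms(5,6) \<Omega> R(1) assms(8,13) fc], rule N.positive_case[of F])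
      show "continuous_on UNIV F" unfolding F_def
        by (intro continuous_intros continuous_on_compose2[OF fc]) auto
      show "f (\<zeta> + \<xi>) = F \<xi> + (f \<zeta> + grad f \<zeta> \<bullet> \<xi>)" for \<xi> by (simp add: F_def)
      show "F 0 = 0" by (simp add: F_def)
      show "0 < F (grad u x - \<zeta>)" if "x \<in> cball x0 R" "grad u x - \<zeta> \<noteq> 0" for x
        using strictly_above_tangent[OF assms(4) \<eta>(2) \<zeta>, of "grad u x"] R(2)[OF that(1)] that(2)
        by (simp add: F_def)
      show "\<epsilon> > 0" by fact
    qed
  qed
qed

end
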